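(* There exist absolute constants $c,c'>0$ such that the following holds. Let $\epsilon\in(0,1)$ and put $\epsilon'=\epsilon/c$. Let $d,k,l$ be positive integers with $d\le \frac{k}{c'}$, $$k> d-1+2\cdot 8^{\frac{2}{l}}\frac{(6l)^{1+\frac{1}{l}}}{\epsilon'^2}\qquad\text{and}\qquad l\ge 3d+2 .$$ Then every $l$-wise independent family of hash functions $\mathcal{H}\subseteq [u]\to[u]$ is approximately $d$-$k$-min-wise independent with error bound $\epsilon$.
   Context: Let $[u]=\{0,\dots,u-1\}$. A family $\mathcal{H}$ of functions $[u]\to[u]$ is $l$-wise independent if, for $h$ chosen uniformly at random from $\mathcal{H}$, for any $l$ distinct $x_1,\dots,x_l\in[u]$ and any $v_1,\dots,v_l\in[u]$, $\Pr[h(x_1)=v_1,\dots,h(x_l)=v_l]=u^{-l}$. For a finite set $S$ of numbers, $RANK_j(S)$ denotes the $j$-th smallest element of $S$; for a function $h$ and a set $X$, $h(X)=\{h(x):x\in X\}$. A family $\mathcal{H}$ of functions $[u]\to[u]$ is called approximately $d$-$k$-min-wise independent with error bound $\epsilon\in(0,1)$ if for every $n$, every $X\subseteq[u]$ with $|X|=n-d$ and every $Y\subseteq[u]$ with $|Y|=d$ and $X\cap Y=\emptyset$ (with $d\le k$), we have $$\Pr_{h\in\mathcal{H}}\left[RANK_d(h(Y))<RANK_{k-d+1}(h(X))\right]=\frac{\binom{k}{d}}{\binom{n}{d}}(1\pm\epsilon),$$ i.e. the probability lies between $\frac{\binom{k}{d}}{\binom{n}{d}}(1-\epsilon)$ and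 $\frac{\binom{k}{d}}{\binom{n}{d}}(1+\epsilon)$, where $h$ is chosen uniformly at random from $\mathcal{H}$.
   Formalization: RANK_j counts hash values with multiplicity instead of in the set h(X), where RANK_d(h(Y)) may not exist and the bound fails for fully random h with n=u; and "for every n" is restricted to n>k, exactly when RANK_{k-d+1}(h(X)) exists. *)

theory Defs
  imports "HOL-Probability.Probability_Mass_Function"
begin

definition hash_family :: "nat \<Rightarrow> (nat \<Rightarrow> nat) set \<Rightarrow> bool" where
  "hash_family u H \<longleftrightarrow> H \<noteq> {} \<and> H \<subseteq> {..<u} \<rightarrow>\<^sub>E {..<u}"

definition wise_independent :: "nat \<Rightarrow> nat \<Rightarrow> (nat \<Rightarrow> nat) set \<Rightarrow> bool" where
  "wise_independent l u H \<longleftrightarrow> hash_family u H \<and>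
     (\<forall>x v. inj_on x {..<l} \<and> x ` {..<l} \<subseteq> {..<u} \<and> v ` {..<l} \<subseteq> {..<u} \<longrightarrow>
        measure_pmf.prob (pmf_of_set H) {h. \<forall>i<l. h (x i) = v i} = 1 / real u ^ l)"

text \<open>
  Hash values are counted with multiplicity: a hash function may collide on \<open>Y\<close>, and the
  \<open>d\<close>-th smallest element of \<open>h(Y)\<close> with \<open>|Y| = d\<close> must still exist.  (Counting only distinct values
  would moreover shift the rank in \<open>h(X)\<close> by a constant factor when \<open>|X|\<close> is comparable to \<open>u\<close>,
  even for a fully random \<open>h\<close>.)
  The index \<open>j\<close> starts at 1, and \<open>RANK j M\<close> is meaningful only for \<open>1 \<le> j \<le> size M\<close>.
\<close>

definition RANK :: "nat \<Rightarrow> nat multiset \<Rightarrow> nat" where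
  "RANK j M = sorted_list_of_multiset M ! (j - 1)"

definition hash_values :: "(nat \<Rightarrow> nat) \<Rightarrow> nat set \<Rightarrow> nat multiset" where
  "hash_values h X = image_mset h (mset_set X)"

text \<open>
  The side condition \<open>k < n\<close> says exactly that \<open>X\<close>, having \<open>n - d\<close> elements, has an element of
  rank \<open>k - d + 1\<close>.
\<close>

definition approx_min_wise_independent ::
    "nat \<Rightarrow> nat \<Rightarrow> real \<Rightarrow> nat \<Rightarrow> (nat \<Rightarrow> nat) set \<Rightarrow> bool" where
  "approx_min_wise_independent d k \<epsilon> u H \<longleftrightarrow>
     hash_family u H \<and> 0 < \<epsilon> \<and> \<epsilon> < 1 \<and> d \<le> k \<and>
     (\<forall>n X Y. k < n \<and> X \<subseteq> {..<u} \<and> card X = n - d \<and> Y \<subseteq> {..<u} \<and> card Y = d \<and> X \<inter> Y = {} \<longrightarrow>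
        measure_pmf.prob (pmf_of_set H)
            {h. RANK d (hash_values h Y) < RANK (k - d + 1) (hash_values h X)}
          \<in> {real (k choose d) / real (n choose d) * (1 - \<epsilon>) ..
             real (k choose d) / real (n choose d) * (1 + \<epsilon>)})"

end

theory Submission
  imports Defs "HOL-Analysis.Weierstrass_Theorems" "HOL-Computational_Algebra.Polynomial"
begin

text \<open>
  Write \<open>N = |X| = n - d\<close> and \<open>t = k - d\<close>. If \<open>m\<close> is the largest hash value on \<open>Y\<close>, the event says
  that at most \<open>t\<close> elements of \<open>X\<close> have hash value at most \<open>m\<close>. Conditioned on the values on \<open>Y\<close>, the number
  of these elements has the same moments up to order \<open>l - d \<ge> 2 d + 2\<close> as a binomial variable with
  parameters \<open>N\<close> and \<open>p = (m + 1) / u\<close>. For such a binomial variable the probability of the event is, up to the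
  discretisation of \<open>p\<close>, the integral of \<open>d p\<^bsup>d-1\<^esup> P(Bin(N, p) \<le> t)\<close>, which equals
  \<open>(k choose d) / (n choose d)\<close> exactly.

  The difference is controlled by polynomials of degree at most \<open>2 d + 2\<close> above and below the
  indicator of \<open>{..t}\<close>. If \<open>N p\<close> is far from \<open>t\<close>, a power of \<open>(x - N p) / (t - N p)\<close> suffices. Near
  \<open>t\<close>, a fluctuation bound alone loses a factor of order \<open>sqrt d\<close>; instead, a single pair of polynomials
  is used for all \<open>p\<close>. Averaging its gap over \<open>p\<close> turns the binomial weights into the weights
  \<open>(j + d - 1 choose d - 1)\<close>, so the gap only has to be summable against these. It is built
  from a polynomial with Lorentzian profile of width \<open>1 / d\<close> (a divided difference of a Chebyshev
  polynomial), multiplied by an exponential tilt that cancels the growth of the weights. The total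
  relative error is of order \<open>sqrt (d / t)\<close>, hence of order \<open>\<epsilon>\<close>.
\<close>

section \<open>Bernstein polynomials and binomial moments\<close>

text \<open>All scales come from the degree 2 d + 2, which is what l >= 3 d + 2 leaves for X once Y
  has used d values. Central moments of that order see deviations of size \<open>sigma\<close> =
  sqrt (d t). Far from t, put M = max (N p) t: the density contributes M^(d-1) and the moment
  M^(d+1), so division by (t - N p)^(2 d + 2) leaves a spare factor 1 / (t - N p)^2, just enough to
  sum over p. Near t, a window of width w in N p has relative mass about d w / t. The natural
  fluctuation w = sqrt t would cost d / sqrt t. A polynomial of degree of order d on an interval of
  length of order \<open>sigma\<close> resolves a jump at width sigma / d = sqrt (t / d), which
  costs only sqrt (d / t). This width is below the binomial fluctuation, so the gain appears only
  after averaging over p. Across the window the averaged weights may change by a factor exponential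
  in d sigma / t, which is unbounded as d grows; this forces the tilt.\<close>

text \<open>Each term is compared with an increment of arctan((x - c) / W) / W over a unit interval.
  Since W >= 1, the summand varies there by a factor of at most 3; arctan increases by at most pi in
  total, and 3 pi <= 10.\<close>

lemma sum_Lorentzian_le:
  fixes c W :: real and I :: "nat set"
  assumes "W \<ge> 1" "finite I"
  shows "(\<Sum>i\<in>I. 1 / (W\<^sup>2 + (real i - c)\<^sup>2)) \<le> 10 / W"
proof -
  define g where "g = (\<lambda>x::real. arctan ((x - c) / W))"
  have step: "1 / (W\<^sup>2 + (real i - c)\<^sup>2) \<le> 3 / W * (g (real (Suc i)) - g (real i))" for i
  proof -
    have D: "(g has_real_derivative W / (W\<^sup>2 + (x - c)\<^sup>2)) (at x)" for x
    proof -
      have "(g has_real_derivative (1 / W) / (1 + ((x - c) / W)\<^sup>2)) (at x)"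
        unfolding g_def using assms by (auto intro!: derivative_eq_intros simp: field_simps)
      moreover have "(1 / W) / (1 + ((x - c) / W)\<^sup>2) = W / (W\<^sup>2 + (x - c)\<^sup>2)"
        using assms by (simp add: divide_simps power2_eq_square)
      ultimately show ?thesis by simp
    qed
    obtain z where z: "real i < z" "z < real (Suc i)"
      "g (real (Suc i)) - g (real i) = (real (Suc i) - real i) * (W / (W\<^sup>2 + (z - c)\<^sup>2))"
      using MVT2[of "real i" "real (Suc i)" g "\<lambda>x. W / (W\<^sup>2 + (x - c)\<^sup>2)"] D by auto
    define a where "a = real i - c"
    define e where "e = z - real i"
    have e: "0 < e" "e < 1" using z unfolding e_def by auto
    have zc: "z - c = a + e" unfolding a_def e_def by simp
    have e2: "e\<^sup>2 \<le> 1" using e by (simp add: power_le_one)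
    have W2: "W\<^sup>2 \<ge> 1" using assms by simp
    have "0 \<le> (a - e)\<^sup>2" by simp
    then have "(a + e)\<^sup>2 \<le> 2 * a\<^sup>2 + 2 * e\<^sup>2" by (simp add: power2_eq_square algebra_simps)
    also have "\<dots> \<le> 3 * a\<^sup>2 + 2 * W\<^sup>2" using e2 W2 zero_le_power2[of a] by linarith
    finally have le: "W\<^sup>2 + (a + e)\<^sup>2 \<le> 3 * (W\<^sup>2 + a\<^sup>2)" by (simp add: algebra_simps)
    have pos: "W\<^sup>2 + y\<^sup>2 > 0" for y using assms by (simp add: add_pos_nonneg)
    have "1 / (W\<^sup>2 + a\<^sup>2) \<le> 3 / (W\<^sup>2 + (a + e)\<^sup>2)"
      using le pos[of a] pos[of "a + e"] by (simp add: field_simps)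
    also have "\<dots> = 3 / W * (W / (W\<^sup>2 + (a + e)\<^sup>2))" using assms by simp
    finally show ?thesis using z(3) zc unfolding a_def by simp
  qed
  obtain b where b: "I \<subseteq> {..<b}" using assms(2) finite_nat_bounded by blast
  have "(\<Sum>i\<in>I. 1 / (W\<^sup>2 + (real i - c)\<^sup>2)) \<le> (\<Sum>i<b. 1 / (W\<^sup>2 + (real i - c)\<^sup>2))"
    by (rule sum_mono2) (use b in auto)
  also have "\<dots> \<le> (\<Sum>i<b. 3 / W * (g (real (Suc i)) - g (real i)))"
    by (rule sum_mono) (rule step)
  also have "\<dots> = 3 / W * (g (real b) - g 0)"
    unfolding sum_distrib_left[symmetric] sum_lessThan_telescope[of "\<lambda>i. g (real i)"] by simp
  also have "\<dots> \<le> 3 / W * pi"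
    using arctan_ubound[of "(real b - c) / W"] arctan_lbound[of "(0 - c) / W"] assms
    unfolding g_def by (intro mult_left_mono) (auto simp: field_simps)
  also have "\<dots> \<le> 10 / W" using pi_less_4 pi_approx assms by (simp add: field_simps)
  finally show ?thesis .
qed

text \<open>Stands in for the comparison of two integrals: below, all antiderivatives are at hand,
  so no integral is ever formed.\<close>

lemma has_derivative_le_imp_diff_le:
  fixes f g :: "real \<Rightarrow> real"
  assumes "a \<le> b"
    and "\<And>x. a \<le> x \<Longrightarrow> x \<le> b \<Longrightarrow> (f has_real_derivative f' x) (at x)"
    and "\<And>x. a \<le> x \<Longrightarrow> x \<le> b \<Longrightarrow> (g has_real_derivative g' x) (at x)"
    and "\<And>x. a \<le> x \<Longrightarrow> x \<le> b \<Longrightarrow> f' x \<le> g' x"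
  shows "f b - f a \<le> g b - g a"
proof -
  have "g a - f a \<le> g b - f b"
  proof (rule DERIV_nonneg_imp_nondecreasing[OF assms(1), of "\<lambda>x. g x - f x"])
    fix x assume x: "a \<le> x" "x \<le> b"
    show "\<exists>y. ((\<lambda>x. g x - f x) has_real_derivative y) (at x) \<and> 0 \<le> y"
      using DERIV_diff[OF assms(3)[OF x] assms(2)[OF x]] assms(4)[OF x] by auto
  qed
  then show ?thesis by simp
qed

section \<open>Derivatives, monotonicity and Riemann sums of Bernstein polynomials\<close>

definition Bernstein_cdf :: "nat \<Rightarrow> nat \<Rightarrow> real \<Rightarrow> real" where
  "Bernstein_cdf n j x = (\<Sum>i\<le>j. Bernstein n i x)"

lemma Bernstein_eq_0: "n < j \<Longrightarrow> Bernstein n j x = 0"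
  by (simp add: Bernstein_def)

lemma Bernstein_0_has_derivative:
  "(Bernstein (Suc n) 0 has_real_derivative - real (Suc n) * Bernstein n 0 x) (at x)"
proof -
  have "Bernstein (Suc n) 0 = (\<lambda>x. (1 - x) ^ Suc n)" by (auto simp: Bernstein_def)
  moreover have "((\<lambda>x::real. (1 - x) ^ Suc n) has_real_derivative
      real (Suc n) * ((- 1) * (1 - x) ^ n)) (at x)"
    by (rule DERIV_cong, rule DERIV_power_Suc, auto intro!: derivative_eq_intros)
  moreover have "real (Suc n) * ((- 1) * (1 - x) ^ n) = - real (Suc n) * Bernstein n 0 x"
    by (simp add: Bernstein_def algebra_simps)
  ultimately show ?thesis by metis
qed

lemma Bernstein_Suc_has_derivative:
  "(Bernstein (Suc n) (Suc j) has_real_derivative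
      real (Suc n) * (Bernstein n j x - Bernstein n (Suc j) x)) (at x)"
proof (cases "j \<le> n")
  case True
  have D: "(Bernstein (Suc n) (Suc j) has_real_derivative
      real (Suc n choose Suc j) * (real (Suc j) * x ^ j * (1 - x) ^ (n - j)
        - x ^ Suc j * (real (n - j) * (1 - x) ^ (n - j - 1)))) (at x)"
    unfolding Bernstein_def
    by (rule derivative_eq_intros refl | simp)+ (simp add: algebra_simps)
  have 1: "real (Suc n choose Suc j) * real (Suc j) = real (Suc n) * real (n choose j)"
    by (metis Suc_times_binomial mult.commute of_nat_mult)
  have 2: "real (Suc n choose Suc j) * real (n - j) = real (Suc n) * real (n choose Suc j)"
    using binomial_absorb_comp[of "Suc n" "Suc j"]
    by (metis diff_Suc_Suc diff_Suc_1 mult.commute of_nat_mult)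
  have "real (Suc n choose Suc j) * (real (Suc j) * x ^ j * (1 - x) ^ (n - j)
        - x ^ Suc j * (real (n - j) * (1 - x) ^ (n - j - 1)))
      = (real (Suc n choose Suc j) * real (Suc j)) * x ^ j * (1 - x) ^ (n - j)
        - (real (Suc n choose Suc j) * real (n - j)) * x ^ Suc j * (1 - x) ^ (n - j - 1)"
    by (simp only: algebra_simps)
  also have "\<dots> = real (Suc n) * (Bernstein n j x - Bernstein n (Suc j) x)"
    unfolding 1 2 Bernstein_def by (simp add: algebra_simps)
  finally show ?thesis using D by metis
next
  case False
  then have "Bernstein (Suc n) (Suc j) = (\<lambda>x. 0)" by (auto simp: Bernstein_eq_0)
  then show ?thesis using False by (simp add: Bernstein_eq_0)
qed

text \<open>The derivatives of the summands telescope and only the last survives. Up to sign it is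
  the density of the (j + 1)-st smallest of n + 1 uniform variables, which is how order statistics
  enter.\<close>

lemma Bernstein_cdf_has_derivative:
  "(Bernstein_cdf (Suc n) j has_real_derivative - real (Suc n) * Bernstein n j x) (at x)"
proof (induction j)
  case 0
  then show ?case using Bernstein_0_has_derivative[of n x] by (simp add: Bernstein_cdf_def[abs_def])
next
  case (Suc j)
  have "Bernstein_cdf (Suc n) (Suc j) = (\<lambda>x. Bernstein_cdf (Suc n) j x + Bernstein (Suc n) (Suc j) x)"
    by (auto simp: Bernstein_cdf_def)
  then show ?case
    using DERIV_add[OF Suc Bernstein_Suc_has_derivative[of n j x]] by (simp add: algebra_simps)
qed

lemma Bernstein_cdf_0 [simp]: "Bernstein_cdf n j 0 = 1"
  by (simp add: Bernstein_cdf_def Bernstein_def power_0_left if_distrib if_distribR sum.If_cases cong: if_cong)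

lemma Bernstein_cdf_1 [simp]: "j < n \<Longrightarrow> Bernstein_cdf n j 1 = 0"
  by (auto simp: Bernstein_cdf_def Bernstein_def power_0_left)

lemma Bernstein_cdf_antimono:
  assumes "0 \<le> x" "x \<le> y" "y \<le> 1"
  shows "Bernstein_cdf n j y \<le> Bernstein_cdf n j x"
proof (cases n)
  case 0
  have "Bernstein_cdf 0 j z = 1" for z
  proof -
    have "Bernstein_cdf 0 j z = (\<Sum>i\<in>{0}. Bernstein 0 i z)"
      unfolding Bernstein_cdf_def by (rule sum.mono_neutral_right) (auto simp: Bernstein_eq_0)
    then show ?thesis by (simp add: Bernstein_def)
  qed
  then show ?thesis using 0 by simp
next
  case (Suc n')
  show ?thesis unfolding Suc
  proof (rule DERIV_nonpos_imp_nonincreasing[OF assms(2)])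
    fix z assume "x \<le> z" "z \<le> y"
    then show "\<exists>D. (Bernstein_cdf (Suc n') j has_real_derivative D) (at z) \<and> D \<le> 0"
      using Bernstein_cdf_has_derivative[of n' j z] Bernstein_nonneg[of z n' j] assms
      by (intro exI[of _ "- real (Suc n') * Bernstein n' j z"] conjI)
         (auto intro!: mult_nonpos_nonneg simp del: of_nat_Suc)
  qed
qed

text \<open>The integral is 1 / (n + 1), so the sum over right endpoints may exceed it by as much
  again. Write the polynomial as the decreasing \<open>Bernstein_cdf n j\<close> plus the increasing
  \<open>V\<close>. Only \<open>V\<close> makes right endpoints too large; it rises by at most 1 in
  total, so the excess is at most 1 / u.\<close>

lemma Bernstein_Riemann_sum_le:
  assumes "n < u"
  shows "(\<Sum>i=1..u. Bernstein n j (real i / real u)) / real u \<le> 2 / real (Suc n)"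
proof (cases "j \<le> n")
  case False
  then show ?thesis by (simp add: Bernstein_eq_0)
next
  case True
  have u: "real u > 0" using assms by simp
  define V where "V = (\<lambda>x. - (\<Sum>i<j. Bernstein n i x))"
  define B where "B = (\<lambda>x. - Bernstein_cdf (Suc n) j x / real (Suc n))"
  have Vmono: "V x \<le> V y" if "0 \<le> x" "x \<le> y" "y \<le> 1" for x y
  proof (cases j)
    case (Suc j')
    then show ?thesis using Bernstein_cdf_antimono[OF that, of n j']
      by (simp add: V_def Bernstein_cdf_def lessThan_Suc_atMost)
  qed (simp add: V_def)
  have bV: "Bernstein n j x = Bernstein_cdf n j x + V x" for x
    by (simp add: V_def Bernstein_cdf_def lessThan_Suc_atMost[symmetric])
  have step: "Bernstein n j (real (Suc i) / real u) / real u
      \<le> (B (real (Suc i) / real u) - B (real i / real u))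
        + (V (real (Suc i) / real u) - V (real i / real u)) / real u" if i: "i < u" for i
  proof -
    define x where "x = real i / real u"
    define y where "y = real (Suc i) / real u"
    have xy: "0 \<le> x" "x < y" "y \<le> 1" "y - x = 1 / real u"
      using i u by (auto simp: x_def y_def field_simps)
    have D: "(B has_real_derivative Bernstein n j z) (at z)" for z
    proof -
      have "(B has_real_derivative - (- real (Suc n) * Bernstein n j z) / real (Suc n)) (at z)"
        unfolding B_def by (intro DERIV_cdivide DERIV_minus Bernstein_cdf_has_derivative)
      then show ?thesis by (simp del: of_nat_Suc)
    qed
    obtain z where z: "x < z" "z < y" "B y - B x = (y - x) * Bernstein n j z"
      using MVT2[OF xy(2), of B "Bernstein n j"] D by auto
    have "Bernstein n j y - Bernstein n j z \<le> V y - V z"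
      using Bernstein_cdf_antimono[of z y n j] z xy by (simp add: bV)
    also have "\<dots> \<le> V y - V x" using Vmono[of x z] z xy by simp
    finally have "Bernstein n j y / real u \<le> (Bernstein n j z + (V y - V x)) / real u"
      using u by (intro divide_right_mono) auto
    also have "\<dots> = (B y - B x) + (V y - V x) / real u"
      using z(3) xy(4) by (simp add: add_divide_distrib)
    finally show ?thesis by (simp add: x_def y_def)
  qed
  have "(\<Sum>i=1..u. Bernstein n j (real i / real u)) / real u
      = (\<Sum>i<u. Bernstein n j (real (Suc i) / real u) / real u)"
    by (simp add: sum.atLeast1_atMost_eq sum_divide_distrib)
  also have "\<dots> \<le> (\<Sum>i<u. (B (real (Suc i) / real u) - B (real i / real u))
        + (V (real (Suc i) / real u) - V (real i / real u)) / real u)"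
    by (rule sum_mono) (rule step, simp)
  also have "\<dots> = (B 1 - B 0) + (V 1 - V 0) / real u"
    unfolding sum.distrib sum_divide_distrib[symmetric]
      sum_lessThan_telescope[of "\<lambda>i. B (real i / real u)"]
      sum_lessThan_telescope[of "\<lambda>i. V (real i / real u)"] using u by simp
  also have "B 1 - B 0 = 1 / real (Suc n)"
    using True by (simp add: B_def)
  finally have le: "(\<Sum>i=1..u. Bernstein n j (real i / real u)) / real u
      \<le> 1 / real (Suc n) + (V 1 - V 0) / real u" .
  have "V 1 - V 0 \<le> 1"
  proof (cases j)
    case (Suc j')
    then have "V 1 = - Bernstein_cdf n j' 1" "V 0 = - Bernstein_cdf n j' 0"
      by (simp_all only: V_def Bernstein_cdf_def lessThan_Suc_atMost)
    then show ?thesis using Suc True by simp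
  qed (simp add: V_def)
  then have "(V 1 - V 0) / real u \<le> 1 / real u" using u by (intro divide_right_mono) auto
  moreover have "1 / real u \<le> 1 / real (Suc n)"
    using assms by (intro frac_le) auto
  ultimately show ?thesis using le by simp
qed

text \<open>Choosing i + r successes and r of them is choosing the r first; what remains is the
  total mass of a binomial distribution with n - r trials.\<close>

lemma Bernstein_binomial_moment:
  "(\<Sum>j\<le>n. Bernstein n j p * real (j choose r)) = real (n choose r) * p ^ r"
proof (cases "r \<le> n")
  case True
  have "(\<Sum>j\<le>n. Bernstein n j p * real (j choose r)) = (\<Sum>j=r..n. Bernstein n j p * real (j choose r))"
    by (rule sum.mono_neutral_right) auto
  also have "\<dots> = (\<Sum>i\<le>n - r. Bernstein n (i + r) p * real ((i + r) choose r))"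
    by (rule sum.reindex_bij_witness[of _ "\<lambda>i. i + r" "\<lambda>j. j - r"]) (use True in auto)
  also have "\<dots> = (\<Sum>i\<le>n - r. real (n choose r) * p ^ r * Bernstein (n - r) i p)"
  proof (rule sum.cong[OF refl])
    fix i assume "i \<in> {..n - r}"
    then have i: "i + r \<le> n" using True by auto
    have "real (n choose (i + r)) * real ((i + r) choose r) = real (n choose r) * real ((n - r) choose i)"
      using choose_mult[of r "i + r" n] i by (metis add_diff_cancel_right' le_add2 of_nat_mult)
    moreover have "n - (i + r) = n - r - i" by simp
    moreover have "Bernstein n (i + r) p * real ((i + r) choose r)
      = (real (n choose (i + r)) * real ((i + r) choose r)) * p ^ r * (p ^ i * (1 - p) ^ (n - (i + r)))"
      unfolding Bernstein_def by (simp add: power_add)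
    ultimately show "Bernstein n (i + r) p * real ((i + r) choose r)
        = real (n choose r) * p ^ r * Bernstein (n - r) i p"
      unfolding Bernstein_def by (simp only: mult_ac)
  qed
  finally show ?thesis by (simp add: sum_distrib_left[symmetric])
next
  case False
  then show ?thesis by (simp add: binomial_eq_0)
qed

section \<open>Exponential and central moments of binomial variables\<close>

lemma exp_le_quadratic:
  fixes x :: real
  assumes "\<bar>x\<bar> \<le> 1"
  shows "exp x \<le> 1 + x + x\<^sup>2"
proof (cases "x \<ge> 0")
  case True
  then show ?thesis using exp_bound assms by simp
next
  case False
  define y where "y = - x"
  have y: "0 < y" "y \<le> 1" using False assms by (auto simp: y_def)
  \<comment> \<open>Multiplication by 1 + y, which is at most exp y, reduces the claim to 1 <= 1 +
    y^3.\<close>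
  have "1 \<le> 1 + y * y * y" using y by simp
  also have "\<dots> = (1 - y + y\<^sup>2) * (1 + y)" by (simp add: power2_eq_square algebra_simps)
  also have "\<dots> \<le> (1 - y + y\<^sup>2) * exp y"
    using y exp_ge_add_one_self[of y] by (intro mult_left_mono) auto
  finally have "exp (- y) \<le> 1 - y + y\<^sup>2" by (simp add: exp_minus field_simps)
  then show ?thesis by (simp add: y_def)
qed

lemma Bernstein_mgf_le:
  assumes p: "0 \<le> p" "p \<le> 1" and s: "\<bar>s\<bar> \<le> 1"
  shows "(\<Sum>j\<le>n. Bernstein n j p * exp (s * (real j - real n * p))) \<le> exp (real n * p * s\<^sup>2)"
proof -
  have "(\<Sum>j\<le>n. Bernstein n j p * exp (s * (real j - real n * p)))
      = exp (- (s * real n * p)) * (\<Sum>j\<le>n. real (n choose j) * (p * exp s) ^ j * (1 - p) ^ (n - j))"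
    unfolding sum_distrib_left
    by (intro sum.cong refl)
       (simp add: Bernstein_def power_mult_distrib exp_of_nat_mult[symmetric] algebra_simps
          exp_add[symmetric] exp_diff exp_minus divide_inverse)
  also have "(\<Sum>j\<le>n. real (n choose j) * (p * exp s) ^ j * (1 - p) ^ (n - j)) = (p * exp s + (1 - p)) ^ n"
    by (simp add: binomial_ring)
  also have "\<dots> \<le> exp (p * (s + s\<^sup>2)) ^ n"
  proof (rule power_mono)
    have "p * exp s + (1 - p) \<le> p * (1 + s + s\<^sup>2) + (1 - p)"
      using exp_le_quadratic[OF s] p by (intro add_right_mono mult_left_mono) auto
    also have "\<dots> = 1 + p * (s + s\<^sup>2)" by (simp add: algebra_simps)
    also have "\<dots> \<le> exp (p * (s + s\<^sup>2))" by (rule exp_ge_add_one_self)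
    finally show "p * exp s + (1 - p) \<le> exp (p * (s + s\<^sup>2))" .
    show "0 \<le> p * exp s + (1 - p)" using p by simp
  qed
  also have "exp (- (s * real n * p)) * exp (p * (s + s\<^sup>2)) ^ n = exp (real n * p * s\<^sup>2)"
    by (simp add: exp_of_nat_mult[symmetric] exp_add[symmetric] algebra_simps)
  finally show ?thesis by simp
qed

text \<open>The exponent n - 1 leaves a factor n to spare. For n = 2 m it absorbs the 2 that arises
  when an even power is bounded by two exponentials.\<close>

lemma fact_le_power_pred: "n \<ge> 1 \<Longrightarrow> (fact n :: real) \<le> real n ^ (n - 1)"
proof (induction n rule: nat_induct_at_least)
  case (Suc n)
  have "(fact (Suc n) :: real) \<le> real (Suc n) * real n ^ (n - 1)"
    using Suc.IH by (simp add: fact_Suc mult_left_mono del: of_nat_Suc)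
  also have "\<dots> \<le> real (Suc n) * real (Suc n) ^ (n - 1)"
    by (intro mult_left_mono power_mono) auto
  also have "\<dots> = real (Suc n) ^ n" using Suc.hyps by (cases n) auto
  finally show ?case by simp
qed simp

lemma power_le_fact_exp:
  fixes y :: real
  assumes "even k"
  shows "y ^ k \<le> fact k * (exp y + exp (- y))"
proof -
  have *: "z ^ k / fact k \<le> exp z" if "z \<ge> 0" for z :: real
  proof -
    have "(\<Sum>i\<in>{k}. z ^ i /\<^sub>R fact i) \<le> (\<Sum>i. z ^ i /\<^sub>R fact i)"
      by (rule sum_le_suminf[OF summable_exp_generic]) (use that in auto)
    then show ?thesis by (simp add: exp_def divide_inverse mult.commute)
  qed
  have "y ^ k = \<bar>y\<bar> ^ k" using assms by (simp add: power_even_abs)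
  also have "\<dots> \<le> fact k * exp \<bar>y\<bar>" using *[of "\<bar>y\<bar>"] by (simp add: field_simps)
  also have "\<dots> \<le> fact k * (exp y + exp (- y))" by (intro mult_left_mono) (auto simp: abs_if)
  finally show ?thesis .
qed

lemma Bernstein_central_moment_le:
  assumes p: "0 \<le> p" "p \<le> 1" and m: "m \<ge> 1" and M: "real n * p \<le> M" "real m \<le> M"
  shows "(\<Sum>j\<le>n. Bernstein n j p * (real j - real n * p) ^ (2 * m)) \<le> (12 * real m * M) ^ m"
proof -
  \<comment> \<open>With s^2 = m / M the generating function is at most exp m <= 3^m, and m <= M
    ensures s <= 1. Dividing (2 m)^(2 m) * 3^m by s^(2 m) gives the constant 12 = 4 * 3.\<close>
  define s where "s = sqrt (real m / M)"
  have Mpos: "M > 0" "real m > 0" using M m by auto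
  have s2: "s\<^sup>2 = real m / M" using Mpos by (simp add: s_def)
  have s: "s > 0" "s \<le> 1" using Mpos M by (auto simp: s_def)
  have sm: "s ^ (2 * m) = (real m / M) ^ m" by (simp add: power_mult s2)
  have "s ^ (2 * m) * (\<Sum>j\<le>n. Bernstein n j p * (real j - real n * p) ^ (2 * m))
      = (\<Sum>j\<le>n. Bernstein n j p * (s * (real j - real n * p)) ^ (2 * m))"
    unfolding sum_distrib_left power_mult_distrib by (simp add: mult_ac)
  also have "\<dots> \<le> (\<Sum>j\<le>n. Bernstein n j p * (fact (2 * m) *
      (exp (s * (real j - real n * p)) + exp (- (s * (real j - real n * p))))))"
    by (intro sum_mono mult_left_mono power_le_fact_exp) (use p in \<open>auto simp: Bernstein_nonneg\<close>)
  also have "\<dots> = fact (2 * m) * ((\<Sum>j\<le>n. Bernstein n j p * exp (s * (real j - real n * p)))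
      + (\<Sum>j\<le>n. Bernstein n j p * exp ((- s) * (real j - real n * p))))"
    unfolding sum_distrib_left sum.distrib[symmetric] by (intro sum.cong refl) (simp add: algebra_simps)
  also have "\<dots> \<le> fact (2 * m) * (exp (real n * p * s\<^sup>2) + exp (real n * p * (- s)\<^sup>2))"
    by (intro mult_left_mono add_mono Bernstein_mgf_le) (use p s in auto)
  also have "\<dots> = 2 * fact (2 * m) * exp (real n * p * s\<^sup>2)" by simp
  also have "\<dots> \<le> real (2 * m) ^ (2 * m) * 3 ^ m"
  proof (rule mult_mono)
    have "2 * fact (2 * m) \<le> real (2 * m) * real (2 * m) ^ (2 * m - 1)"
      using fact_le_power_pred[of "2 * m"] m by (intro mult_mono) auto
    also have "\<dots> = real (2 * m) ^ (2 * m)"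
      using power_minus_mult[of "2 * m" "real (2 * m)"] m by (simp only: mult.commute)
    finally show "2 * fact (2 * m) \<le> real (2 * m) ^ (2 * m)" .
    have "real n * p * s\<^sup>2 \<le> M * s\<^sup>2" using M by (intro mult_right_mono) auto
    also have "\<dots> = real m" using Mpos by (simp add: s2)
    finally have "exp (real n * p * s\<^sup>2) \<le> exp (real m * 1)" by simp
    also have "\<dots> = exp 1 ^ m" by (rule exp_of_nat_mult)
    also have "\<dots> \<le> 3 ^ m" using exp_le by (intro power_mono) auto
    finally show "exp (real n * p * s\<^sup>2) \<le> 3 ^ m" .
  qed auto
  finally have "(real m / M) ^ m * (\<Sum>j\<le>n. Bernstein n j p * (real j - real n * p) ^ (2 * m))
      \<le> real (2 * m) ^ (2 * m) * 3 ^ m" by (simp add: sm)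
  also have "\<dots> = (real m / M) ^ m * (12 * real m * M) ^ m"
  proof -
    have "real m / M * (12 * real m * M) = (real (2 * m))\<^sup>2 * 3"
      using Mpos by (simp add: power2_eq_square)
    then have "(real m / M) ^ m * (12 * real m * M) ^ m = ((real (2 * m))\<^sup>2 * 3) ^ m"
      by (simp only: power_mult_distrib[symmetric])
    then show ?thesis by (simp only: power_mult_distrib power_mult)
  qed
  finally show ?thesis by (rule mult_left_le_imp_le) (use Mpos in simp)
qed

section \<open>Polynomials sandwiching a step function\<close>

fun Chebyshev :: "nat \<Rightarrow> real poly" where
  "Chebyshev 0 = 1"
| "Chebyshev (Suc 0) = [:0, 1:]"
| "Chebyshev (Suc (Suc n)) = [:0, 2:] * Chebyshev (Suc n) - Chebyshev n"

lemma degree_Chebyshev: "degree (Chebyshev n) \<le> n"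
proof (induction n rule: Chebyshev.induct)
  case (3 n)
  have "degree ([:0, 2:] * Chebyshev (Suc n)) \<le> 1 + Suc n"
    using degree_mult_le[of "[:0, 2:]" "Chebyshev (Suc n)"] 3 by auto
  then show ?case using 3 by (auto intro!: degree_diff_le)
qed auto

lemma poly_Chebyshev_cos: "poly (Chebyshev n) (cos \<theta>) = cos (real n * \<theta>)"
proof (induction n rule: Chebyshev.induct)
  case (3 n)
  have "cos (real (Suc (Suc n)) * \<theta>) + cos (real n * \<theta>) = 2 * cos (real (Suc n) * \<theta>) * cos \<theta>"
    using cos_add[of "real (Suc n) * \<theta>" \<theta>] cos_diff[of "real (Suc n) * \<theta>" \<theta>]
    by (simp add: algebra_simps)
  then show ?case using 3 by (simp add: algebra_simps)
qed auto

lemma abs_Chebyshev_le_1: "\<bar>x\<bar> \<le> 1 \<Longrightarrow> \<bar>poly (Chebyshev n) x\<bar> \<le> 1"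
  using poly_Chebyshev_cos[of n "arccos x"] by (simp add: cos_arccos_abs)

lemma Chebyshev_ge:
  assumes "h \<ge> 0"
  shows "1 + (real n)\<^sup>2 * h \<le> poly (Chebyshev n) (1 + h)"
proof -
  \<comment> \<open>The increments are carried along: the recurrence says that each increment
    exceeds the previous one by 2 h times a value that is at least 1, and the numbers 2 n + 1 sum to
    squares.\<close>
  have "1 + (real n)\<^sup>2 * h \<le> poly (Chebyshev n) (1 + h) \<and>
      (2 * real n + 1) * h \<le> poly (Chebyshev (Suc n)) (1 + h) - poly (Chebyshev n) (1 + h)"
  proof (induction n)
    case (Suc n)
    let ?a = "poly (Chebyshev n) (1 + h)" and ?b = "poly (Chebyshev (Suc n)) (1 + h)"
    have b: "1 + (real (Suc n))\<^sup>2 * h \<le> ?b" using Suc by (simp add: power2_eq_square algebra_simps)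
    moreover have "0 \<le> (real (Suc n))\<^sup>2 * h" using assms by simp
    ultimately have "1 \<le> ?b" by linarith
    then have "h * 1 \<le> h * ?b" using assms by (intro mult_left_mono)
    then show ?case using b Suc by (simp add: algebra_simps)
  qed simp
  then show ?thesis ..
qed

lemma abs_Chebyshev_le_power:
  assumes "\<bar>x\<bar> \<ge> 1"
  shows "\<bar>poly (Chebyshev n) x\<bar> \<le> (3 * \<bar>x\<bar>) ^ n"
proof (induction n rule: Chebyshev.induct)
  case (3 n)
  let ?y = "3 * \<bar>x\<bar>"
  have "\<bar>poly (Chebyshev (Suc (Suc n))) x\<bar>
      \<le> 2 * \<bar>x\<bar> * \<bar>poly (Chebyshev (Suc n)) x\<bar> + \<bar>poly (Chebyshev n) x\<bar>"
    using abs_triangle_ineq4[of "x * (2 * poly (Chebyshev (Suc n)) x)" "poly (Chebyshev n) x"]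
    by (simp add: abs_mult mult_ac)
  also have "\<dots> \<le> 2 * \<bar>x\<bar> * ?y ^ Suc n + ?y ^ n"
    using 3 by (intro add_mono mult_left_mono) auto
  also have "\<dots> = ?y ^ n * (6 * \<bar>x\<bar> * \<bar>x\<bar> + 1)" by (simp add: algebra_simps)
  also have "\<dots> \<le> ?y ^ n * (9 * \<bar>x\<bar> * \<bar>x\<bar>)"
    using mult_mono[OF assms assms] by (intro mult_left_mono) auto
  also have "\<dots> = ?y ^ Suc (Suc n)" by simp
  finally show ?case .
qed (use assms in auto)

text \<open>The kernel is the divided difference of a Chebyshev polynomial at the point
  \<open>1 + 2 / n\<^sup>2\<close>, composed with \<open>x \<mapsto> 1 - 2 x\<^sup>2\<close>: the node lies off \<open>[-1, 1]\<close> far enough for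
  the numerator to be bounded away from 0.\<close>

lemma Lorentzian_kernel:
  assumes n: "n \<ge> 1"
  obtains \<kappa> :: "real poly" where "degree \<kappa> \<le> 2 * (n - 1)"
    "\<And>x. \<bar>x\<bar> \<le> 1 \<Longrightarrow> 1 / (1 + (real n * x)\<^sup>2) \<le> poly \<kappa> x"
    "\<And>x. \<bar>x\<bar> \<le> 1 \<Longrightarrow> poly \<kappa> x \<le> 2 / (1 + (real n * x)\<^sup>2)"
    "\<And>x. 1 \<le> \<bar>x\<bar> \<Longrightarrow> \<bar>poly \<kappa> x\<bar> \<le> 12 * (6 * x\<^sup>2) ^ (n - 1)"
proof -
  define A where "A = 1 + 2 / (real n)\<^sup>2"
  define T where "T = poly (Chebyshev n) A"
  \<comment> \<open>The offset 2 / n^2 is chosen so that the quadratic growth gives 1 + 2. With T >=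
    3 the values from T - 1 to T + 1 differ by a factor of at most 2, which is the ratio of the two
    kernel bounds.\<close>
  have T: "T \<ge> 3" using Chebyshev_ge[of "2 / (real n)\<^sup>2" n] n by (simp add: T_def A_def)
  define q where "q = [:T:] - Chebyshev n"
  have "poly q A = 0" by (simp add: q_def T_def)
  then obtain g where g: "q = [:- A, 1:] * g" by (auto simp: poly_eq_0_iff_dvd dvd_def)
  have dq: "degree q \<le> n" unfolding q_def
    by (intro degree_diff_le degree_Chebyshev) auto
  have dg: "degree g \<le> n - 1"
  proof (cases "g = 0")
    case False
    then have "degree q = 1 + degree g" unfolding g by (subst degree_mult_eq) auto
    then show ?thesis using dq by simp
  qed simp
  \<comment> \<open>At z = 1 - 2 x^2 the divisor z - A equals - (2 / n^2) (1 + (n x)^2), so the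
    divided difference has a Lorentzian denominator. The scalar makes the numerator at least 1 on
    [-1, 1].\<close>
  define \<kappa> where "\<kappa> = smult (- 2 / ((real n)\<^sup>2 * (T - 1))) (g \<circ>\<^sub>p [:1, 0, - 2:])"
  have "degree (g \<circ>\<^sub>p [:1, 0, - 2:]) \<le> (n - 1) * 2"
    using dg by (intro order_trans[OF degree_pcompose_le]) simp
  then have deg: "degree \<kappa> \<le> 2 * (n - 1)"
    unfolding \<kappa>_def by (intro order_trans[OF degree_smult_le]) simp
  have key: "poly \<kappa> x * (1 + (real n * x)\<^sup>2) = (T - poly (Chebyshev n) (1 - 2 * x\<^sup>2)) / (T - 1)" for x
  proof -
    define z where "z = 1 - 2 * x\<^sup>2"
    have "T - poly (Chebyshev n) z = poly q z" by (simp add: q_def)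
    also have "\<dots> = (z - A) * poly g z" by (simp add: g algebra_simps)
    finally have 1: "T - poly (Chebyshev n) z = (z - A) * poly g z" .
    have 2: "poly \<kappa> x = (- 2 / ((real n)\<^sup>2 * (T - 1))) * poly g z"
      by (simp add: \<kappa>_def poly_pcompose z_def power2_eq_square algebra_simps)
    have "(- 2 / (real n)\<^sup>2) * (1 + (real n * x)\<^sup>2) = z - A"
      using n by (simp add: z_def A_def field_simps)
    then have "(- 2 / (real n)\<^sup>2) * (1 + (real n * x)\<^sup>2) * (poly g z / (T - 1))
        = (z - A) * (poly g z / (T - 1))" by (simp only:)
    moreover have "(- 2 / (N * S)) * G * a = (- 2 / N) * a * (G / S)" for N S G a :: real
      by simp
    ultimately show ?thesis unfolding z_def[symmetric] 1 2 times_divide_eq_right by (simp only:)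
  qed
  have pos: "1 + (real n * x)\<^sup>2 > 0" for x by (simp add: add_pos_nonneg)
  show thesis
  proof (rule that[OF deg])
    fix x :: real assume x: "\<bar>x\<bar> \<le> 1"
    then have "x\<^sup>2 \<le> 1" by (simp add: abs_square_le_1)
    then have "\<bar>1 - 2 * x\<^sup>2\<bar> \<le> 1" by (auto simp: abs_le_iff)
    then have c: "\<bar>poly (Chebyshev n) (1 - 2 * x\<^sup>2)\<bar> \<le> 1" by (rule abs_Chebyshev_le_1)
    have "1 \<le> poly \<kappa> x * (1 + (real n * x)\<^sup>2)" unfolding key using T c by (simp add: field_simps)
    then show "1 / (1 + (real n * x)\<^sup>2) \<le> poly \<kappa> x" using pos[of x] by (simp add: field_simps)
    have "poly \<kappa> x * (1 + (real n * x)\<^sup>2) \<le> 2" unfolding key using T c by (simp add: field_simps)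
    then show "poly \<kappa> x \<le> 2 / (1 + (real n * x)\<^sup>2)" using pos[of x] by (simp add: field_simps)
  next
    fix x :: real assume x: "1 \<le> \<bar>x\<bar>"
    then have x2: "1 \<le> x\<^sup>2" by (simp add: abs_le_square_iff[of 1 x, simplified])
    define z where "z = 1 - 2 * x\<^sup>2"
    have z: "1 \<le> \<bar>z\<bar>" "\<bar>z\<bar> \<le> 2 * x\<^sup>2" using x2 by (auto simp: z_def)
    have "\<bar>poly (Chebyshev n) z\<bar> \<le> (3 * \<bar>z\<bar>) ^ n" by (rule abs_Chebyshev_le_power[OF z(1)])
    also have "\<dots> \<le> (6 * x\<^sup>2) ^ n" using z by (intro power_mono) auto
    finally have c: "\<bar>poly (Chebyshev n) z\<bar> \<le> (6 * x\<^sup>2) ^ n" .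
    have one: "1 \<le> (6 * x\<^sup>2) ^ n" using x2 by (intro one_le_power) simp
    have "\<bar>poly \<kappa> x\<bar> * (1 + (real n * x)\<^sup>2) = \<bar>T - poly (Chebyshev n) z\<bar> / (T - 1)"
      using arg_cong[OF key[of x], of abs] pos[of x] T unfolding z_def by (simp add: abs_mult)
    also have "\<dots> \<le> (T + (6 * x\<^sup>2) ^ n) / (T - 1)"
      using c T by (intro divide_right_mono) auto
    also have "\<dots> \<le> 2 * (6 * x\<^sup>2) ^ n"
    proof -
      define P where "P = (6 * x\<^sup>2) ^ n"
      have "0 \<le> (2 * T - 3) * (P - 1) + (T - 3)" using T one unfolding P_def[symmetric] by simp
      then have "T + P \<le> 2 * P * (T - 1)" by (simp add: algebra_simps)
      then show ?thesis unfolding P_def[symmetric] using T by (simp add: divide_le_eq)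
    qed
    finally have "\<bar>poly \<kappa> x\<bar> * (1 + (real n * x)\<^sup>2) \<le> 2 * (6 * x\<^sup>2) ^ n" .
    \<comment> \<open>Keeping only x^2 from the denominator cancels one factor 6 x^2 and lowers the
      exponent from n to n - 1.\<close>
    moreover have "\<bar>poly \<kappa> x\<bar> * x\<^sup>2 \<le> \<bar>poly \<kappa> x\<bar> * (1 + (real n * x)\<^sup>2)"
    proof (rule mult_left_mono)
      have "1 * x\<^sup>2 \<le> (real n)\<^sup>2 * x\<^sup>2" using n by (intro mult_right_mono) auto
      then show "x\<^sup>2 \<le> 1 + (real n * x)\<^sup>2" by (simp add: power_mult_distrib)
    qed simp
    moreover have "(6 * x\<^sup>2) ^ n = 6 * x\<^sup>2 * (6 * x\<^sup>2) ^ (n - 1)"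
      using n by (cases n) auto
    ultimately have "\<bar>poly \<kappa> x\<bar> * x\<^sup>2 \<le> 12 * (6 * x\<^sup>2) ^ (n - 1) * x\<^sup>2" by (simp add: mult_ac)
    then show "\<bar>poly \<kappa> x\<bar> \<le> 12 * (6 * x\<^sup>2) ^ (n - 1)"
      by (rule mult_right_le_imp_le) (use x2 in linarith)
  qed
qed

section \<open>The smoothed step and its tails\<close>

lemma poly_antiderivative:
  fixes p :: "real poly"
  obtains P where "pderiv P = p" "degree P \<le> Suc (degree p)"
proof
  define P where "P = (\<Sum>i\<le>degree p. monom (coeff p i / real (Suc i)) (Suc i))"
  have "pderiv (\<Sum>i\<le>k. f i) = (\<Sum>i\<le>k. pderiv (f i))" for k and f :: "nat \<Rightarrow> real poly"
    by (induction k) (simp_all add: pderiv_add)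
  then have "pderiv P = (\<Sum>i\<le>degree p. monom (coeff p i) i)"
    unfolding P_def by (simp add: pderiv_monom del: of_nat_Suc)
  then show "pderiv P = p" by (simp add: poly_as_sum_of_monoms)
  show "degree P \<le> Suc (degree p)" unfolding P_def
    by (intro degree_sum_le) (auto intro: order_trans[OF degree_monom_le])
qed

text \<open>Powers of 1 / (1 + y) have rational antiderivatives, so the tails are integrated in that
  form; \<open>inverse_square_le_Lorentzian\<close> leads back afterwards.\<close>

lemma Lorentzian_power2_le:
  fixes y :: real
  assumes "y \<ge> 0"
  shows "(1 / (1 + y\<^sup>2))\<^sup>2 \<le> 4 / (1 + y) ^ 4"
proof -
  have "(1 + y)\<^sup>2 \<le> 2 * (1 + y\<^sup>2)"
    using sum_squares_bound[of 1 y] by (simp add: power2_eq_square algebra_simps)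
  then have "((1 + y)\<^sup>2)\<^sup>2 \<le> (2 * (1 + y\<^sup>2))\<^sup>2" by (intro power_mono) auto
  then have le: "(1 + y) ^ 4 \<le> 4 * (1 + y\<^sup>2)\<^sup>2" unfolding power_mult_distrib by simp
  have pos: "(1 + y\<^sup>2)\<^sup>2 > 0" "(1 + y) ^ 4 > 0"
    using assms zero_le_power2[of y] by (intro zero_less_power; linarith)+
  have "(1 / (1 + y\<^sup>2))\<^sup>2 = 1 / (1 + y\<^sup>2)\<^sup>2" by (simp add: power_divide)
  also have "\<dots> \<le> 4 / (1 + y) ^ 4" using le pos by (simp add: divide_simps)
  finally show ?thesis .
qed

lemma inverse_square_le_Lorentzian:
  fixes y :: real
  assumes "y \<ge> 0"
  shows "1 / (1 + y)\<^sup>2 \<le> 1 / (1 + y\<^sup>2)"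
  using assms by (intro divide_left_mono) (auto simp: power2_eq_square algebra_simps add_pos_nonneg)

text \<open>
  The smoothed step is a normalised antiderivative \<open>P\<close> of the squared kernel times the tilt
  \<open>(1 - b x / d)\<^sup>d\<close>, which behaves like \<open>exp (- b x)\<close>. Since the tilt grows to the left, the step is
  normalised to 1 at the point \<open>- z\<close>, at distance of order \<open>1 / b\<close> from the jump, rather than at \<open>- 1\<close>.
\<close>

context
  fixes d n :: nat and b :: real and \<kappa> P :: "real poly"
  assumes d: "d \<ge> 1" and b0: "0 \<le> b" and bd: "b \<le> real d / 8"
    and n1: "n \<ge> 1" and nd: "real d / 4 \<le> real n"
    and \<kappa>_ge: "\<And>x. \<bar>x\<bar> \<le> 1 \<Longrightarrow> 1 / (1 + (real n * x)\<^sup>2) \<le> poly \<kappa> x"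
    and \<kappa>_le: "\<And>x. \<bar>x\<bar> \<le> 1 \<Longrightarrow> poly \<kappa> x \<le> 2 / (1 + (real n * x)\<^sup>2)"
    and P: "pderiv P = \<kappa>\<^sup>2 * [:1, - b / real d:] ^ d"
begin

private definition tilt :: "real \<Rightarrow> real" where "tilt x = (1 - b * x / real d) ^ d"

private lemma P_deriv: "(poly P has_real_derivative (poly \<kappa> x)\<^sup>2 * tilt x) (at x)"
  using poly_DERIV[of P x] unfolding P by (simp add: tilt_def mult_ac power_mult)

private lemma tilt_base:
  assumes "\<bar>x\<bar> \<le> 1"
  shows "7 / 8 \<le> 1 - b * x / real d" "1 - b * x / real d \<le> 9 / 8"
proof -
  have "\<bar>b * x\<bar> \<le> b * 1" using assms b0 by (simp add: abs_mult mult_left_le)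
  then have "\<bar>b * x\<bar> \<le> real d / 8" using bd by simp
  then show "7 / 8 \<le> 1 - b * x / real d" "1 - b * x / real d \<le> 9 / 8"
    using d by (auto simp: field_simps abs_le_iff)
qed

private lemma tilt_pos: "\<bar>x\<bar> \<le> 1 \<Longrightarrow> 0 < tilt x"
  unfolding tilt_def using tilt_base(1)[of x] by (intro zero_less_power) linarith

private lemma tilt_antimono: "x \<le> y \<Longrightarrow> \<bar>y\<bar> \<le> 1 \<Longrightarrow> tilt y \<le> tilt x"
  unfolding tilt_def using tilt_base[of y] b0 d
  by (intro power_mono) (auto intro!: divide_right_mono mult_left_mono)

private lemma tilt_0: "tilt 0 = 1"
  by (simp add: tilt_def)

private lemma integrand_nonneg: "\<bar>x\<bar> \<le> 1 \<Longrightarrow> 0 \<le> (poly \<kappa> x)\<^sup>2 * tilt x"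
  using tilt_pos[of x] by simp

private lemma P_mono:
  assumes "- 1 \<le> x" "x \<le> y" "y \<le> 1"
  shows "poly P x \<le> poly P y"
  using has_derivative_le_imp_diff_le[OF assms(2), of "\<lambda>_. 0" "\<lambda>_. 0" "poly P"
      "\<lambda>x. (poly \<kappa> x)\<^sup>2 * tilt x"] assms P_deriv integrand_nonneg
  by auto

private lemma integrand_le:
  assumes "\<bar>x\<bar> \<le> 1"
  shows "(poly \<kappa> x)\<^sup>2 * tilt x \<le> 16 * tilt x / (1 + real n * \<bar>x\<bar>) ^ 4"
proof -
  have pos: "0 \<le> poly \<kappa> x"
    using \<kappa>_ge[OF assms] by (rule order_trans[rotated]) (simp add: add_nonneg_nonneg)
  have "(poly \<kappa> x)\<^sup>2 \<le> (2 / (1 + (real n * x)\<^sup>2))\<^sup>2" by (rule power_mono[OF \<kappa>_le[OF assms] pos])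
  also have "\<dots> = 4 * (1 / (1 + (real n * \<bar>x\<bar>)\<^sup>2))\<^sup>2" by (simp add: power_divide power_mult_distrib)
  also have "\<dots> \<le> 4 * (4 / (1 + real n * \<bar>x\<bar>) ^ 4)"
    by (intro mult_left_mono Lorentzian_power2_le) auto
  finally have "(poly \<kappa> x)\<^sup>2 * tilt x \<le> 4 * (4 / (1 + real n * \<bar>x\<bar>) ^ 4) * tilt x"
    using tilt_pos[OF assms] by (intro mult_right_mono) auto
  then show ?thesis by simp
qed

private lemma integrand_le_cube:
  assumes "\<bar>x\<bar> \<le> 1"
  shows "(poly \<kappa> x)\<^sup>2 * tilt x \<le> 16 * tilt x / (1 + real n * \<bar>x\<bar>) ^ 3"
proof -
  have "16 * tilt x / (1 + real n * \<bar>x\<bar>) ^ 4 \<le> 16 * tilt x / (1 + real n * \<bar>x\<bar>) ^ 3"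
    using tilt_pos[OF assms]
    by (intro divide_left_mono power_increasing mult_pos_pos zero_less_power) (auto simp: add_pos_nonneg)
  then show ?thesis using integrand_le[OF assms] by simp
qed

text \<open>To the right the tilt decreases and may be frozen at its value at x. A cubic decay
  suffices, because integration leaves the inverse square wanted in the result.\<close>

private lemma P_tail_right:
  assumes x: "0 \<le> x" "x \<le> 1"
  shows "poly P 1 - poly P x \<le> 8 / real n * (tilt x / (1 + (real n * x)\<^sup>2))"
proof -
  define H where "H = (\<lambda>s. - (tilt x * (8 / real n)) / (1 + real n * s)\<^sup>2)"
  have pos: "1 + real n * s > 0" if "s \<ge> 0" for s using that by (simp add: add_pos_nonneg)
  have "poly P 1 - poly P x \<le> H 1 - H x"
  proof (rule has_derivative_le_imp_diff_le[where f' = "\<lambda>s. (poly \<kappa> s)\<^sup>2 * tilt s"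
        and g' = "\<lambda>s. 16 * tilt x / (1 + real n * s) ^ 3"])
    fix s assume s: "x \<le> s" "s \<le> 1"
    have ps: "1 + real n * s > 0" using pos s x by simp
    show "(H has_real_derivative 16 * tilt x / (1 + real n * s) ^ 3) (at s)"
      unfolding H_def using ps n1
      by (auto intro!: derivative_eq_intros simp: divide_simps power2_eq_square power3_eq_cube)
    have "(poly \<kappa> s)\<^sup>2 * tilt s \<le> 16 * tilt s / (1 + real n * \<bar>s\<bar>) ^ 3"
      by (rule integrand_le_cube) (use s x in auto)
    also have "\<dots> \<le> 16 * tilt x / (1 + real n * s) ^ 3"
      using tilt_antimono[of x s] s x ps by (auto intro!: divide_right_mono)
    finally show "(poly \<kappa> s)\<^sup>2 * tilt s \<le> 16 * tilt x / (1 + real n * s) ^ 3" .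
  qed (use x P_deriv in auto)
  also have "\<dots> \<le> - H x" using tilt_pos[of x] x by (auto simp: H_def)
  also have "\<dots> = 8 / real n * (tilt x * (1 / (1 + real n * x)\<^sup>2))" by (simp add: H_def)
  also have "\<dots> \<le> 8 / real n * (tilt x * (1 / (1 + (real n * x)\<^sup>2)))"
    using tilt_pos[of x] x by (intro mult_left_mono inverse_square_le_Lorentzian) auto
  finally show ?thesis by simp
qed

text \<open>Up to distance 4 / b the tilt stays below exp 4 <= 3^4 = 81, hence the constant 648 = 8
  * 81. The factor \<open>tilt x\<close> in the bound can be inserted because the tilt is at least 1
  left of 0.\<close>

private lemma P_tail_left_near:
  assumes z: "0 < z" "z \<le> 1" "b * z \<le> 4" and x: "- z \<le> x" "x \<le> 0"
  shows "poly P x - poly P (- z) \<le> 648 / real n * (tilt x / (1 + (real n * x)\<^sup>2))"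
proof -
  define H where "H = (\<lambda>s. (81 * (8 / real n)) / (1 - real n * s)\<^sup>2)"
  have pos: "1 - real n * s > 0" if "s \<le> 0" for s
    using that mult_nonneg_nonpos[of "real n" s] by simp
  have tz: "tilt (- z) \<le> 81"
  proof -
    have "tilt (- z) \<le> exp (b * z / real d) ^ d"
      unfolding tilt_def using exp_ge_add_one_self[of "b * z / real d"] b0 z
      by (intro power_mono) auto
    also have "\<dots> = exp (b * z)" using d by (simp add: exp_of_nat_mult[symmetric])
    also have "\<dots> \<le> exp (of_nat 4 * 1)" using z by simp
    also have "\<dots> = exp 1 ^ 4" by (rule exp_of_nat_mult)
    also have "\<dots> \<le> 3 ^ 4" using exp_le by (intro power_mono) auto
    finally show ?thesis by simp
  qed
  have "poly P x - poly P (- z) \<le> H x - H (- z)"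
  proof (rule has_derivative_le_imp_diff_le[where f' = "\<lambda>s. (poly \<kappa> s)\<^sup>2 * tilt s"
        and g' = "\<lambda>s. 16 * 81 / (1 - real n * s) ^ 3"])
    fix s assume s: "- z \<le> s" "s \<le> x"
    have ps: "1 - real n * s > 0" using pos s x by simp
    show "(H has_real_derivative 16 * 81 / (1 - real n * s) ^ 3) (at s)"
      unfolding H_def using ps n1
      by (auto intro!: derivative_eq_intros simp: divide_simps power2_eq_square power3_eq_cube)
    have "(poly \<kappa> s)\<^sup>2 * tilt s \<le> 16 * tilt s / (1 + real n * \<bar>s\<bar>) ^ 3"
      by (rule integrand_le_cube) (use s x z in auto)
    also have "\<dots> = 16 * tilt s / (1 - real n * s) ^ 3" using s x by simp
    also have "\<dots> \<le> 16 * 81 / (1 - real n * s) ^ 3"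
      using tilt_antimono[of "- z" s] s x z tz ps by (intro divide_right_mono) auto
    finally show "(poly \<kappa> s)\<^sup>2 * tilt s \<le> 16 * 81 / (1 - real n * s) ^ 3" .
  qed (use x P_deriv in auto)
  also have "\<dots> \<le> H x" by (simp add: H_def)
  also have "\<dots> = 648 / real n * (1 / (1 + real n * (- x))\<^sup>2)" by (simp add: H_def)
  also have "\<dots> \<le> 648 / real n * (1 / (1 + (real n * (- x))\<^sup>2))"
    using x by (intro mult_left_mono inverse_square_le_Lorentzian) (auto simp: mult_nonneg_nonpos)
  also have "\<dots> \<le> 648 / real n * (tilt x / (1 + (real n * x)\<^sup>2))"
    using tilt_antimono[of x 0] x
    by (intro mult_left_mono) (auto intro!: divide_right_mono add_nonneg_nonneg simp: tilt_0)
  finally show ?thesis .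
qed

text \<open>Here the tilt is no longer bounded, so it goes into the comparison function
  \<open>H\<close>. Beyond distance 4 / b its relative growth, at least 3 b / 4, outweighs the
  relative decay of the inverse square, at most b / 2. The mass between x and - 4 / b is therefore
  controlled by the integrand near x.\<close>

private lemma P_tail_left_far:
  assumes b4: "b \<ge> 4" and x: "- 1 \<le> x" "x \<le> - (4 / b)"
  shows "poly P (- (4 / b)) - poly P x \<le> 648 / real n * (tilt x / (1 + (real n * x)\<^sup>2))"
proof -
  define H where "H = (\<lambda>s. - (4 / real n) * (tilt s / (1 - real n * s)\<^sup>2))"
  define D where "D = (\<lambda>s. 4 / real n * (tilt s / (1 - real n * s)\<^sup>2
      * (b / (1 - b * s / real d) - 2 * real n / (1 - real n * s))))"
  have "poly P (- (4 / b)) - poly P x \<le> H (- (4 / b)) - H x"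
  proof (rule has_derivative_le_imp_diff_le[where f' = "\<lambda>s. (poly \<kappa> s)\<^sup>2 * tilt s" and g' = D])
    fix s assume s: "x \<le> s" "s \<le> - (4 / b)"
    have s1: "\<bar>s\<bar> \<le> 1" "s < 0" 
    proof -
      have "0 < 4 / b" using b4 by simp
      then show "\<bar>s\<bar> \<le> 1" "s < 0" using s x by linarith+
    qed
    have ps: "1 - real n * s > 0" using s1 mult_nonneg_nonpos[of "real n" s] by simp
    have pt: "1 - b * s / real d > 0" using tilt_base(1)[OF s1(1)] by linarith
    show "(H has_real_derivative D s) (at s)"
    proof -
      have dt: "(tilt has_real_derivative - b * (1 - b * s / real d) ^ (d - 1)) (at s)"
        unfolding tilt_def using d by (auto intro!: derivative_eq_intros)
      have e: "(1 - b * s / real d) ^ (d - 1) = tilt s / (1 - b * s / real d)"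
        using power_minus_mult[of d "1 - b * s / real d"] d pt by (simp add: tilt_def field_simps)
      have dn: "((\<lambda>s. 1 / (1 - real n * s)\<^sup>2) has_real_derivative
          2 * real n / (1 - real n * s) ^ 3) (at s)"
        using ps by (auto intro!: derivative_eq_intros simp: divide_simps power2_eq_square power3_eq_cube)
      have "((\<lambda>s. tilt s * (1 / (1 - real n * s)\<^sup>2)) has_real_derivative
          - b * (tilt s / (1 - b * s / real d)) * (1 / (1 - real n * s)\<^sup>2)
          + 2 * real n / (1 - real n * s) ^ 3 * tilt s) (at s)"
        using DERIV_mult[OF dt dn] unfolding e by simp
      then have "(H has_real_derivative - (4 / real n) * (- b * (tilt s / (1 - b * s / real d)) * (1 / (1 - real n * s)\<^sup>2)
          + 2 * real n / (1 - real n * s) ^ 3 * tilt s)) (at s)"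
        unfolding H_def by (intro DERIV_cmult) simp
      moreover have "- (4 / real n) * (- b * (tilt s / (1 - b * s / real d)) * (1 / (1 - real n * s)\<^sup>2)
          + 2 * real n / (1 - real n * s) ^ 3 * tilt s) = D s"
      proof -
        have "- (4 / N) * (- b * (t / p) * (1 / q\<^sup>2) + 2 * N / q ^ 3 * t)
            = 4 / N * (t / q\<^sup>2 * (b / p - 2 * N / q))" if "q \<noteq> 0" "p \<noteq> 0" "N \<noteq> 0" for N t p q :: real
          using that by (simp add: field_simps power2_eq_square power3_eq_cube)
        moreover have "1 - real n * s \<noteq> 0" "1 - b * s / real d \<noteq> 0" "real n \<noteq> 0"
          using ps pt n1 by linarith+
        ultimately show ?thesis unfolding D_def by blast
      qed
      ultimately show ?thesis by simp
    qed
    define y where "y = - s"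
    have y: "4 / b \<le> y" "y \<le> 1" "0 < y" using s s1 by (auto simp: y_def)
    have "3 / 4 * b \<le> b / (1 - b * s / real d)"
    proof -
      have "b * (3 / 4 * (1 - b * s / real d)) \<le> b * 1"
      proof (rule mult_left_mono)
        have "3 / 4 * w \<le> 1" if "w \<le> 9 / 8" for w :: real using that by simp
        then show "3 / 4 * (1 - b * s / real d) \<le> 1" using tilt_base(2)[OF s1(1)] by blast
      qed (use b4 in simp)
      then show ?thesis unfolding pos_le_divide_eq[OF pt] by (simp only: mult_ac mult_1)
    qed
    moreover have "2 * real n / (1 - real n * s) \<le> b / 2"
    proof -
      have "4 \<le> b * y" using y b4 by (simp add: field_simps)
      then have "real n * 4 \<le> real n * (b * y)" by (intro mult_left_mono) auto
      then have "4 * real n \<le> b * (1 - real n * s)" using b4 by (simp add: y_def algebra_simps)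
      then show ?thesis using ps by (simp add: field_simps)
    qed
    ultimately have br: "b / 4 \<le> b / (1 - b * s / real d) - 2 * real n / (1 - real n * s)" by simp
    \<comment> \<open>The surplus b / 4 in the growth rate must still cover the factor by which
      fourth-power decay differs from the inverse square; distance 4 / b and b <= n give
      this.\<close>
    have "16 / (1 - real n * s)\<^sup>2 \<le> b / real n"
    proof -
      have "4 * real n \<le> b * (1 - real n * s)"
      proof -
        have "4 \<le> b * y" using y b4 by (simp add: field_simps)
        then have "real n * 4 \<le> real n * (b * y)" by (intro mult_left_mono) auto
        then show ?thesis using b4 by (simp add: y_def algebra_simps)
      qed
      then have "(4 * real n)\<^sup>2 \<le> (b * (1 - real n * s))\<^sup>2" by (intro power_mono) auto
      then have "16 * (real n * real n) \<le> b * (b * (1 - real n * s)\<^sup>2)"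
        by (simp add: power2_eq_square mult_ac)
      also have "\<dots> \<le> real n * (b * (1 - real n * s)\<^sup>2)"
        using bd nd b4 by (intro mult_right_mono) auto
      finally have "16 * real n \<le> b * (1 - real n * s)\<^sup>2" using n1 by simp
      then show ?thesis using ps n1 by (simp add: field_simps)
    qed
    then have "tilt s / (1 - real n * s)\<^sup>2 * (16 / (1 - real n * s)\<^sup>2)
        \<le> tilt s / (1 - real n * s)\<^sup>2 * (4 / real n * (b / 4))"
      using tilt_pos[OF s1(1)] by (intro mult_left_mono) auto
    also have "\<dots> \<le> tilt s / (1 - real n * s)\<^sup>2 *
        (4 / real n * (b / (1 - b * s / real d) - 2 * real n / (1 - real n * s)))"
      using br tilt_pos[OF s1(1)] by (intro mult_left_mono) auto
    also have "\<dots> = D s" by (simp add: D_def mult_ac)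
    finally have "tilt s / (1 - real n * s)\<^sup>2 * (16 / (1 - real n * s)\<^sup>2) \<le> D s" .
    moreover have "(poly \<kappa> s)\<^sup>2 * tilt s \<le> 16 * tilt s / (1 - real n * s) ^ 4"
      using integrand_le[OF s1(1)] s1 by simp
    moreover have "tilt s / (1 - real n * s)\<^sup>2 * (16 / (1 - real n * s)\<^sup>2) = 16 * tilt s / (1 - real n * s) ^ 4"
      by (simp add: power_add[symmetric])
    ultimately show "(poly \<kappa> s)\<^sup>2 * tilt s \<le> D s" by linarith
  qed (use x P_deriv in auto)
  also have "\<dots> \<le> - H x" using tilt_pos[of "- (4 / b)"] b4 n1 by (simp add: H_def)
  also have "\<dots> = 4 / real n * (tilt x * (1 / (1 + real n * (- x))\<^sup>2))" by (simp add: H_def)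
  also have "\<dots> \<le> 648 / real n * (tilt x * (1 / (1 + (real n * (- x))\<^sup>2)))"
  proof -
    have "0 < 4 / b" using b4 by simp
    then have x0: "x \<le> 0" using x by linarith
    have t: "0 < tilt x" by (rule tilt_pos) (use x x0 in auto)
    show ?thesis
      by (intro mult_mono mult_left_mono divide_right_mono inverse_square_le_Lorentzian)
        (use t x0 in \<open>auto simp: mult_nonneg_nonpos intro: less_imp_le\<close>)
  qed
  finally show ?thesis by simp
qed

text \<open>The stretch from 0 to 1 / n alone carries enough mass: there the kernel is at least 1/2,
  and so is the tilt by Bernoulli's inequality, since b / n <= 1/2.\<close>

private lemma P_mass:
  assumes "0 \<le> z" "z \<le> 1"
  shows "1 / (8 * real n) \<le> poly P 1 - poly P (- z)"
proof -
  have "1 / 8 * (1 / real n) - 1 / 8 * 0 \<le> poly P (1 / real n) - poly P 0"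
  proof (rule has_derivative_le_imp_diff_le[where f' = "\<lambda>_. 1 / 8" and g' = "\<lambda>s. (poly \<kappa> s)\<^sup>2 * tilt s"])
    fix s :: real assume s: "0 \<le> s" "s \<le> 1 / real n"
    have n': "1 / real n \<le> 1" using n1 by simp
    have s1: "\<bar>s\<bar> \<le> 1" using s n' by linarith
    have ns: "0 \<le> real n * s" "real n * s \<le> 1" using s n1 by (auto simp: field_simps)
    have "(real n * s)\<^sup>2 \<le> 1" using ns by (simp add: power_le_one)
    then have "1 / 2 \<le> 1 / (1 + (real n * s)\<^sup>2)" by (simp add: field_simps add_pos_nonneg)
    then have k: "1 / 2 \<le> poly \<kappa> s" using \<kappa>_ge[OF s1] by simp
    have "(1 / 2)\<^sup>2 \<le> (poly \<kappa> s)\<^sup>2" by (rule power_mono[OF k]) simp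
    moreover have "1 / 2 \<le> tilt s"
    proof -
      have "b * s \<le> real d / 8 * (1 / real n)" using b0 bd s by (intro mult_mono) auto
      also have "\<dots> \<le> 1 / 2" using nd n1 by (simp add: field_simps)
      finally have "1 / 2 \<le> 1 + real d * (- (b * s / real d))" using d by simp
      also have "\<dots> \<le> (1 + - (b * s / real d)) ^ d"
        by (rule Bernoulli_inequality) (use tilt_base(1)[OF s1] in linarith)
      finally show ?thesis by (simp add: tilt_def)
    qed
    ultimately have "(1 / 2)\<^sup>2 * (1 / 2) \<le> (poly \<kappa> s)\<^sup>2 * tilt s" by (intro mult_mono) auto
    then show "1 / 8 \<le> (poly \<kappa> s)\<^sup>2 * tilt s" by (simp add: power2_eq_square)
  qed (use P_deriv in \<open>auto intro!: derivative_eq_intros\<close>)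
  moreover have "poly P (1 / real n) \<le> poly P 1" by (rule P_mono) (use n1 in \<open>auto intro: order_trans[of _ 0]\<close>)
  moreover have "poly P (- z) \<le> poly P 0" by (rule P_mono) (use assms in auto)
  ultimately show ?thesis by simp
qed

lemma smoothed_step_error:
  obtains z where "0 < z" "z \<le> 1" "1 / (8 * real n) \<le> poly P 1 - poly P (- z)"
    "\<And>x. \<bar>x\<bar> \<le> 1 \<Longrightarrow>
      \<bar>(poly P 1 - poly P x) / (poly P 1 - poly P (- z)) - (if x \<le> 0 then 1 else 0)\<bar>
        \<le> 5184 * (1 - b * x / real d) ^ d / (1 + (real n * x)\<^sup>2)"
proof -
  \<comment> \<open>For b <= 4 the near estimate reaches the end - 1; otherwise 4 / b is the point
    where the far estimate takes over.\<close>
  define z where "z = (if b \<le> 4 then 1 else 4 / b)"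
  have z: "0 < z" "z \<le> 1" "b * z \<le> 4" by (auto simp: z_def)
  have mass: "1 / (8 * real n) \<le> poly P 1 - poly P (- z)" using P_mass z by simp
  define Z where "Z = poly P 1 - poly P (- z)"
  have Z: "1 / (8 * real n) \<le> Z" "Z > 0"
    using mass n1 less_le_trans[of 0 "1 / (8 * real n)" Z] by (auto simp: Z_def)
  have iZ: "1 / Z \<le> 8 * real n" using Z n1 by (simp add: field_simps)
  \<comment> \<open>The tails carry 648 / n and the normaliser is at least 1 / (8 n), whence 5184 =
    8 * 648.\<close>
  have scale: "a / Z \<le> 5184 * tilt x / (1 + (real n * x)\<^sup>2)"
    if "a \<le> 648 / real n * (tilt x / (1 + (real n * x)\<^sup>2))" "0 \<le> a" "\<bar>x\<bar> \<le> 1" for a x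
  proof -
    have "a / Z = a * (1 / Z)" by simp
    also have "\<dots> \<le> 648 / real n * (tilt x / (1 + (real n * x)\<^sup>2)) * (8 * real n)"
      using that iZ Z tilt_pos[of x]
      by (intro mult_mono) (auto intro!: mult_nonneg_nonneg divide_nonneg_nonneg add_nonneg_nonneg)
    also have "\<dots> = 5184 * tilt x / (1 + (real n * x)\<^sup>2)" using n1 by simp
    finally show ?thesis .
  qed
  show thesis
  proof (rule that[OF z(1,2) mass])
    fix x :: real assume x: "\<bar>x\<bar> \<le> 1"
    have goal: "\<bar>(poly P 1 - poly P x) / Z - (if x \<le> 0 then 1 else 0)\<bar>
      \<le> 5184 * tilt x / (1 + (real n * x)\<^sup>2)"
    proof (cases "x \<le> 0")
      case False
      have "poly P 1 - poly P x \<le> 8 / real n * (tilt x / (1 + (real n * x)\<^sup>2))"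
        using P_tail_right False x by simp
      also have "\<dots> \<le> 648 / real n * (tilt x / (1 + (real n * x)\<^sup>2))"
        using tilt_pos[OF x] by (intro mult_right_mono divide_right_mono) auto
      finally have "poly P 1 - poly P x \<le> 648 / real n * (tilt x / (1 + (real n * x)\<^sup>2))" .
      moreover have "0 \<le> poly P 1 - poly P x" using P_mono[of x 1] False x by simp
      ultimately show ?thesis using scale[of _ x] x False Z by simp
    next
      case True
      have e: "(poly P 1 - poly P x) / Z - 1 = (poly P (- z) - poly P x) / Z"
        using Z by (simp add: field_simps) (simp add: Z_def)
      have "\<bar>poly P (- z) - poly P x\<bar> \<le> 648 / real n * (tilt x / (1 + (real n * x)\<^sup>2))"
      proof (cases "- z \<le> x")
        case near: True
        then show ?thesis using P_tail_left_near[OF z near True] P_mono[of "- z" x] z True by simp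
      next
        case far: False
        then have b4: "b > 4" "z = 4 / b" using x by (auto simp: z_def split: if_splits)
        then show ?thesis using P_tail_left_far[of x] P_mono[of x "- z"] far x z by simp
      qed
      then show ?thesis using scale[of "\<bar>poly P (- z) - poly P x\<bar>" x] x True Z e by simp
    qed
    then show "\<bar>(poly P 1 - poly P x) / (poly P 1 - poly P (- z)) - (if x \<le> 0 then 1 else 0)\<bar>
        \<le> 5184 * (1 - b * x / real d) ^ d / (1 + (real n * x)\<^sup>2)"
      unfolding Z_def tilt_def .
  qed
qed

end

text \<open>The power of \<open>300 x\<close> is only there to dominate the growth of the other terms outside \<open>[-1, 1]\<close>.\<close>

lemma step_sandwich:
  fixes d :: nat and b :: real
  assumes d: "d \<ge> 1" and b0: "0 \<le> b" and bd: "b \<le> real d / 8"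
  obtains qp qm :: "real poly" where
    "degree qp \<le> 2 * d + 2" "degree qm \<le> 2 * d + 2"
    "\<And>x. poly qm x \<le> (if x \<le> 0 then 1 else 0)"
    "\<And>x. (if x \<le> 0 then 1 else 0) \<le> poly qp x"
    "\<And>x. \<bar>x\<bar> \<le> 1 \<Longrightarrow> poly qp x - poly qm x
        \<le> 20736 * (1 - b * x / real d) ^ d / (1 + (real d * x / 4)\<^sup>2) + 2 * (300 * x) ^ (2 * d + 2)"
    "\<And>x. 1 \<le> \<bar>x\<bar> \<Longrightarrow> poly qp x - poly qm x \<le> 4 * (300 * x) ^ (2 * d + 2)"
proof -
  \<comment> \<open>The squared kernel has degree at most 4 (n - 1) <= d, so with the tilt and the
    integration the step has degree at most 2 d + 1; n >= d / 4 keeps the width of order 1 /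
    d.\<close>
  define n where "n = d div 4 + 1"
  have n: "n \<ge> 1" "real d / 4 \<le> real n" "n \<le> d" "4 * (n - 1) \<le> d"
    using d by (auto simp: n_def)
  obtain \<kappa> :: "real poly" where \<kappa>: "degree \<kappa> \<le> 2 * (n - 1)"
    "\<And>x. \<bar>x\<bar> \<le> 1 \<Longrightarrow> 1 / (1 + (real n * x)\<^sup>2) \<le> poly \<kappa> x"
    "\<And>x. \<bar>x\<bar> \<le> 1 \<Longrightarrow> poly \<kappa> x \<le> 2 / (1 + (real n * x)\<^sup>2)"
    "\<And>x. 1 \<le> \<bar>x\<bar> \<Longrightarrow> \<bar>poly \<kappa> x\<bar> \<le> 12 * (6 * x\<^sup>2) ^ (n - 1)"
    using Lorentzian_kernel[OF n(1)] by metis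
  define tau where "tau = [:1, - b / real d:] ^ d"
  have tau: "poly tau x = (1 - b * x / real d) ^ d" for x by (simp add: tau_def mult_ac)
  have dtau: "degree tau \<le> d"
    unfolding tau_def using degree_power_le[of "[:1, - b / real d:]" d]
    by (rule order_trans) auto
  obtain P where P: "pderiv P = \<kappa>\<^sup>2 * tau" "degree P \<le> Suc (degree (\<kappa>\<^sup>2 * tau))"
    using poly_antiderivative by metis
  have dP: "degree P \<le> 2 * d + 1"
  proof -
    have "degree (\<kappa>\<^sup>2 * tau) \<le> degree \<kappa> * 2 + degree tau"
      by (intro order_trans[OF degree_mult_le] add_mono degree_power_le order_refl)
    then show ?thesis using P(2) \<kappa>(1) dtau n by simp
  qed
  obtain z where z: "0 < z" "z \<le> 1" "1 / (8 * real n) \<le> poly P 1 - poly P (- z)"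
    "\<And>x. \<bar>x\<bar> \<le> 1 \<Longrightarrow>
      \<bar>(poly P 1 - poly P x) / (poly P 1 - poly P (- z)) - (if x \<le> 0 then 1 else 0)\<bar>
        \<le> 5184 * (1 - b * x / real d) ^ d / (1 + (real n * x)\<^sup>2)"
    using smoothed_step_error[OF d b0 bd n(1,2) \<kappa>(2,3) P(1)[unfolded tau_def]] by metis
  define Z where "Z = poly P 1 - poly P (- z)"
  have Z: "1 / (8 * real n) \<le> Z" "Z > 0"
    using z(3) n less_le_trans[of 0 "1 / (8 * real n)" Z] by (auto simp: Z_def)
  define Q where "Q = smult (1 / Z) ([:poly P 1:] - P)"
  have Q: "poly Q x = (poly P 1 - poly P x) / Z" for x by (simp add: Q_def)
  define step :: "real \<Rightarrow> real" where "step = (\<lambda>x. if x \<le> 0 then 1 else 0)"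
  define E where "E = monom ((300::real) ^ (2 * d + 2)) (2 * d + 2)"
  have E: "poly E x = (300 * x) ^ (2 * d + 2)" for x
    unfolding E_def poly_monom power_mult_distrib ..
  have E0: "0 \<le> poly E x" for x
  proof -
    have "even (2 * d + 2)" by simp
    then show ?thesis unfolding E by (rule zero_le_even_power)
  qed
  \<comment> \<open>The error bound has to be a polynomial itself, so the Lorentzian factor is
    replaced by the kernel, which dominates it on [-1, 1].\<close>
  define F where "F = smult 5184 (tau * \<kappa>)"
  have dE: "degree E \<le> 2 * d + 2" unfolding E_def by (rule degree_monom_le)
  have dQ: "degree Q \<le> 2 * d + 2"
    unfolding Q_def using dP by (intro order_trans[OF degree_smult_le] degree_diff_le) auto
  have dF: "degree F \<le> 2 * d + 2"
  proof -
    have "degree (tau * \<kappa>) \<le> d + 2 * (n - 1)"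
      using degree_mult_le[of tau \<kappa>] dtau \<kappa>(1) by linarith
    then show ?thesis unfolding F_def using n by (intro order_trans[OF degree_smult_le]) simp
  qed
  have inner: "\<bar>poly Q x - step x\<bar> \<le> poly F x"
    and F_le: "poly F x \<le> 10368 * (1 - b * x / real d) ^ d / (1 + (real d * x / 4)\<^sup>2)"
    and tau_le: "0 \<le> poly tau x" "poly tau x \<le> 2 ^ d" if x: "\<bar>x\<bar> \<le> 1" for x
  proof -
    have "\<bar>b * x\<bar> \<le> b * 1" using x b0 by (simp add: abs_mult mult_left_le)
    then have "\<bar>b * x\<bar> \<le> real d / 8" using bd by simp
    then have "0 \<le> 1 - b * x / real d" "1 - b * x / real d \<le> 2"
      using d by (auto simp: field_simps abs_le_iff)
    then show t: "0 \<le> poly tau x" "poly tau x \<le> 2 ^ d"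
      unfolding tau by (auto intro: power_mono)
    have "\<bar>poly Q x - step x\<bar> \<le> 5184 * (poly tau x * (1 / (1 + (real n * x)\<^sup>2)))"
      using z(4)[OF x] unfolding Q Z_def step_def tau by simp
    also have "\<dots> \<le> 5184 * (poly tau x * poly \<kappa> x)"
      using t \<kappa>(2)[OF x] by (intro mult_left_mono) auto
    finally show "\<bar>poly Q x - step x\<bar> \<le> poly F x" by (simp add: F_def)
    have "poly F x = 5184 * (poly tau x * poly \<kappa> x)" by (simp add: F_def)
    also have "\<dots> \<le> 5184 * (poly tau x * (2 / (1 + (real d * x / 4)\<^sup>2)))"
    proof (intro mult_left_mono t)
      have "poly \<kappa> x \<le> 2 / (1 + (real n * x)\<^sup>2)" by (rule \<kappa>(3)[OF x])
      also have "\<dots> \<le> 2 / (1 + (real d * x / 4)\<^sup>2)"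
      proof (rule divide_left_mono)
        have "(real d * x / 4)\<^sup>2 = (real d / 4)\<^sup>2 * x\<^sup>2" by (simp add: power_mult_distrib power_divide)
        also have "\<dots> \<le> (real n)\<^sup>2 * x\<^sup>2" using n by (intro mult_right_mono power_mono) auto
        finally show "1 + (real d * x / 4)\<^sup>2 \<le> 1 + (real n * x)\<^sup>2" by (simp add: power_mult_distrib)
      qed (auto intro!: mult_pos_pos add_pos_nonneg)
      finally show "poly \<kappa> x \<le> 2 / (1 + (real d * x / 4)\<^sup>2)" .
    qed auto
    finally show "poly F x \<le> 10368 * (1 - b * x / real d) ^ d / (1 + (real d * x / 4)\<^sup>2)"
      by (simp add: tau)
  qed
  have outer: "\<bar>poly Q x - step x\<bar> + \<bar>poly F x\<bar> \<le> poly E x" if x: "1 \<le> \<bar>x\<bar>" for x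
  proof -
    have tau_out: "\<bar>poly tau s\<bar> \<le> 2 ^ d * \<bar>s\<bar> ^ d" if s: "1 \<le> \<bar>s\<bar>" for s
    proof -
      have "\<bar>b * s / real d\<bar> = b / real d * \<bar>s\<bar>" using b0 by (simp add: abs_mult)
      also have "\<dots> \<le> 1 * \<bar>s\<bar>" using bd d by (intro mult_right_mono) (auto simp: field_simps)
      finally have "\<bar>1 - b * s / real d\<bar> \<le> 2 * \<bar>s\<bar>" using s by linarith
      then show ?thesis unfolding tau power_abs power_mult_distrib[symmetric] by (intro power_mono) auto
    qed
    have prod_pow: "A * (3 ^ d * \<bar>s\<bar> ^ d) * (2 ^ d * \<bar>s\<bar> ^ d) = A * 6 ^ d * \<bar>s\<bar> ^ (2 * d)"
      for A s :: real
    proof -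
      have "(3::real) ^ d * 2 ^ d = 6 ^ d" by (simp add: power_mult_distrib[symmetric])
      moreover have "\<bar>s\<bar> ^ d * \<bar>s\<bar> ^ d = \<bar>s\<bar> ^ (2 * d)" by (simp add: mult_2 power_add)
      moreover have "A * (a * b) * (c * e) = A * (a * c) * (b * e)" for a b c e :: real
        by (simp only: mult_ac)
      ultimately show ?thesis by metis
    qed
    have pow: "6 ^ (n - 1) * (s\<^sup>2) ^ (n - 1) \<le> 3 ^ d * \<bar>s\<bar> ^ d"
      "36 ^ (n - 1) * (s\<^sup>2) ^ (2 * (n - 1)) \<le> 3 ^ d * \<bar>s\<bar> ^ d" if s: "1 \<le> \<bar>s\<bar>" for s :: real
    proof -
      have s2: "(s\<^sup>2) ^ k = \<bar>s\<bar> ^ (2 * k)" for k by (simp add: power_mult)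
      have "(6::real) ^ (n - 1) \<le> 81 ^ (n - 1)" "(36::real) ^ (n - 1) \<le> 81 ^ (n - 1)"
        by (auto intro: power_mono)
      moreover have "(81::real) ^ (n - 1) = 3 ^ (4 * (n - 1))" by (simp add: power_mult)
      moreover have "(3::real) ^ (4 * (n - 1)) \<le> 3 ^ d" using n by (intro power_increasing) auto
      ultimately have "(6::real) ^ (n - 1) \<le> 3 ^ d" "(36::real) ^ (n - 1) \<le> 3 ^ d" by linarith+
      moreover have "\<bar>s\<bar> ^ (2 * (n - 1)) \<le> \<bar>s\<bar> ^ d" "\<bar>s\<bar> ^ (2 * (2 * (n - 1))) \<le> \<bar>s\<bar> ^ d"
        using s n by (auto intro!: power_increasing)
      ultimately show "6 ^ (n - 1) * (s\<^sup>2) ^ (n - 1) \<le> 3 ^ d * \<bar>s\<bar> ^ d"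
        "36 ^ (n - 1) * (s\<^sup>2) ^ (2 * (n - 1)) \<le> 3 ^ d * \<bar>s\<bar> ^ d"
        unfolding s2 by (auto intro!: mult_mono)
    qed
    have J: "\<bar>poly (pderiv P) s\<bar> \<le> 144 * 6 ^ d * \<bar>s\<bar> ^ (2 * d)" if s: "1 \<le> \<bar>s\<bar>" for s
    proof -
      have "(poly \<kappa> s)\<^sup>2 \<le> (12 * (6 * s\<^sup>2) ^ (n - 1))\<^sup>2"
        using power_mono[OF \<kappa>(4)[OF s], of 2] by simp
      also have "\<dots> = 144 * (36 ^ (n - 1) * (s\<^sup>2) ^ (2 * (n - 1)))"
      proof -
        have "((6::real) ^ (n - 1))\<^sup>2 = 36 ^ (n - 1)"
          unfolding power_mult[symmetric] mult.commute[of _ 2] by (simp add: power_mult)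
        moreover have "((s\<^sup>2) ^ (n - 1))\<^sup>2 = (s\<^sup>2) ^ (2 * (n - 1))"
          by (simp only: power_mult[symmetric] mult.commute[of 2])
        ultimately show ?thesis unfolding power_mult_distrib by simp
      qed
      also have "\<dots> \<le> 144 * (3 ^ d * \<bar>s\<bar> ^ d)" using pow(2)[OF s] by simp
      finally have k: "(poly \<kappa> s)\<^sup>2 \<le> 144 * (3 ^ d * \<bar>s\<bar> ^ d)" .
      have "\<bar>poly (pderiv P) s\<bar> = (poly \<kappa> s)\<^sup>2 * \<bar>poly tau s\<bar>" unfolding P(1) by (simp add: abs_mult)
      also have "\<dots> \<le> 144 * (3 ^ d * \<bar>s\<bar> ^ d) * (2 ^ d * \<bar>s\<bar> ^ d)"
        by (intro mult_mono k tau_out s) auto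
      also have "\<dots> = 144 * 6 ^ d * \<bar>s\<bar> ^ (2 * d)"
        unfolding prod_pow by simp
      finally show ?thesis .
    qed
    \<comment> \<open>Crude exponential factors are harmless outside [-1, 1]: 2^d and 6^d merge into
      12^d, which the base 300 of \<open>E\<close> absorbs.\<close>
    have nd: "8 * real n \<le> 8 * 2 ^ d"
    proof -
      have "real n \<le> real d" using n by simp
      also have "\<dots> \<le> 2 ^ d" using of_nat_less_two_power[of d, where 'a=real] by simp
      finally show ?thesis by simp
    qed
    have iZ: "1 / Z \<le> 8 * 2 ^ d"
    proof -
      have "1 / Z \<le> 8 * real n" using Z n by (simp add: field_simps)
      then show ?thesis using nd by linarith
    qed
    have x1: "1 \<le> \<bar>x\<bar> ^ k" for k using x by simp
    have P_out: "\<bar>poly P (sgn x) - poly P x\<bar> / Z \<le> 1152 * 12 ^ d * \<bar>x\<bar> ^ (2 * d + 2)"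
    proof -
      have "\<bar>poly P (sgn x) - poly P x\<bar> \<le> 144 * 6 ^ d * \<bar>x\<bar> ^ (2 * d) * \<bar>x\<bar>"
      proof -
        \<comment> \<open>Mean value theorem between x and the nearer end \<open>sgn x\<close> of
          [-1, 1]; at the ends themselves the interval degenerates.\<close>
        have ex: "\<exists>y. 1 \<le> \<bar>y\<bar> \<and> \<bar>y\<bar> \<le> \<bar>x\<bar> \<and>
            \<bar>poly P (sgn x) - poly P x\<bar> = (\<bar>x\<bar> - 1) * \<bar>poly (pderiv P) y\<bar>"
        proof (cases "\<bar>x\<bar> = 1")
          case True
          then have "sgn x = x" by (auto simp: sgn_if abs_if split: if_splits)
          then show ?thesis using True by (intro exI[of _ x]) simp
        next
          case neq: False
          show ?thesis
          proof (cases "x > 0")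
            case True
            then have x': "1 < x" using neq x by simp
            obtain y where "1 < y" "y < x" "poly P x - poly P 1 = (x - 1) * poly (pderiv P) y"
              using MVT2[OF x', of "poly P" "poly (pderiv P)"] poly_DERIV by blast
            then show ?thesis using True x'
              by (intro exI[of _ y]) (simp add: abs_minus_commute[of "poly P 1"] abs_mult)
          next
            case False
            then have x': "x < - 1" using neq x by simp
            obtain y where "x < y" "y < - 1" "poly P (- 1) - poly P x = (- 1 - x) * poly (pderiv P) y"
              using MVT2[OF x', of "poly P" "poly (pderiv P)"] poly_DERIV by blast
            then show ?thesis using False x'
              by (intro exI[of _ y]) (simp add: abs_mult)
          qed
        qed
        then obtain y where y: "1 \<le> \<bar>y\<bar>" "\<bar>y\<bar> \<le> \<bar>x\<bar>"
          "\<bar>poly P (sgn x) - poly P x\<bar> = (\<bar>x\<bar> - 1) * \<bar>poly (pderiv P) y\<bar>" by blast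
        have "\<bar>poly (pderiv P) y\<bar> \<le> 144 * 6 ^ d * \<bar>y\<bar> ^ (2 * d)" by (rule J[OF y(1)])
        also have "\<dots> \<le> 144 * 6 ^ d * \<bar>x\<bar> ^ (2 * d)" using y by (intro mult_left_mono power_mono) auto
        finally have "(\<bar>x\<bar> - 1) * \<bar>poly (pderiv P) y\<bar> \<le> \<bar>x\<bar> * (144 * 6 ^ d * \<bar>x\<bar> ^ (2 * d))"
          using x by (intro mult_mono) auto
        then show ?thesis using y(3) by (simp add: mult_ac)
      qed
      then have "\<bar>poly P (sgn x) - poly P x\<bar> * (1 / Z) \<le> 144 * 6 ^ d * \<bar>x\<bar> ^ (2 * d) * \<bar>x\<bar> * (8 * 2 ^ d)"
        using iZ Z by (intro mult_mono) auto
      also have "\<dots> = 1152 * 12 ^ d * (\<bar>x\<bar> ^ (2 * d) * \<bar>x\<bar>)"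
      proof -
        have "(6::real) ^ d * 2 ^ d = 12 ^ d" by (simp add: power_mult_distrib[symmetric])
        moreover have "144 * A * X * Y * (8 * B) = 1152 * (A * B) * (X * Y)" for A B X Y :: real
          by simp
        ultimately show ?thesis by metis
      qed
      also have "\<dots> \<le> 1152 * 12 ^ d * \<bar>x\<bar> ^ (2 * d + 2)"
        using x power_increasing[of "Suc (2 * d)" "2 * d + 2" "\<bar>x\<bar>"] by (intro mult_left_mono) (auto simp: mult.commute)
      finally show ?thesis by simp
    qed
    have QS: "\<bar>poly Q x - step x\<bar> \<le> 6336 * 12 ^ d * \<bar>x\<bar> ^ (2 * d + 2)"
    proof (cases "x > 0")
      case True
      then have "\<bar>poly Q x - step x\<bar> = \<bar>poly P (sgn x) - poly P x\<bar> / Z"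
        using Z by (simp add: Q step_def)
      also have "\<dots> \<le> 1152 * 12 ^ d * \<bar>x\<bar> ^ (2 * d + 2)" by (rule P_out)
      also have "\<dots> \<le> 6336 * 12 ^ d * \<bar>x\<bar> ^ (2 * d + 2)" by (intro mult_right_mono) auto
      finally show ?thesis .
    next
      case False
      then have neg: "x < 0" using x by auto
      \<comment> \<open>The step is exactly 0 at 1 but is normalised to 1 at - z, not at - 1. The
        defect at - 1 comes from the estimate inside the interval.\<close>
      have "poly Q x - step x = (poly Q (- 1) - step (- 1)) + (poly P (sgn x) - poly P x) / Z"
        using neg by (simp add: Q step_def diff_divide_distrib[symmetric] add_divide_distrib[symmetric])
      then have "\<bar>poly Q x - step x\<bar> \<le> \<bar>poly Q (- 1) - step (- 1)\<bar> + \<bar>poly P (sgn x) - poly P x\<bar> / Z"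
        using Z abs_triangle_ineq[of "poly Q (- 1) - step (- 1)" "(poly P (sgn x) - poly P x) / Z"] by simp
      moreover have "\<bar>poly Q (- 1) - step (- 1)\<bar> \<le> 5184 * 12 ^ d * \<bar>x\<bar> ^ (2 * d + 2)"
      proof -
        have "\<bar>poly Q (- 1) - step (- 1)\<bar> \<le> 5184 * poly tau (- 1) / (1 + (real n * (- 1))\<^sup>2)"
          using z(4)[of "- 1"] unfolding Q Z_def step_def tau by simp
        also have "\<dots> \<le> 5184 * poly tau (- 1) / 1"
          using tau_le[of "- 1"] by (intro divide_left_mono) (auto simp: add_pos_nonneg)
        also have "\<dots> \<le> 5184 * 12 ^ d"
        proof -
          have "(2::real) ^ d \<le> 12 ^ d" by (intro power_mono) auto
          then show ?thesis using tau_le(2)[of "- 1"] by simp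
        qed
        also have "\<dots> \<le> 5184 * 12 ^ d * \<bar>x\<bar> ^ (2 * d + 2)"
          using mult_left_mono[OF x1[of "2 * d + 2"], of "5184 * 12 ^ d"] by simp
        finally show ?thesis .
      qed
      ultimately have "\<bar>poly Q x - step x\<bar> \<le> 5184 * 12 ^ d * \<bar>x\<bar> ^ (2 * d + 2) + 1152 * 12 ^ d * \<bar>x\<bar> ^ (2 * d + 2)"
        using P_out by linarith
      also have "\<dots> = 6336 * 12 ^ d * \<bar>x\<bar> ^ (2 * d + 2)" by (simp only: distrib_right[symmetric]) simp
      finally show ?thesis .
    qed
    have FS: "\<bar>poly F x\<bar> \<le> 62208 * 12 ^ d * \<bar>x\<bar> ^ (2 * d + 2)"
    proof -
      have "\<bar>poly \<kappa> x\<bar> \<le> 12 * (3 ^ d * \<bar>x\<bar> ^ d)"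
        using \<kappa>(4)[OF x] pow(1)[OF x] unfolding power_mult_distrib by linarith
      then have "\<bar>poly \<kappa> x\<bar> * \<bar>poly tau x\<bar> \<le> (12 * (3 ^ d * \<bar>x\<bar> ^ d)) * (2 ^ d * \<bar>x\<bar> ^ d)"
        by (intro mult_mono tau_out x) auto
      also have "\<dots> = 12 * 6 ^ d * \<bar>x\<bar> ^ (2 * d)"
        unfolding prod_pow by simp
      also have "\<dots> \<le> 12 * 12 ^ d * \<bar>x\<bar> ^ (2 * d + 2)"
        using x by (intro mult_mono power_mono power_increasing) auto
      finally show ?thesis by (simp add: F_def abs_mult mult_ac)
    qed
    \<comment> \<open>The bound 90000 = 300^2 lies above 6336 + 62208; being a square it fits the
      even power in \<open>E\<close>.\<close>
    have "\<bar>poly Q x - step x\<bar> + \<bar>poly F x\<bar> \<le> 90000 * 12 ^ d * \<bar>x\<bar> ^ (2 * d + 2)"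
    proof -
      have "6336 * (12 ^ d * \<bar>x\<bar> ^ (2 * d + 2)) + 62208 * (12 ^ d * \<bar>x\<bar> ^ (2 * d + 2))
          \<le> 90000 * (12 ^ d * \<bar>x\<bar> ^ (2 * d + 2))" by simp
      then show ?thesis using QS FS unfolding mult.assoc by linarith
    qed
    also have "\<dots> \<le> 90000 * 90000 ^ d * \<bar>x\<bar> ^ (2 * d + 2)"
      by (intro mult_right_mono mult_left_mono power_mono) auto
    also have "\<dots> = poly E x"
    proof -
      have "(300::real) ^ (2 * d + 2) = (300\<^sup>2) ^ Suc d" by (simp only: power_mult[symmetric]) simp
      moreover have "\<bar>x\<bar> ^ (2 * d + 2) = x ^ (2 * d + 2)" by (simp add: power_even_abs)
      ultimately show ?thesis unfolding E power_mult_distrib by simp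
    qed
    finally show ?thesis .
  qed
  show thesis
  proof (rule that[of "Q + F + E" "Q - F - E"])
    show "degree (Q + F + E) \<le> 2 * d + 2" "degree (Q - F - E) \<le> 2 * d + 2"
      using dQ dF dE by (auto intro!: degree_add_le degree_diff_le)
    fix x :: real
    have both: "\<bar>poly Q x - step x\<bar> \<le> poly F x + poly E x"
    proof (cases "\<bar>x\<bar> \<le> 1")
      case True
      then show ?thesis using inner[of x] E0[of x] by linarith
    next
      case False
      then show ?thesis using outer[of x] by linarith
    qed
    show "poly (Q - F - E) x \<le> (if x \<le> 0 then 1 else 0)" "(if x \<le> 0 then 1 else 0) \<le> poly (Q + F + E) x"
      using both unfolding step_def by auto
    {
      assume "\<bar>x\<bar> \<le> 1"
      then show "poly (Q + F + E) x - poly (Q - F - E) x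
        \<le> 20736 * (1 - b * x / real d) ^ d / (1 + (real d * x / 4)\<^sup>2) + 2 * (300 * x) ^ (2 * d + 2)"
        using F_le[of x] unfolding E[symmetric] by simp
    next
      assume "1 \<le> \<bar>x\<bar>"
      then show "poly (Q + F + E) x - poly (Q - F - E) x \<le> 4 * (300 * x) ^ (2 * d + 2)"
        using outer[of x] unfolding E[symmetric] by simp
    }
  qed
qed

section \<open>Averages over the parameter of a binomial distribution\<close>

lemma power_diff_le:
  fixes x y :: real
  assumes "0 \<le> y" "y \<le> x"
  shows "x ^ d - y ^ d \<le> real d * x ^ (d - 1) * (x - y)"
proof -
  have "x ^ d - y ^ d = (x - y) * (\<Sum>i<d. y ^ (d - Suc i) * x ^ i)"
    by (rule power_diff_sumr2)
  also have "\<dots> \<le> (x - y) * (\<Sum>i<d. x ^ (d - 1))"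
  proof (intro mult_left_mono sum_mono)
    fix i assume "i \<in> {..<d}"
    then have "x ^ (d - 1) = x ^ (d - Suc i) * x ^ i" by (simp add: power_add[symmetric])
    moreover have "y ^ (d - Suc i) * x ^ i \<le> x ^ (d - Suc i) * x ^ i"
      using assms by (intro mult_right_mono power_mono) auto
    ultimately show "y ^ (d - Suc i) * x ^ i \<le> x ^ (d - 1)" by simp
  qed (use assms in auto)
  finally show ?thesis by (simp add: mult_ac)
qed

lemma power_mult_Bernstein:
  assumes "j \<le> n"
  shows "x ^ e * Bernstein n j x = real (n choose j) / real ((n + e) choose (j + e)) * Bernstein (n + e) (j + e) x"
  using assms by (simp add: Bernstein_def power_add)

text \<open>Multiplication by x^e turns one beta density into a multiple of another. The increment
  of \<open>G\<close> from 0 to 1 is the e-th moment of the (j + 1)-st smallest of n + 1 uniform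
  variables.\<close>

lemma power_mult_Bernstein_antiderivative:
  assumes "j \<le> n"
  obtains G where
    "\<And>x. (G has_real_derivative x ^ e * (real (Suc n) * Bernstein n j x)) (at x)"
    "G 1 - G 0 = real (Suc n) * real (n choose j) / (real (Suc (n + e)) * real ((n + e) choose (j + e)))"
proof -
  define C where "C = real (Suc n) * (real (n choose j) / real ((n + e) choose (j + e))) / real (Suc (n + e))"
  define G where "G = (\<lambda>x. - C * Bernstein_cdf (Suc (n + e)) (j + e) x)"
  show thesis
  proof
    fix x
    have "(G has_real_derivative - C * (- real (Suc (n + e)) * Bernstein (n + e) (j + e) x)) (at x)"
      unfolding G_def by (intro DERIV_cmult Bernstein_cdf_has_derivative)
    moreover have "- C * (- real (Suc (n + e)) * Bernstein (n + e) (j + e) x)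
        = real (Suc n) * (x ^ e * Bernstein n j x)"
      unfolding C_def power_mult_Bernstein[OF assms] by (simp del: of_nat_Suc)
    ultimately show "(G has_real_derivative x ^ e * (real (Suc n) * Bernstein n j x)) (at x)"
      by (simp only: mult.left_commute)
    show "G 1 - G 0 = real (Suc n) * real (n choose j) / (real (Suc (n + e)) * real ((n + e) choose (j + e)))"
      using assms by (simp add: G_def C_def del: of_nat_Suc)
  qed
qed

text \<open>Both sides are the probability that d marked points among n in random order are all
  among the first k. The left side is the form in which the moment of the order statistic produces
  it.\<close>

lemma order_statistic_constant:
  assumes d: "d \<le> k" "k < n"
  shows "real (n - d) * real ((n - d - 1) choose (k - d)) / (real n * real ((n - 1) choose k))
    = real (k choose d) / real (n choose d)"
proof -
  have 1: "real (n - d) * real ((n - d - 1) choose (k - d)) = real (n - k) * real ((n - d) choose (k - d))"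
    using binomial_absorb_comp[of "n - d" "k - d"] d
    by (metis diff_diff_cancel diff_diff_right diff_add_inverse2 diff_le_mono le_add_diff_inverse2 less_imp_le of_nat_mult eq_diff_iff order.strict_implies_order Nat.diff_diff_eq le_trans)
  have 2: "real n * real ((n - 1) choose k) = real (n - k) * real (n choose k)"
    using binomial_absorb_comp[of n k] by (metis of_nat_mult)
  have 3: "real (n choose k) * real (k choose d) = real (n choose d) * real ((n - d) choose (k - d))"
    using choose_mult[of d k n] d by (metis less_imp_le of_nat_mult)
  have pos: "real (n choose k) > 0" "real (n choose d) > 0" "real (n - k) > 0" using d by auto
  show ?thesis unfolding 1 2 using 3 pos by (simp add: field_simps)
qed

text \<open>
  Summation by parts turns \<open>S\<close> into the \<open>d\<close>-th moment of the \<open>(k - d + 1)\<close>-st order statistic of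
  \<open>n - d\<close> uniform variables, each rounded down to a multiple of \<open>1 / u\<close>.
\<close>

lemma uniform_order_statistic_moment:
  fixes d k n u :: nat
  assumes d: "1 \<le> d" "d \<le> k" "k < n" and u: "n \<le> u"
  defines "S \<equiv> (\<Sum>m<u. (real (Suc m) ^ d - real m ^ d) / real u ^ d *
      Bernstein_cdf (n - d) (k - d) (real (Suc m) / real u))"
    and "I \<equiv> real (k choose d) / real (n choose d)"
  shows "S \<le> I" "I * (1 - real d / real k) \<le> S"
proof -
  define N where "N = n - d - 1"
  define t where "t = k - d"
  have N: "n - d = Suc N" "t \<le> N" "N + d = n - 1" "N + (d - 1) = n - 2" "t + d = k" "t + (d - 1) = k - 1"
    "Suc (N + d) = n" "Suc (N + (d - 1)) = n - 1"
    using d by (auto simp: N_def t_def)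
  have u0: "real u > 0" using d u by simp
  define f where "f = Bernstein_cdf (Suc N) t"
  define x where "x = (\<lambda>m. real m / real u)"
  have f1: "f 1 = 0" using N by (simp add: f_def)
  have S1: "S = (\<Sum>m<u. x m ^ d * (f (x m) - f (x (Suc m))))"
  proof -
    have "(\<Sum>m<u. (x (Suc m) ^ d - x m ^ d) * f (x (Suc m)) - x m ^ d * (f (x m) - f (x (Suc m))))
        = (\<Sum>m<u. x (Suc m) ^ d * f (x (Suc m)) - x m ^ d * f (x m))"
      by (intro sum.cong refl) (simp add: algebra_simps)
    also have "\<dots> = x u ^ d * f (x u) - x 0 ^ d * f (x 0)"
      by (rule sum_lessThan_telescope)
    also have "\<dots> = 0" using f1 u0 d by (simp add: x_def)
    finally have "(\<Sum>m<u. (x (Suc m) ^ d - x m ^ d) * f (x (Suc m))) = (\<Sum>m<u. x m ^ d * (f (x m) - f (x (Suc m))))"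
      by (simp add: sum_subtractf)
    moreover have "S = (\<Sum>m<u. (x (Suc m) ^ d - x m ^ d) * f (x (Suc m)))"
      unfolding S_def f_def x_def N(1) t_def[symmetric]
      by (simp only: power_divide diff_divide_distrib)
    ultimately show ?thesis by simp
  qed
  obtain G where G: "\<And>x. (G has_real_derivative x ^ d * (real (Suc N) * Bernstein N t x)) (at x)"
    "G 1 - G 0 = real (Suc N) * real (N choose t) / (real (Suc (N + d)) * real ((N + d) choose (t + d)))"
    using power_mult_Bernstein_antiderivative[OF N(2)] by metis
  obtain G' where G': "\<And>x. (G' has_real_derivative x ^ (d - 1) * (real (Suc N) * Bernstein N t x)) (at x)"
    "G' 1 - G' 0 = real (Suc N) * real (N choose t) / (real (Suc (N + (d - 1))) * real ((N + (d - 1)) choose (t + (d - 1))))"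
    using power_mult_Bernstein_antiderivative[OF N(2)] by metis
  have GI: "G 1 - G 0 = I"
    unfolding G(2) I_def order_statistic_constant[OF d(2,3), symmetric] N(7) unfolding N(3,5)
    by (simp only: N(1) t_def[symmetric] diff_Suc_1)
  \<comment> \<open>Rounding down by at most 1 / u costs d / u times the (d - 1)-st moment. That
    moment is n / k times the d-th, so n <= u makes the relative loss at most d / k.\<close>
  have G'I: "G' 1 - G' 0 = I * (real n / real k)"
  proof -
    have "real (n - 1) * real ((n - 2) choose (k - 1)) = real k * real ((n - 1) choose k)"
    proof -
      obtain k' n' where "k = Suc k'" "n = Suc (Suc n')"
        using d by (metis One_nat_def Suc_le_D le_trans less_imp_Suc_add plus_nat.simps(2))
      then show ?thesis using Suc_times_binomial[of n' k'] by (metis Suc_times_binomial diff_Suc_1 diff_Suc_Suc numeral_2_eq_2 of_nat_mult diff_zero)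
    qed
    then have "G' 1 - G' 0 = real (Suc N) * real (N choose t) / (real k * real ((n - 1) choose k))"
      unfolding G'(2) N(8) unfolding N(4,6) by simp
    also have "\<dots> = (real (Suc N) * real (N choose t) / (real n * real ((n - 1) choose k))) * (real n / real k)"
      using d by simp
    finally show ?thesis unfolding GI[unfolded G(2) N(7), unfolded N(3,5)] .
  qed
  have Bpos: "0 \<le> real (Suc N) * Bernstein N t y" if "0 \<le> y" "y \<le> 1" for y
    using that by (simp add: Bernstein_nonneg)
  have xs: "0 \<le> x m" "x m \<le> x (Suc m)" "x (Suc m) \<le> 1" "x (Suc m) - x m = 1 / real u" if "m < u" for m
    using that u0 by (auto simp: x_def field_simps)
  have Df: "((\<lambda>y. - (c * f y)) has_real_derivative c * (real (Suc N) * Bernstein N t y)) (at y)" for c y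
  proof -
    have "((\<lambda>y. - (c * f y)) has_real_derivative - (c * (- real (Suc N) * Bernstein N t y))) (at y)"
      unfolding f_def by (intro DERIV_minus DERIV_cmult Bernstein_cdf_has_derivative)
    then show ?thesis by (simp del: of_nat_Suc)
  qed
  have up: "x m ^ d * (f (x m) - f (x (Suc m))) \<le> G (x (Suc m)) - G (x m)" if m: "m < u" for m
  proof -
    have "- (x m ^ d * f (x (Suc m))) - - (x m ^ d * f (x m)) \<le> G (x (Suc m)) - G (x m)"
    proof (rule has_derivative_le_imp_diff_le[OF xs(2)[OF m] Df G(1)])
      fix y assume y: "x m \<le> y" "y \<le> x (Suc m)"
      then show "x m ^ d * (real (Suc N) * Bernstein N t y) \<le> y ^ d * (real (Suc N) * Bernstein N t y)"
        using xs[OF m] by (intro mult_right_mono power_mono Bpos) auto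
    qed
    then show ?thesis by (simp add: algebra_simps)
  qed
  have low: "G (x (Suc m)) - G (x m) - real d / real u * (G' (x (Suc m)) - G' (x m))
      \<le> x m ^ d * (f (x m) - f (x (Suc m)))" if m: "m < u" for m
  proof -
    define G2 where "G2 = (\<lambda>y. G y - real d / real u * G' y)"
    have "G2 (x (Suc m)) - G2 (x m) \<le> - (x m ^ d * f (x (Suc m))) - - (x m ^ d * f (x m))"
    proof (rule has_derivative_le_imp_diff_le[OF xs(2)[OF m] _ Df])
      fix y assume y: "x m \<le> y" "y \<le> x (Suc m)"
      let ?B = "real (Suc N) * Bernstein N t y"
      show "(G2 has_real_derivative y ^ d * ?B - real d / real u * (y ^ (d - 1) * ?B)) (at y)"
        unfolding G2_def by (intro DERIV_diff DERIV_cmult G G')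
      have "y ^ d - x m ^ d \<le> real d * y ^ (d - 1) * (y - x m)"
        using xs[OF m] y by (intro power_diff_le) auto
      also have "\<dots> \<le> real d * y ^ (d - 1) * (1 / real u)"
        using xs[OF m] y by (intro mult_left_mono) auto
      finally have "(y ^ d - real d / real u * y ^ (d - 1)) * ?B \<le> x m ^ d * ?B"
        using xs[OF m] y by (intro mult_right_mono Bpos) auto
      then show "y ^ d * ?B - real d / real u * (y ^ (d - 1) * ?B) \<le> x m ^ d * ?B"
        by (simp add: left_diff_distrib mult.assoc)
    qed
    then show ?thesis by (simp add: G2_def algebra_simps)
  qed
  have x01: "x 0 = 0" "x u = 1" using u0 by (auto simp: x_def)
  have "S \<le> (\<Sum>m<u. G (x (Suc m)) - G (x m))" unfolding S1 by (intro sum_mono up) simp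
  also have "\<dots> = I" unfolding sum_lessThan_telescope[of "\<lambda>m. G (x m)"] x01 by (rule GI)
  finally show "S \<le> I" .
  have I0: "I \<ge> 0" by (simp add: I_def)
  have "I * (1 - real d / real k) \<le> I - real d / real u * (I * (real n / real k))"
  proof -
    have "real d / real u * (I * (real n / real k)) = I * (real d / real k) * (real n / real u)"
      by (simp add: mult_ac)
    also have "\<dots> \<le> I * (real d / real k) * 1" using u u0 I0 by (intro mult_left_mono) auto
    finally show ?thesis by (simp add: algebra_simps)
  qed
  also have "\<dots> = (\<Sum>m<u. G (x (Suc m)) - G (x m) - real d / real u * (G' (x (Suc m)) - G' (x m)))"
    unfolding sum_subtractf sum_distrib_left[symmetric] sum_lessThan_telescope[of "\<lambda>m. G (x m)"]
      sum_lessThan_telescope[of "\<lambda>m. G' (x m)"] x01 GI G'I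
    by (simp add: sum_subtractf[symmetric] sum_lessThan_telescope[of "\<lambda>m. G (x m)"]
      sum_lessThan_telescope[of "\<lambda>m. G' (x m)"] x01 GI G'I)
  also have "\<dots> \<le> S" unfolding S1 by (intro sum_mono low) simp
  finally show "I * (1 - real d / real k) \<le> S" .
qed

section \<open>Averaged binomial weights and their growth\<close>

lemma power_increment_le:
  assumes "u > 0"
  shows "(real (Suc m) ^ d - real m ^ d) / real u ^ d \<le> real d / real u * (real (Suc m) / real u) ^ (d - 1)"
proof -
  have "(real (Suc m) ^ d - real m ^ d) / real u ^ d = (real (Suc m) / real u) ^ d - (real m / real u) ^ d"
    by (simp only: power_divide diff_divide_distrib)
  also have "\<dots> \<le> real d * (real (Suc m) / real u) ^ (d - 1) * (real (Suc m) / real u - real m / real u)"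
    by (rule power_diff_le) (auto intro: divide_right_mono)
  also have "real (Suc m) / real u - real m / real u = 1 / real u" by (simp add: diff_divide_distrib[symmetric])
  finally show ?thesis by simp
qed

text \<open>For N + d points in random order, d of them marked, the bound without its 2 is the
  probability that exactly j unmarked points precede the last marked one. The 2 pays for the
  discretisation.\<close>

lemma weighted_Bernstein_sum_le:
  assumes d: "d \<ge> 1" and j: "j \<le> N" and u: "N + d \<le> u"
  shows "(\<Sum>m<u. (real (Suc m) ^ d - real m ^ d) / real u ^ d * Bernstein N j (real (Suc m) / real u))
    \<le> 2 * real ((j + d - 1) choose (d - 1)) / real ((N + d) choose d)"
proof -
  define e where "e = d - 1"
  have e: "d = Suc e" using d by (simp add: e_def)
  have u0: "u > 0" using u d by simp
  define C where "C = real (N choose j) / real ((N + e) choose (j + e))"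
  have "(\<Sum>m<u. (real (Suc m) ^ d - real m ^ d) / real u ^ d * Bernstein N j (real (Suc m) / real u))
      \<le> (\<Sum>m<u. real d / real u * (real (Suc m) / real u) ^ e * Bernstein N j (real (Suc m) / real u))"
    using u0 unfolding e_def
    by (intro sum_mono mult_right_mono power_increment_le Bernstein_nonneg) auto
  also have "\<dots> = (\<Sum>m<u. real d / real u * (C * Bernstein (N + e) (j + e) (real (Suc m) / real u)))"
    unfolding mult.assoc power_mult_Bernstein[OF j] C_def ..
  also have "\<dots> = real d * C * ((\<Sum>i=1..u. Bernstein (N + e) (j + e) (real i / real u)) / real u)"
    by (simp add: sum.atLeast1_atMost_eq sum_distrib_left[symmetric] sum_divide_distrib[symmetric])
  also have "\<dots> \<le> real d * C * (2 / real (Suc (N + e)))"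
    using u e by (intro mult_left_mono Bernstein_Riemann_sum_le) (auto simp: C_def)
  also have "\<dots> = 2 * real ((j + e) choose e) / real ((N + d) choose d)"
  proof -
    have "((N + e) choose (j + e)) * ((j + e) choose e) = ((N + e) choose e) * (N choose j)"
      using choose_mult[of e "j + e" "N + e"] j by simp
    then have 1: "real ((N + e) choose (j + e)) * real ((j + e) choose e) = real ((N + e) choose e) * real (N choose j)"
      by (metis of_nat_mult)
    have "Suc e * (Suc (N + e) choose Suc e) = Suc (N + e) * ((N + e) choose e)"
      by (rule Suc_times_binomial)
    then have 2: "real d * real ((N + d) choose d) = real (Suc (N + e)) * real ((N + e) choose e)"
      unfolding e by (metis add_Suc_right of_nat_mult)
    have pos: "real ((N + e) choose (j + e)) > 0" "real ((N + d) choose d) > 0" "real (Suc (N + e)) > 0"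
      using j by auto
    have "real d * real (N choose j) * real ((N + d) choose d)
        = real (Suc (N + e)) * (real ((N + e) choose e) * real (N choose j))"
      using 2 by (metis mult.assoc mult.commute)
    also have "\<dots> = real ((j + e) choose e) * (real ((N + e) choose (j + e)) * real (Suc (N + e)))"
      unfolding 1[symmetric] by (simp only: mult_ac)
    finally have "real d * real (N choose j) / (real ((N + e) choose (j + e)) * real (Suc (N + e)))
        = real ((j + e) choose e) / real ((N + d) choose d)"
      using pos by (simp add: frac_eq_eq del: of_nat_Suc)
    then have "2 * (real d * real (N choose j) / (real ((N + e) choose (j + e)) * real (Suc (N + e))))
        = 2 * (real ((j + e) choose e) / real ((N + d) choose d))" by simp
    then show ?thesis unfolding C_def by (simp add: mult_ac del: of_nat_Suc)
  qed
  finally show ?thesis by (simp add: e)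
qed

text \<open>The logarithm of the left side is concave in j, so it lies below its tangent at j = t,
  on both sides of t. Factor by factor this is 1 + x <= exp x.\<close>

lemma binomial_le_exp_binomial:
  fixes j t e :: nat
  shows "real ((j + e) choose e)
    \<le> real ((t + e) choose e) * exp ((real j - real t) * (\<Sum>i<e. 1 / real (t + Suc i)))"
proof (induction e)
  case (Suc e)
  let ?s = "\<Sum>i<e. 1 / real (t + Suc i)"
  have rec: "real ((a + Suc e) choose Suc e) = real ((a + e) choose e) * (real (a + Suc e) / real (Suc e))" for a
  proof -
    have "Suc e * (Suc (a + e) choose Suc e) = Suc (a + e) * ((a + e) choose e)"
      by (rule Suc_times_binomial)
    then have "real (Suc e) * real ((a + Suc e) choose Suc e) = real (a + Suc e) * real ((a + e) choose e)"
      by (metis add_Suc_right of_nat_mult)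
    then show ?thesis by (simp add: field_simps del: of_nat_Suc)
  qed
  have "real (j + Suc e) / real (t + Suc e) = 1 + (real j - real t) * (1 / real (t + Suc e))"
    by (simp add: field_simps)
  also have "\<dots> \<le> exp ((real j - real t) * (1 / real (t + Suc e)))"
    by (rule exp_ge_add_one_self)
  finally have f: "real (j + Suc e) \<le> real (t + Suc e) * exp ((real j - real t) * (1 / real (t + Suc e)))"
    by (simp add: field_simps)
  have "real ((j + Suc e) choose Suc e) = real ((j + e) choose e) * (real (j + Suc e) / real (Suc e))" by (rule rec)
  also have "\<dots> \<le> (real ((t + e) choose e) * exp ((real j - real t) * ?s)) *
      (real (t + Suc e) * exp ((real j - real t) * (1 / real (t + Suc e))) / real (Suc e))"
    by (intro mult_mono Suc divide_right_mono f) auto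
  also have "\<dots> = real ((t + Suc e) choose Suc e) * exp ((real j - real t) * (\<Sum>i<Suc e. 1 / real (t + Suc i)))"
    unfolding rec[of t] by (simp add: distrib_left exp_add mult_ac del: of_nat_Suc)
  finally show ?case .
qed simp

text \<open>Moment bounds come out relative to (t / N)^d; this compares them with the target
  probability. Adding the same number to t and to N only increases the ratio.\<close>

lemma power_ratio_le_binomial_ratio:
  assumes "t \<le> N" "0 < N"
  shows "(real t / real N) ^ d \<le> real ((t + d) choose d) / real ((N + d) choose d)"
proof -
  have "real t ^ d * real ((N + d) choose d) \<le> real N ^ d * real ((t + d) choose d)"
  proof (induction d)
    case (Suc d)
    have rec: "real ((a + Suc d) choose Suc d) = real ((a + d) choose d) * real (a + Suc d) / real (Suc d)" for a
    proof -
      have "Suc d * (Suc (a + d) choose Suc d) = Suc (a + d) * ((a + d) choose d)"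
        by (rule Suc_times_binomial)
      then have "real (Suc d) * real ((a + Suc d) choose Suc d) = real (a + Suc d) * real ((a + d) choose d)"
        by (metis add_Suc_right of_nat_mult)
      then show ?thesis by (simp add: field_simps del: of_nat_Suc)
    qed
    have "t * Suc d \<le> N * Suc d" using assms(1) by (rule mult_le_mono1)
    then have "t * (N + Suc d) \<le> N * (t + Suc d)"
      unfolding distrib_left by (simp only: mult.commute[of t N] add_le_cancel_left)
    then have le: "real t * real (N + Suc d) \<le> real N * real (t + Suc d)" by (metis of_nat_le_iff of_nat_mult)
    have "(real t ^ d * real ((N + d) choose d)) * (real t * real (N + Suc d))
        \<le> (real N ^ d * real ((t + d) choose d)) * (real N * real (t + Suc d))"
      by (intro mult_mono Suc le) auto
    then have "(real t ^ d * real ((N + d) choose d)) * (real t * real (N + Suc d)) / real (Suc d)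
        \<le> (real N ^ d * real ((t + d) choose d)) * (real N * real (t + Suc d)) / real (Suc d)"
      by (rule divide_right_mono) simp
    then show ?case unfolding rec by (simp add: mult_ac del: of_nat_Suc of_nat_add)
  qed simp
  then show ?thesis using assms by (simp add: power_divide field_simps)
qed

section \<open>Hash families of limited independence\<close>

text \<open>Independence is given for exactly l points, so Z is padded with unconstrained points,
  for which l <= u leaves room. The event splits into fibres of the restriction to the padded set,
  all with equally many functions.\<close>

lemma wise_independent_prob_Ball:
  assumes H: "wise_independent l u H" and lu: "l \<le> u"
    and Z: "Z \<subseteq> {..<u}" "card Z \<le> l" and B: "\<And>z. z \<in> Z \<Longrightarrow> B z \<subseteq> {..<u}"
  shows "measure_pmf.prob (pmf_of_set H) {h. \<forall>z\<in>Z. h z \<in> B z} = (\<Prod>z\<in>Z. real (card (B z)) / real u)"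
proof -
  have hf: "H \<noteq> {}" "H \<subseteq> {..<u} \<rightarrow>\<^sub>E {..<u}"
    using H by (auto simp: wise_independent_def hash_family_def)
  have fH: "finite H" using hf(2) by (rule finite_subset) (auto intro: finite_PiE)
  have cH: "card H > 0" using hf fH by (simp add: card_gt_0_iff)
  obtain Z' where Z': "Z \<subseteq> Z'" "Z' \<subseteq> {..<u}" "card Z' = l"
    using exists_subset_between[of Z l "{..<u}"] Z lu by auto
  have fZ: "finite Z'" "finite Z" using Z' Z by (auto intro: finite_subset)
  obtain x where x: "bij_betw x {..<l} Z'"
    using ex_bij_betw_nat_finite[OF fZ(1)] Z'(3) by (auto simp: atLeast0LessThan)
  define B' where "B' = (\<lambda>z. if z \<in> Z then B z else {..<u})"
  have B': "B' z \<subseteq> {..<u}" for z using B by (auto simp: B'_def)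
  define S where "S = {h \<in> H. \<forall>z\<in>Z. h z \<in> B z}"
  have fiber: "real (card {h \<in> S. restrict h Z' = w}) = real (card H) / real u ^ l" if w: "w \<in> PiE Z' B'" for w
  proof -
    have "measure_pmf.prob (pmf_of_set H) {h. \<forall>i<l. h (x i) = w (x i)} = 1 / real u ^ l"
    proof -
      have "inj_on x {..<l}" "x ` {..<l} \<subseteq> {..<u}"
        using x Z' by (auto simp: bij_betw_def)
      moreover have "(\<lambda>i. w (x i)) ` {..<l} \<subseteq> {..<u}"
        using x w B' unfolding bij_betw_def PiE_def Pi_def by blast
      ultimately show ?thesis
        using H unfolding wise_independent_def by blast
    qed
    moreover have "{h \<in> S. restrict h Z' = w} = H \<inter> {h. \<forall>i<l. h (x i) = w (x i)}"
    proof -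
      have "restrict h Z' = w \<longleftrightarrow> (\<forall>z\<in>Z'. h z = w z)" for h
        using w by (auto simp: PiE_def extensional_def restrict_def fun_eq_iff)
      moreover have "(\<forall>z\<in>Z'. h z = w z) \<longleftrightarrow> (\<forall>i<l. h (x i) = w (x i))" for h
        using x by (auto simp: bij_betw_def)
      moreover have "h \<in> S" if "h \<in> H" "\<forall>z\<in>Z'. h z = w z" for h
        using that w Z' unfolding S_def by (force simp: B'_def PiE_def Pi_def)
      ultimately show ?thesis by (auto simp: S_def)
    qed
    ultimately show ?thesis
      using cH by (simp add: measure_pmf_of_set[OF hf(1) fH] field_simps)
  qed
  have "real (card S) = (\<Sum>w\<in>PiE Z' B'. real (card {h \<in> S. restrict h Z' = w}))"
  proof -
    have "(\<Sum>w\<in>PiE Z' B'. \<Sum>h\<in>{h \<in> S. restrict h Z' = w}. 1 :: real) = (\<Sum>h\<in>S. 1)"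
    proof (rule sum.group)
      show "finite S" using fH by (simp add: S_def)
      show "finite (PiE Z' B')" using fZ B' by (intro finite_PiE) (auto intro: finite_subset)
      show "(\<lambda>h. restrict h Z') ` S \<subseteq> PiE Z' B'"
      proof (intro image_subsetI restrict_PiE_iff[THEN iffD2] ballI)
        fix h z assume hz: "h \<in> S" "z \<in> Z'"
        then have "h \<in> {..<u} \<rightarrow>\<^sub>E {..<u}" "z \<in> {..<u}" using hf(2) Z' by (auto simp: S_def)
        then have "h z \<in> {..<u}" by (rule PiE_mem)
        then show "h z \<in> B' z" using hz by (auto simp: S_def B'_def)
      qed
    qed
    then show ?thesis by simp
  qed
  also have "\<dots> = real (card (PiE Z' B')) * (real (card H) / real u ^ l)"
    using fiber by simp
  also have "card (PiE Z' B') = (\<Prod>z\<in>Z'. card (B' z))" using fZ by (simp add: card_PiE)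
  also have "(\<Prod>z\<in>Z'. card (B' z)) = (\<Prod>z\<in>Z. card (B z)) * u ^ (l - card Z)"
  proof -
    have "(\<Prod>z\<in>Z'. card (B' z)) = (\<Prod>z\<in>Z. card (B' z)) * (\<Prod>z\<in>Z' - Z. card (B' z))"
      using prod.subset_diff[OF Z'(1) fZ(1), of "\<lambda>z. card (B' z)"] by (simp add: mult.commute)
    then show ?thesis using Z' fZ by (simp add: B'_def card_Diff_subset)
  qed
  finally have S: "real (card S) = real ((\<Prod>z\<in>Z. card (B z)) * u ^ (l - card Z)) * (real (card H) / real u ^ l)" .
  have "measure_pmf.prob (pmf_of_set H) {h. \<forall>z\<in>Z. h z \<in> B z} = real (card S) / real (card H)"
    unfolding measure_pmf_of_set[OF hf(1) fH] S_def by (simp add: Int_def)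
  also have "\<dots> = real (\<Prod>z\<in>Z. card (B z)) * (real u ^ (l - card Z) / real u ^ l)"
    unfolding S using cH by simp
  also have "real u ^ (l - card Z) / real u ^ l = 1 / real u ^ card Z"
  proof (cases "u = 0")
    case True
    then show ?thesis using lu Z by simp
  next
    case False
    then show ?thesis using Z(2) by (simp add: power_diff)
  qed
  finally show ?thesis by (simp add: prod_dividef)
qed

text \<open>The binomial coefficient counts the r-subsets of X hashed into {..m}. Together with Y
  each involves only d + r <= l points. The free threshold \<open>a\<close> on Y allows a difference
  to be taken later.\<close>

lemma wise_independent_binomial_moment:
  fixes d r m a :: nat
  assumes H: "wise_independent l u H" and lu: "l \<le> u"
    and X: "X \<subseteq> {..<u}" and Y: "Y \<subseteq> {..<u}" "card Y = d" "X \<inter> Y = {}"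
    and dr: "d + r \<le> l" and m: "m < u" and a: "a \<le> u"
  shows "(\<Sum>h\<in>H. of_bool (\<forall>y\<in>Y. h y < a) * real (card {x \<in> X. h x \<le> m} choose r)) / real (card H)
    = (real a / real u) ^ d * (real (card X choose r) * (real (Suc m) / real u) ^ r)"
proof -
  have hf: "H \<noteq> {}" "H \<subseteq> {..<u} \<rightarrow>\<^sub>E {..<u}"
    using H by (auto simp: wise_independent_def hash_family_def)
  have fH: "finite H" using hf(2) by (rule finite_subset) (auto intro: finite_PiE)
  have fX: "finite X" "finite Y" using X Y by (auto intro: finite_subset)
  define T where "T = {S. S \<subseteq> X \<and> card S = r}"
  have fT: "finite T" "card T = card X choose r"
    using fX n_subsets[of X r] by (auto simp: T_def)
  have choose_eq: "real (card {x \<in> X. h x \<le> m} choose r) = (\<Sum>S\<in>T. of_bool (\<forall>x\<in>S. h x \<le> m))" for h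
  proof -
    have "card {x \<in> X. h x \<le> m} choose r = card {S. S \<subseteq> {x \<in> X. h x \<le> m} \<and> card S = r}"
      using n_subsets[of "{x \<in> X. h x \<le> m}" r] fX by simp
    also have "{S. S \<subseteq> {x \<in> X. h x \<le> m} \<and> card S = r} = {S \<in> T. \<forall>x\<in>S. h x \<le> m}"
      by (auto simp: T_def)
    finally show ?thesis using fT by (simp add: sum.If_cases of_bool_def Int_def)
  qed
  have single: "(\<Sum>h\<in>H. of_bool (\<forall>y\<in>Y. h y < a) * of_bool (\<forall>x\<in>S. h x \<le> m)) / real (card H)
      = (real a / real u) ^ d * (real (Suc m) / real u) ^ r" if S: "S \<in> T" for S
  proof -
    define B where "B = (\<lambda>z. if z \<in> Y then {..<a} else {..m})"
    have SX: "S \<subseteq> X" "card S = r" "finite S" "S \<inter> Y = {}"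
      using S X Y fX by (auto simp: T_def intro: finite_subset)
    have disj: "Y \<inter> S = {}" using SX by auto
    have cYS: "card (Y \<union> S) = d + r" using card_Un_disjoint[OF fX(2) SX(3) disj] Y SX by simp
    have "measure_pmf.prob (pmf_of_set H) {h. \<forall>z\<in>Y \<union> S. h z \<in> B z} = (\<Prod>z\<in>Y \<union> S. real (card (B z)) / real u)"
    proof (rule wise_independent_prob_Ball[OF H lu])
      show "Y \<union> S \<subseteq> {..<u}" using X Y SX by auto
      show "card (Y \<union> S) \<le> l" using cYS dr by simp
      fix z show "B z \<subseteq> {..<u}" using a m by (auto simp: B_def)
    qed
    also have "\<dots> = (\<Prod>z\<in>Y. real (card (B z)) / real u) * (\<Prod>z\<in>S. real (card (B z)) / real u)"
      by (rule prod.union_disjoint[OF fX(2) SX(3) disj])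
    also have "(\<Prod>z\<in>Y. real (card (B z)) / real u) = (real a / real u) ^ d"
      using Y by (simp add: B_def)
    also have "(\<Prod>z\<in>S. real (card (B z)) / real u) = (\<Prod>z\<in>S. real (Suc m) / real u)"
      using SX by (intro prod.cong refl) (auto simp: B_def)
    also have "\<dots> = (real (Suc m) / real u) ^ r" using SX by simp
    also have "measure_pmf.prob (pmf_of_set H) {h. \<forall>z\<in>Y \<union> S. h z \<in> B z}
        = (\<Sum>h\<in>H. of_bool (\<forall>z\<in>Y \<union> S. h z \<in> B z)) / real (card H)"
      unfolding measure_pmf_of_set[OF hf(1) fH] using fH by (simp add: sum.If_cases of_bool_def Int_def)
    also have "(\<Sum>h\<in>H. of_bool (\<forall>z\<in>Y \<union> S. h z \<in> B z)) = (\<Sum>h\<in>H. of_bool (\<forall>y\<in>Y. h y < a) * of_bool (\<forall>x\<in>S. h x \<le> m) :: real)"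
      using SX by (intro sum.cong refl) (auto simp: B_def)
    finally show ?thesis .
  qed
  have "(\<Sum>h\<in>H. of_bool (\<forall>y\<in>Y. h y < a) * real (card {x \<in> X. h x \<le> m} choose r)) / real (card H)
      = (\<Sum>S\<in>T. (\<Sum>h\<in>H. of_bool (\<forall>y\<in>Y. h y < a) * of_bool (\<forall>x\<in>S. h x \<le> m)) / real (card H))"
    unfolding choose_eq sum_distrib_left sum_divide_distrib[symmetric] by (subst sum.swap) simp
  also have "\<dots> = real (card T) * ((real a / real u) ^ d * (real (Suc m) / real u) ^ r)"
    using single by simp
  finally show ?thesis using fT by simp
qed

text \<open>What matters is that the coefficients do not depend on N: moments of binomial
  coefficients then determine those of powers.\<close>

lemma power_binomial_basis:
  "\<exists>a. \<forall>N. real N ^ r = (\<Sum>i\<le>r. a i * real (N choose i))"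
proof (induction r)
  case 0
  show ?case by (intro exI[of _ "\<lambda>_. 1"]) simp
next
  case (Suc r)
  then obtain a where a: "\<And>N. real N ^ r = (\<Sum>i\<le>r. a i * real (N choose i))" by blast
  have absorb: "real N * real (N choose i) = real (Suc i) * real (N choose Suc i) + real i * real (N choose i)" for N i
  proof -
    have "Suc i * (N choose Suc i) = (N - i) * (N choose i)"
      using binomial_absorb_comp[of N i] binomial_absorption[of i N] by (cases N) auto
    then have "real (Suc i) * real (N choose Suc i) = real (N - i) * real (N choose i)"
      by (metis of_nat_mult)
    then show ?thesis by (cases "i \<le> N") (auto simp: algebra_simps of_nat_diff)
  qed
  define a' where "a' = (\<lambda>i. (if i = 0 then 0 else real i * a (i - 1)) + (if i \<le> r then real i * a i else 0))"
  have "real N ^ Suc r = (\<Sum>i\<le>Suc r. a' i * real (N choose i))" for N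
  proof -
    have "real N ^ Suc r = (\<Sum>i\<le>r. a i * (real N * real (N choose i)))"
      by (simp add: a sum_distrib_left mult_ac)
    also have "\<dots> = (\<Sum>i\<le>r. real (Suc i) * a i * real (N choose Suc i)) + (\<Sum>i\<le>r. real i * a i * real (N choose i))"
      unfolding absorb sum.distrib[symmetric] by (intro sum.cong refl) (simp add: algebra_simps)
    also have "(\<Sum>i\<le>r. real (Suc i) * a i * real (N choose Suc i))
        = (\<Sum>i\<le>Suc r. (if i = 0 then 0 else real i * a (i - 1)) * real (N choose i))"
      by (subst sum.atMost_Suc_shift) simp
    also have "(\<Sum>i\<le>r. real i * a i * real (N choose i))
        = (\<Sum>i\<le>Suc r. (if i \<le> r then real i * a i else 0) * real (N choose i))"
      by simp
    finally show ?thesis by (simp add: a'_def sum.distrib distrib_right)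
  qed
  then show ?case by blast
qed

text \<open>The difference of the thresholds \<open>Suc m\<close> and m singles out the functions
  with maximum m on Y. Both sides are linear in q and agree on binomial coefficients of order up to
  l - d, hence on polynomials of that degree.\<close>

lemma wise_independent_poly_moment:
  fixes d m :: nat and q :: "real poly"
  assumes H: "wise_independent l u H" and lu: "l \<le> u"
    and X: "X \<subseteq> {..<u}" and Y: "Y \<subseteq> {..<u}" "card Y = d" "X \<inter> Y = {}"
    and dq: "d + degree q \<le> l" and m: "m < u"
  shows "(\<Sum>h\<in>H. of_bool ((\<forall>y\<in>Y. h y \<le> m) \<and> \<not> (\<forall>y\<in>Y. h y < m)) * poly q (real (card {x \<in> X. h x \<le> m}))) / real (card H)
    = (real (Suc m) ^ d - real m ^ d) / real u ^ d *
      (\<Sum>j\<le>card X. Bernstein (card X) j (real (Suc m) / real u) * poly q (real j))"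
    (is "?L (\<lambda>N. poly q (real N)) = ?W * ?R (\<lambda>j. poly q (real j))")
proof -
  define f where "f = (\<lambda>h. of_bool ((\<forall>y\<in>Y. h y \<le> m) \<and> \<not> (\<forall>y\<in>Y. h y < m)) :: real)"
  define N where "N = (\<lambda>h. card {x \<in> X. h x \<le> m})"
  define p where "p = real (Suc m) / real u"
  define L where "L = (\<lambda>g :: nat \<Rightarrow> real. (\<Sum>h\<in>H. f h * g (N h)) / real (card H))"
  define R where "R = (\<lambda>g. \<Sum>j\<le>card X. Bernstein (card X) j p * g j)"
  have lin: "L (\<lambda>n. \<Sum>i\<le>k. c i * g i n) = (\<Sum>i\<le>k. c i * L (g i))"
    "R (\<lambda>n. \<Sum>i\<le>k. c i * g i n) = (\<Sum>i\<le>k. c i * R (g i))" for k c g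
  proof -
    have "(\<Sum>h\<in>H. f h * (\<Sum>i\<le>k. c i * g i (N h))) = (\<Sum>i\<le>k. c i * (\<Sum>h\<in>H. f h * g i (N h)))"
      unfolding sum_distrib_left by (subst sum.swap) (simp add: mult_ac)
    then show "L (\<lambda>n. \<Sum>i\<le>k. c i * g i n) = (\<Sum>i\<le>k. c i * L (g i))"
      unfolding L_def by (simp only: sum_divide_distrib[of _ "{..k}"] times_divide_eq_right)
    show "R (\<lambda>n. \<Sum>i\<le>k. c i * g i n) = (\<Sum>i\<le>k. c i * R (g i))"
      unfolding R_def sum_distrib_left by (subst sum.swap) (simp add: mult_ac)
  qed
  have binom: "L (\<lambda>n. real (n choose r)) = ?W * R (\<lambda>n. real (n choose r))" if "d + r \<le> l" for r
  proof -
    have f: "f h = of_bool (\<forall>y\<in>Y. h y < Suc m) - of_bool (\<forall>y\<in>Y. h y < m)" for h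
      unfolding f_def by (auto simp: less_Suc_eq_le intro: less_imp_le)
    have "L (\<lambda>n. real (n choose r)) =
        (real (Suc m) / real u) ^ d * (real (card X choose r) * p ^ r)
        - (real m / real u) ^ d * (real (card X choose r) * p ^ r)"
      unfolding L_def f N_def left_diff_distrib sum_subtractf diff_divide_distrib p_def
      using m by (subst (1 2) wise_independent_binomial_moment[OF H lu X Y that]) auto
    also have "\<dots> = ?W * (real (card X choose r) * p ^ r)"
      by (simp only: power_divide diff_divide_distrib left_diff_distrib)
    also have "real (card X choose r) * p ^ r = R (\<lambda>n. real (n choose r))"
      unfolding R_def by (rule Bernstein_binomial_moment[symmetric])
    finally show ?thesis .
  qed
  have power: "L (\<lambda>n. real n ^ r) = ?W * R (\<lambda>n. real n ^ r)" if r: "d + r \<le> l" for r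
  proof -
    obtain a where a: "\<And>N. real N ^ r = (\<Sum>i\<le>r. a i * real (N choose i))"
      using power_binomial_basis by blast
    have "(\<Sum>i\<le>r. a i * L (\<lambda>n. real (n choose i))) = (\<Sum>i\<le>r. a i * (?W * R (\<lambda>n. real (n choose i))))"
      using r by (intro sum.cong refl arg_cong2[of _ _ _ _ "(*)"] binom) simp
    then show ?thesis unfolding a lin sum_distrib_left by (simp only: mult.left_commute)
  qed
  have "L (\<lambda>n. poly q (real n)) = ?W * R (\<lambda>n. poly q (real n))"
  proof -
    have "(\<Sum>i\<le>degree q. coeff q i * L (\<lambda>n. real n ^ i))
        = (\<Sum>i\<le>degree q. coeff q i * (?W * R (\<lambda>n. real n ^ i)))"
      using dq by (intro sum.cong refl arg_cong2[of _ _ _ _ "(*)"] power) simp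
    then show ?thesis unfolding poly_altdef lin sum_distrib_left by (simp only: mult.left_commute)
  qed
  then show ?thesis unfolding L_def R_def f_def N_def p_def .
qed

section \<open>From ranks to counts\<close>

lemma sorted_nth_le_iff:
  fixes xs :: "'a :: linorder list"
  assumes "sorted xs" "i < length xs"
  shows "xs ! i \<le> m \<longleftrightarrow> i < length (filter (\<lambda>v. v \<le> m) xs)"
  using assms
proof (induction xs arbitrary: i)
  case (Cons x xs)
  show ?case
  proof (cases "x \<le> m")
    case True
    then show ?thesis using Cons by (cases i) auto
  next
    case False
    then have "filter (\<lambda>v. v \<le> m) (x # xs) = []" using Cons.prems by (auto simp: filter_empty_conv)
    moreover have "x \<le> (x # xs) ! i" using Cons.prems by (cases i) auto
    ultimately show ?thesis using False by auto
  qed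
qed simp

lemma RANK_hash_values_le_iff:
  assumes "finite X" "1 \<le> j" "j \<le> card X"
  shows "RANK j (hash_values h X) \<le> m \<longleftrightarrow> j \<le> card {x \<in> X. h x \<le> m}"
proof -
  define xs where "xs = sorted_list_of_multiset (hash_values h X)"
  have xs: "sorted xs" "mset xs = hash_values h X" by (simp_all add: xs_def)
  have len: "length xs = card X" using arg_cong[OF xs(2), of size] by (simp add: hash_values_def)
  have "length (filter (\<lambda>v. v \<le> m) xs) = size (filter_mset (\<lambda>v. v \<le> m) (hash_values h X))"
    using xs(2) by (metis mset_filter size_mset)
  also have "\<dots> = card {x \<in> X. h x \<le> m}"
    unfolding hash_values_def filter_mset_image_mset using assms(1)
    by (simp add: filter_mset_mset_set)
  finally have "length (filter (\<lambda>v. v \<le> m) xs) = card {x \<in> X. h x \<le> m}" .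
  then show ?thesis
    using sorted_nth_le_iff[OF xs(1), of "j - 1" m] assms len unfolding RANK_def xs_def[symmetric] by auto
qed

text \<open>The event is split by the maximum m on Y. For each m the family average and the binomial
  average of the indicator lie between the averages of the two polynomials, and those coincide for
  family and binomial. The polynomials may depend on m.\<close>

lemma wise_independent_rank_prob_error:
  fixes d t :: nat and qp qm :: "nat \<Rightarrow> real poly"
  assumes H: "wise_independent l u H" and lu: "l \<le> u"
    and X: "X \<subseteq> {..<u}" and Y: "Y \<subseteq> {..<u}" "card Y = d" "X \<inter> Y = {}"
    and d: "d \<ge> 1" and t: "t < card X"
    and deg: "\<And>m. m < u \<Longrightarrow> d + degree (qp m) \<le> l" "\<And>m. m < u \<Longrightarrow> d + degree (qm m) \<le> l"
    and le: "\<And>m j. m < u \<Longrightarrow> poly (qm m) (real j) \<le> of_bool (j \<le> t)"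
    and ge: "\<And>m j. m < u \<Longrightarrow> of_bool (j \<le> t) \<le> poly (qp m) (real j)"
  shows "\<bar>measure_pmf.prob (pmf_of_set H) {h. RANK d (hash_values h Y) < RANK (t + 1) (hash_values h X)}
      - (\<Sum>m<u. (real (Suc m) ^ d - real m ^ d) / real u ^ d * Bernstein_cdf (card X) t (real (Suc m) / real u))\<bar>
    \<le> (\<Sum>m<u. (real (Suc m) ^ d - real m ^ d) / real u ^ d *
        (\<Sum>j\<le>card X. Bernstein (card X) j (real (Suc m) / real u) * (poly (qp m) (real j) - poly (qm m) (real j))))"
proof -
  have hf: "H \<noteq> {}" "H \<subseteq> {..<u} \<rightarrow>\<^sub>E {..<u}"
    using H by (auto simp: wise_independent_def hash_family_def)
  have fH: "finite H" using hf(2) by (rule finite_subset) (auto intro: finite_PiE)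
  have cH: "card H > 0" using hf fH by (simp add: card_gt_0_iff)
  have fX: "finite X" "finite Y" using X Y by (auto intro: finite_subset)
  define A where "A = (\<lambda>m h. (\<forall>y\<in>Y. h y \<le> m) \<and> \<not> (\<forall>y\<in>Y. h y < (m::nat)))"
  define N where "N = (\<lambda>m h. card {x \<in> X. h x \<le> (m::nat)})"
  define W where "W = (\<lambda>m. (real (Suc m) ^ d - real m ^ d) / real u ^ d)"
  define pr where "pr = (\<lambda>m. real (Suc m) / real u)"
  define L where "L = (\<lambda>m (g :: nat \<Rightarrow> real). (\<Sum>h\<in>H. of_bool (A m h) * g (N m h)) / real (card H))"
  define R where "R = (\<lambda>m g. \<Sum>j\<le>card X. Bernstein (card X) j (pr m) * g j)"
  have poly_eq: "L m (\<lambda>j. poly q (real j)) = W m * R m (\<lambda>j. poly q (real j))"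
    if "m < u" "d + degree q \<le> l" for m q
    using wise_independent_poly_moment[OF H lu X Y that(2,1)]
    unfolding L_def R_def A_def N_def W_def pr_def .
  have Lmono: "L m g \<le> L m g'" if "\<And>j. g j \<le> g' j" for m g g'
    unfolding L_def using that by (intro divide_right_mono sum_mono mult_left_mono) auto
  have Rmono: "R m g \<le> R m g'" if "\<And>j. g j \<le> g' j" "m < u" for m g g'
    unfolding R_def pr_def using that by (intro sum_mono mult_left_mono Bernstein_nonneg) auto
  have W0: "W m \<ge> 0" for m unfolding W_def by (auto intro!: divide_nonneg_nonneg power_mono)
  have A_iff: "A m h \<longleftrightarrow> RANK d (hash_values h Y) = m" for m h
  proof -
    have *: "RANK d (hash_values h Y) \<le> i \<longleftrightarrow> (\<forall>y\<in>Y. h y \<le> i)" for i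
    proof -
      have "d \<le> card {y \<in> Y. h y \<le> i} \<longleftrightarrow> {y \<in> Y. h y \<le> i} = Y"
        using card_seteq[of Y "{y \<in> Y. h y \<le> i}"] fX Y by auto
      then show ?thesis using RANK_hash_values_le_iff[OF fX(2), of d h i] d Y by auto
    qed
    have lt: "(\<forall>y\<in>Y. h y < m) \<longleftrightarrow> RANK d (hash_values h Y) < m"
    proof (cases m)
      case 0
      then show ?thesis using Y d by auto
    next
      case (Suc m')
      then show ?thesis using *[of m'] by (auto simp: less_Suc_eq_le)
    qed
    show ?thesis unfolding A_def lt *[symmetric] by auto
  qed
  have rank_lt: "RANK d (hash_values h Y) < u" if "h \<in> H" for h
  proof -
    have "\<forall>y\<in>Y. h y < u" using that hf(2) Y by (force dest: PiE_mem)
    moreover have "u > 0" using t X by (cases u) auto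
    ultimately have "\<forall>y\<in>Y. h y \<le> u - 1" by auto
    then have "{y \<in> Y. h y \<le> u - 1} = Y" by auto
    then have "RANK d (hash_values h Y) \<le> u - 1"
      using RANK_hash_values_le_iff[OF fX(2), of d h "u - 1"] d Y by simp
    then show ?thesis using \<open>u > 0\<close> by simp
  qed
  \<comment> \<open>Exactly one m below u is the maximum on Y, so a single summand can be nonzero;
    the rank t + 1 exceeds it exactly when at most t values on X do not.\<close>
  have event: "of_bool (RANK d (hash_values h Y) < RANK (t + 1) (hash_values h X))
      = (\<Sum>m<u. of_bool (A m h) * of_bool (N m h \<le> t) :: real)" if h: "h \<in> H" for h
  proof -
    define r where "r = RANK d (hash_values h Y)"
    have "(\<Sum>m<u. of_bool (A m h) * of_bool (N m h \<le> t) :: real) = (\<Sum>m<u. if m = r then of_bool (N m h \<le> t) else 0)"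
      unfolding A_iff r_def by (intro sum.cong refl) auto
    also have "\<dots> = of_bool (N r h \<le> t)" using rank_lt[OF h] by (simp add: r_def)
    also have "N r h \<le> t \<longleftrightarrow> \<not> RANK (t + 1) (hash_values h X) \<le> r"
      using RANK_hash_values_le_iff[OF fX(1), of "t + 1" h r] t by (auto simp: N_def)
    finally show ?thesis by (simp add: r_def not_le)
  qed
  have "measure_pmf.prob (pmf_of_set H) {h. RANK d (hash_values h Y) < RANK (t + 1) (hash_values h X)}
      = (\<Sum>h\<in>H. of_bool (RANK d (hash_values h Y) < RANK (t + 1) (hash_values h X))) / real (card H)"
    unfolding measure_pmf_of_set[OF hf(1) fH] using fH by (simp add: sum.If_cases of_bool_def Int_def)
  also have "\<dots> = (\<Sum>m<u. L m (\<lambda>j. of_bool (j \<le> t)))"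
    unfolding L_def sum_divide_distrib[symmetric]
    by (subst sum.swap) (simp only: event cong: sum.cong)
  finally have prob: "measure_pmf.prob (pmf_of_set H) {h. RANK d (hash_values h Y) < RANK (t + 1) (hash_values h X)}
      = (\<Sum>m<u. L m (\<lambda>j. of_bool (j \<le> t)))" .
  have cdf: "Bernstein_cdf (card X) t (pr m) = R m (\<lambda>j. of_bool (j \<le> t))" for m
  proof -
    have "R m (\<lambda>j. of_bool (j \<le> t)) = (\<Sum>j\<in>{..card X} \<inter> {..t}. Bernstein (card X) j (pr m))"
      unfolding R_def sum.inter_restrict[OF finite_atMost] by (intro sum.cong refl) auto
    also have "{..card X} \<inter> {..t} = {..t}" using t by auto
    finally show ?thesis by (simp add: Bernstein_cdf_def)
  qed
  have term_err: "\<bar>L m (\<lambda>j. of_bool (j \<le> t)) - W m * R m (\<lambda>j. of_bool (j \<le> t))\<bar>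
      \<le> W m * R m (\<lambda>j. poly (qp m) (real j) - poly (qm m) (real j))" if m: "m < u" for m
  proof -
    let ?i = "\<lambda>j. of_bool (j \<le> t) :: real"
    let ?p = "\<lambda>j. poly (qp m) (real j)" and ?q = "\<lambda>j. poly (qm m) (real j)"
    have "W m * R m ?q \<le> L m ?i" "L m ?i \<le> W m * R m ?p"
      using Lmono[of ?q ?i m] Lmono[of ?i ?p m] le ge m deg poly_eq by auto
    moreover have "W m * R m ?q \<le> W m * R m ?i" "W m * R m ?i \<le> W m * R m ?p"
      using Rmono le ge m W0 by (auto intro!: mult_left_mono)
    moreover have "R m (\<lambda>j. ?p j - ?q j) = R m ?p - R m ?q"
      unfolding R_def by (simp add: right_diff_distrib sum_subtractf)
    ultimately show ?thesis by (simp add: right_diff_distrib abs_le_iff)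
  qed
  have "\<bar>(\<Sum>m<u. L m (\<lambda>j. of_bool (j \<le> t))) - (\<Sum>m<u. W m * R m (\<lambda>j. of_bool (j \<le> t)))\<bar>
      \<le> (\<Sum>m<u. W m * R m (\<lambda>j. poly (qp m) (real j) - poly (qm m) (real j)))"
    unfolding sum_subtractf[symmetric] by (intro order_trans[OF sum_abs] sum_mono term_err) auto
  then show ?thesis unfolding cdf[symmetric] unfolding prob R_def W_def pr_def .
qed

section \<open>The total error\<close>

context
  fixes d t N u :: nat
  assumes d: "d \<ge> 1" and t: "10 ^ 12 * real d \<le> real t" and tN: "t < N" and Nu: "N + d \<le> u"
begin

text \<open>Central moments of order 2 d + 2 at mean about t are at most (C d t)^(d + 1), so beyond
  a multiple of \<open>sigma\<close> they decay geometrically in d.\<close>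

private definition sigma :: real where "sigma = sqrt (real t * real d)"
text \<open>The probability that the largest of d independent uniform values is m.\<close>

private definition W :: "nat \<Rightarrow> real" where "W m = (real (Suc m) ^ d - real m ^ d) / real u ^ d"
private definition pr :: "nat \<Rightarrow> real" where "pr m = real (Suc m) / real u"
private definition mean :: "nat \<Rightarrow> real" where "mean m = real N * pr m"

private lemma pos: "real u > 0" "real N > 0" "real d \<ge> 1" "real t > 0" "real t \<ge> 10 ^ 12"
proof -
  show d1: "real d \<ge> 1" using d by simp
  then have "10 ^ 12 * 1 \<le> 10 ^ 12 * real d" by (intro mult_left_mono) auto
  then show "real t \<ge> 10 ^ 12" using t by linarith
  then show "real t > 0" by simp
  show "real u > 0" "real N > 0" using tN Nu by auto
qed

private lemma sigma_sq: "sigma * sigma = real t * real d"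
  by (simp add: sigma_def)

private lemma sigma_pos: "sigma > 0"
  unfolding sigma_def using pos by simp

private lemma sigma_le: "sigma \<le> real t / 10 ^ 6"
proof (rule power2_le_imp_le)
  have "real t * (10 ^ 12 * real d) \<le> real t * real t" using t pos by (intro mult_left_mono) auto
  then show "sigma\<^sup>2 \<le> (real t / 10 ^ 6)\<^sup>2"
    using sigma_sq by (simp add: power2_eq_square field_simps)
qed (use pos in auto)

private lemma sigma_ge: "10 ^ 6 * real d \<le> sigma"
proof (rule power2_le_imp_le)
  have "10 ^ 12 * real d * real d \<le> real t * real d" using t pos by (intro mult_right_mono) auto
  then show "(10 ^ 6 * real d)\<^sup>2 \<le> sigma\<^sup>2"
    using sigma_sq by (simp add: power2_eq_square algebra_simps)
qed (use sigma_pos in auto)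

private lemma inverse_sigma_le: "1 / sigma \<le> sigma / real t"
proof -
  have "real t * 1 \<le> real t * real d" using pos by (intro mult_left_mono) auto
  then have "real t \<le> sigma * sigma" by (simp add: sigma_sq)
  then show ?thesis using pos sigma_pos by (simp add: field_simps)
qed

private lemma W_nonneg: "0 \<le> W m"
  unfolding W_def by (auto intro!: divide_nonneg_nonneg power_mono)

private lemma pr_bounds: "m < u \<Longrightarrow> 0 \<le> pr m \<and> pr m \<le> 1"
  by (auto simp: pr_def)

private lemma W_le:
  assumes "mean m \<le> c"
  shows "W m \<le> real d / real u * (c / real N) ^ (d - 1)"
proof -
  have "W m \<le> real d / real u * pr m ^ (d - 1)"
    unfolding W_def pr_def by (rule power_increment_le) (use pos in simp)
  also have "\<dots> \<le> real d / real u * (c / real N) ^ (d - 1)"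
    using assms pos by (intro mult_left_mono power_mono) (auto simp: mean_def pr_def field_simps)
  finally show ?thesis .
qed

text \<open>The means form an arithmetic progression with step N / u <= 1. Rescaling makes them
  consecutive integers, and the width only grows.\<close>

private lemma sum_mean_Lorentzian_le:
  assumes M: "M \<subseteq> {..<u}"
  shows "(\<Sum>m\<in>M. 1 / ((20 * sigma)\<^sup>2 + (mean m - real t)\<^sup>2)) \<le> real u / (2 * real N * sigma)"
proof -
  define s where "s = real N / real u"
  have s: "0 < s" "s \<le> 1" using pos Nu by (auto simp: s_def)
  define V where "V = 20 * sigma / s"
  have "20 * sigma \<ge> 1" using sigma_ge pos by simp
  then have V: "V \<ge> 1" using s by (simp add: V_def field_simps)
  define c where "c = real t / s - 1"
  have eq: "1 / ((20 * sigma)\<^sup>2 + (mean m - real t)\<^sup>2) = 1 / s\<^sup>2 * (1 / (V\<^sup>2 + (real m - c)\<^sup>2))" for m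
  proof -
    have "mean m - real t = s * (real m - c)"
      using s pos by (simp add: mean_def pr_def s_def c_def field_simps)
    moreover have "20 * sigma = s * V" using s by (simp add: V_def)
    ultimately have "(20 * sigma)\<^sup>2 + (mean m - real t)\<^sup>2 = s\<^sup>2 * (V\<^sup>2 + (real m - c)\<^sup>2)"
      by (simp only: power_mult_distrib distrib_left)
    then show ?thesis by simp
  qed
  have "(\<Sum>m\<in>M. 1 / ((20 * sigma)\<^sup>2 + (mean m - real t)\<^sup>2)) = 1 / s\<^sup>2 * (\<Sum>m\<in>M. 1 / (V\<^sup>2 + (real m - c)\<^sup>2))"
    unfolding eq sum_distrib_left ..
  also have "\<dots> \<le> 1 / s\<^sup>2 * (10 / V)"
    using M by (intro mult_left_mono sum_Lorentzian_le V) (auto intro: finite_subset)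
  also have "\<dots> = real u / (2 * real N * sigma)"
    using s sigma_pos pos by (simp add: V_def s_def power2_eq_square field_simps)
  finally show ?thesis .
qed

section \<open>Means far from \<open>t\<close>\<close>

private lemma central_moment_le:
  assumes m: "m < u" and M: "mean m \<le> M" "real t \<le> M"
  shows "(\<Sum>j\<le>N. Bernstein N j (pr m) * (real j - mean m) ^ (2 * d + 2)) \<le> (24 * real d * M) ^ (d + 1)"
proof -
  have "real (d + 1) \<le> M"
  proof -
    have "real (d + 1) \<le> 10 ^ 12 * real d" using pos by simp
    then show ?thesis using t M by linarith
  qed
  then have "(\<Sum>j\<le>N. Bernstein N j (pr m) * (real j - real N * pr m) ^ (2 * (d + 1))) \<le> (12 * real (d + 1) * M) ^ (d + 1)"
    using pr_bounds[OF m] M by (intro Bernstein_central_moment_le) (auto simp: mean_def)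
  also have "\<dots> \<le> (24 * real d * M) ^ (d + 1)"
    using pos M by (intro power_mono mult_right_mono) auto
  finally show ?thesis by (simp add: mean_def)
qed

text \<open>As |z| > 20 sigma and M <= t + |z|, the ratio M^2 / z^2 is at most t / (100 d) however
  large z is. The resulting base 24 / 100 is below 1 / 4, so that its d-th power later beats d^2 <=
  4^d.\<close>

private lemma outer_error_le:
  assumes m: "m < u" and y: "20 * sigma < \<bar>mean m - real t\<bar>"
  shows "W m * (\<Sum>j\<le>N. Bernstein N j (pr m) * ((real j - mean m) / (mean m - real t)) ^ (2 * d + 2))
    \<le> 48 * (real d)\<^sup>2 / real u * ((24 / 100 * real t) ^ d / real N ^ (d - 1))
      * (1 / ((20 * sigma)\<^sup>2 + (mean m - real t)\<^sup>2))"
proof -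
  define z where "z = mean m - real t"
  define M where "M = max (mean m) (real t)"
  have M: "mean m \<le> M" "real t \<le> M" "M \<le> real t + \<bar>z\<bar>" "M > 0"
    using pos by (auto simp: M_def z_def)
  have z: "20 * sigma < \<bar>z\<bar>" "z\<^sup>2 > 0" using y sigma_pos by (auto simp: z_def)
  have Mz: "M\<^sup>2 / z\<^sup>2 \<le> real t / (100 * real d)"
  proof -
    have "M / \<bar>z\<bar> \<le> (real t + \<bar>z\<bar>) / \<bar>z\<bar>" using M by (intro divide_right_mono) auto
    also have "\<dots> = 1 + real t / \<bar>z\<bar>" using z sigma_pos by (simp add: field_simps)
    also have "\<dots> \<le> 1 + real t / (20 * sigma)"
      using z sigma_pos pos by (intro add_left_mono divide_left_mono) auto
    also have "\<dots> \<le> real t / (10 * sigma)"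
      using sigma_le sigma_pos by (simp add: field_simps)
    finally have "(M / \<bar>z\<bar>)\<^sup>2 \<le> (real t / (10 * sigma))\<^sup>2" using M by (intro power_mono) auto
    also have "\<dots> = real t / (100 * real d)"
      using sigma_sq sigma_pos pos by (simp add: power_divide power2_eq_square field_simps)
    finally show ?thesis by (simp add: power_divide)
  qed
  have "(\<Sum>j\<le>N. Bernstein N j (pr m) * ((real j - mean m) / z) ^ (2 * d + 2))
      = (\<Sum>j\<le>N. Bernstein N j (pr m) * (real j - mean m) ^ (2 * d + 2)) / z ^ (2 * d + 2)"
    unfolding power_divide sum_divide_distrib by simp
  also have "\<dots> \<le> (24 * real d * M) ^ (d + 1) / z ^ (2 * d + 2)"
  proof (rule divide_right_mono[OF central_moment_le[OF m M(1,2)]])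
    show "0 \<le> z ^ (2 * d + 2)" by (rule zero_le_even_power) simp
  qed
  also have "z ^ (2 * d + 2) = (z\<^sup>2) ^ (d + 1)" by (simp only: power_mult[symmetric]) simp
  finally have E: "(\<Sum>j\<le>N. Bernstein N j (pr m) * ((real j - mean m) / z) ^ (2 * d + 2))
      \<le> (24 * real d * M) ^ (d + 1) / (z\<^sup>2) ^ (d + 1)" .
  have "W m * (\<Sum>j\<le>N. Bernstein N j (pr m) * ((real j - mean m) / z) ^ (2 * d + 2))
      \<le> (real d / real u * (M / real N) ^ (d - 1)) * ((24 * real d * M) ^ (d + 1) / (z\<^sup>2) ^ (d + 1))"
  proof (rule mult_mono[OF W_le[OF M(1)] E])
    show "0 \<le> (\<Sum>j\<le>N. Bernstein N j (pr m) * ((real j - mean m) / z) ^ (2 * d + 2))"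
      using pr_bounds[OF m]
      by (intro sum_nonneg mult_nonneg_nonneg Bernstein_nonneg zero_le_even_power) auto
  qed (use M in auto)
  \<comment> \<open>M^(d-1) from the weight and M^(d+1) from the moment pair off with z^(2 d); the
    remaining 1 / z^2 makes the sum over m converge.\<close>
  also have "\<dots> = real d / real u / real N ^ (d - 1) * (24 * real d) * (24 * real d * (M\<^sup>2 / z\<^sup>2)) ^ d * (1 / z\<^sup>2)"
  proof -
    have "M ^ (d - 1) * M ^ (d + 1) = (M\<^sup>2) ^ d"
      using d by (simp only: power_add[symmetric] power_mult[symmetric]) (simp add: mult_2)
    then have "M ^ (d - 1) * (24 * real d * M) ^ (d + 1) = (24 * real d) * (24 * real d) ^ d * (M\<^sup>2) ^ d"
      unfolding power_mult_distrib[of "24 * real d" M] by (simp add: mult_ac)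
    moreover have "(a / b * (M / n) ^ e) * (A / (z\<^sup>2) ^ (d + 1)) = a / b / n ^ e * (M ^ e * A) / (z\<^sup>2) ^ d * (1 / z\<^sup>2)" for a b n A e
      by (simp add: power_divide mult_ac)
    ultimately show ?thesis by (simp add: power_mult_distrib power_divide)
  qed
  also have "\<dots> \<le> real d / real u / real N ^ (d - 1) * (24 * real d) * (24 / 100 * real t) ^ d * (2 / ((20 * sigma)\<^sup>2 + z\<^sup>2))"
  proof (rule mult_mono[OF mult_left_mono[OF power_mono]])
    have "24 * real d * (M\<^sup>2 / z\<^sup>2) \<le> 24 * real d * (real t / (100 * real d))"
      by (intro mult_left_mono Mz) auto
    also have "\<dots> = 24 / 100 * real t" using pos by simp
    finally show "24 * real d * (M\<^sup>2 / z\<^sup>2) \<le> 24 / 100 * real t" .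
    have "(20 * sigma)\<^sup>2 \<le> \<bar>z\<bar>\<^sup>2" using z sigma_pos by (intro power_mono) auto
    then have "(20 * sigma)\<^sup>2 + z\<^sup>2 \<le> 2 * z\<^sup>2" by simp
    moreover have "0 < (20 * sigma)\<^sup>2 + z\<^sup>2" using z(2) by (intro add_nonneg_pos) auto
    ultimately have "2 / (2 * z\<^sup>2) \<le> 2 / ((20 * sigma)\<^sup>2 + z\<^sup>2)"
      using z(2) by (intro divide_left_mono mult_pos_pos) auto
    then show "1 / z\<^sup>2 \<le> 2 / ((20 * sigma)\<^sup>2 + z\<^sup>2)" by simp
  qed auto
  also have "\<dots> = 48 * (real d)\<^sup>2 / real u * ((24 / 100 * real t) ^ d / real N ^ (d - 1))
      * (1 / ((20 * sigma)\<^sup>2 + z\<^sup>2))"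
    by (simp add: power2_eq_square)
  finally show ?thesis unfolding z_def .
qed

private lemma outer_error_sum_le:
  assumes M: "M \<subseteq> {m. m < u \<and> 20 * sigma < \<bar>mean m - real t\<bar>}"
  shows "(\<Sum>m\<in>M. W m * (\<Sum>j\<le>N. Bernstein N j (pr m) * ((real j - mean m) / (mean m - real t)) ^ (2 * d + 2)))
    \<le> 24 * (sigma / real t) * (real t / real N) ^ d"
proof -
  define C where "C = 48 * (real d)\<^sup>2 / real u * ((24 / 100 * real t) ^ d / real N ^ (d - 1))"
  have C: "C \<ge> 0" by (simp add: C_def)
  have "(\<Sum>m\<in>M. W m * (\<Sum>j\<le>N. Bernstein N j (pr m) * ((real j - mean m) / (mean m - real t)) ^ (2 * d + 2)))
      \<le> (\<Sum>m\<in>M. C * (1 / ((20 * sigma)\<^sup>2 + (mean m - real t)\<^sup>2)))"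
    unfolding C_def using M by (intro sum_mono outer_error_le) auto
  also have "\<dots> \<le> C * (real u / (2 * real N * sigma))"
    unfolding sum_distrib_left[symmetric] using M C by (intro mult_left_mono sum_mean_Lorentzian_le) auto
  also have "\<dots> = 24 * ((real d)\<^sup>2 * (24 / 100) ^ d) * (1 / sigma) * (real t / real N) ^ d"
  proof -
    have "real N ^ d = real N * real N ^ (d - 1)" using d by (cases d) auto
    then show ?thesis using pos by (simp add: C_def power_mult_distrib power_divide mult_ac)
  qed
  also have "\<dots> \<le> 24 * 1 * (sigma / real t) * (real t / real N) ^ d"
  proof (intro mult_right_mono mult_mono mult_left_mono inverse_sigma_le)
    have "real d \<le> 2 ^ d" using of_nat_less_two_power[of d, where 'a=real] by simp
    then have "(real d)\<^sup>2 \<le> (2 ^ d)\<^sup>2" by (intro power_mono) auto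
    also have "(2 ^ d)\<^sup>2 = (4::real) ^ d" by (simp add: power_mult[symmetric] mult.commute[of d]) (simp add: power_mult)
    finally have "(real d)\<^sup>2 * (24 / 100) ^ d \<le> 4 ^ d * (1 / 4) ^ d"
      by (intro mult_mono power_mono) auto
    also have "\<dots> = 1" by (simp add: power_mult_distrib[symmetric])
    finally show "(real d)\<^sup>2 * (24 / 100) ^ d \<le> 1" .
  qed (use sigma_pos in auto)
  finally show ?thesis by simp
qed

section \<open>Means near \<open>t\<close>: the power term of the sandwich\<close>

private lemma add_power_le:
  fixes a b :: real
  assumes "0 \<le> a" "0 \<le> b"
  shows "(a + b) ^ q \<le> 2 ^ q * (a ^ q + b ^ q)"
proof -
  have "(a + b) ^ q \<le> (2 * max a b) ^ q" using assms by (intro power_mono) auto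
  also have "\<dots> = 2 ^ q * (max a b) ^ q" by (rule power_mult_distrib)
  also have "\<dots> \<le> 2 ^ q * (a ^ q + b ^ q)"
    using assms by (intro mult_left_mono) (auto simp: max_def)
  finally show ?thesis .
qed

text \<open>The window scale is 48000 = 300 * 160, so the base is (j - t) / (160 sigma). Splitting
  off the mean costs 2 per factor: the shift contributes 20 / 80 = 1 / 4, and the moment (48 d t /
  (80 sigma)^2)^(d + 1) is smaller still.\<close>

private lemma inner_moment_le:
  assumes m: "m < u" and y: "\<bar>mean m - real t\<bar> \<le> 20 * sigma"
  shows "(\<Sum>j\<le>N. Bernstein N j (pr m) * (300 * ((real j - real t) / (48000 * sigma))) ^ (2 * d + 2))
    \<le> 2 / 16 ^ (d + 1)"
proof -
  define q where "q = 2 * d + 2"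
  have q: "q = 2 * (d + 1)" "even q" by (auto simp: q_def)
  have qpow: "a ^ q = (a\<^sup>2) ^ (d + 1)" for a :: real unfolding q(1) power_mult ..
  have ptw: "(300 * ((real j - real t) / (48000 * sigma))) ^ q
      \<le> (real j - mean m) ^ q / (80 * sigma) ^ q + (1 / 4) ^ q" for j
  proof -
    have "(300 * ((real j - real t) / (48000 * sigma))) ^ q = (\<bar>real j - real t\<bar> / (160 * sigma)) ^ q"
    proof -
      have "300 * (a / (48000 * s)) = a / (160 * s)" for a s :: real by simp
      then show ?thesis using power_even_abs[OF q(2), of "real j - real t"]
        by (simp only: power_divide)
    qed
    also have "\<dots> \<le> ((\<bar>real j - mean m\<bar> + 20 * sigma) / (160 * sigma)) ^ q"
      using y sigma_pos by (intro power_mono divide_right_mono) auto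
    also have "\<dots> \<le> 2 ^ q * (\<bar>real j - mean m\<bar> ^ q + (20 * sigma) ^ q) / (160 * sigma) ^ q"
      unfolding power_divide using sigma_pos by (intro divide_right_mono add_power_le) auto
    also have "\<dots> = (\<bar>real j - mean m\<bar> ^ q + (20 * sigma) ^ q) / (80 * sigma) ^ q"
    proof -
      have "(2 * (80 * sigma)) ^ q = 2 ^ q * (80 * sigma) ^ q" by (rule power_mult_distrib)
      then have "(160 * sigma) ^ q = 2 ^ q * (80 * sigma) ^ q" by simp
      then show ?thesis by (simp only: mult_divide_mult_cancel_left power_eq_0_iff) simp
    qed
    also have "\<dots> = (real j - mean m) ^ q / (80 * sigma) ^ q + (20 * sigma / (80 * sigma)) ^ q"
      by (simp only: power_even_abs[OF q(2)] add_divide_distrib power_divide)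
    also have "20 * sigma / (80 * sigma) = 1 / 4" using sigma_pos by simp
    finally show ?thesis .
  qed
  have "(\<Sum>j\<le>N. Bernstein N j (pr m) * (300 * ((real j - real t) / (48000 * sigma))) ^ q)
      \<le> (\<Sum>j\<le>N. Bernstein N j (pr m) * ((real j - mean m) ^ q / (80 * sigma) ^ q + (1 / 4) ^ q))"
    using pr_bounds[OF m] by (intro sum_mono mult_left_mono ptw Bernstein_nonneg) auto
  also have "\<dots> = (\<Sum>j\<le>N. Bernstein N j (pr m) * (real j - mean m) ^ q) / (80 * sigma) ^ q + (1 / 4) ^ q"
    by (simp add: distrib_left sum.distrib sum_distrib_right[symmetric] sum_divide_distrib[symmetric])
  also have "\<dots> \<le> (24 * real d * (2 * real t)) ^ (d + 1) / (80 * sigma) ^ q + (1 / 4) ^ q"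
  proof (intro add_right_mono divide_right_mono)
    have "mean m \<le> 2 * real t" using y sigma_le pos by simp
    then show "(\<Sum>j\<le>N. Bernstein N j (pr m) * (real j - mean m) ^ q) \<le> (24 * real d * (2 * real t)) ^ (d + 1)"
      unfolding q_def by (intro central_moment_le m) auto
  qed (use sigma_pos in auto)
  also have "\<dots> = (3 / 400) ^ (d + 1) + (1 / 16) ^ (d + 1)"
  proof -
    have "24 * real d * (2 * real t) / (80 * sigma)\<^sup>2 = 3 / 400"
      using sigma_sq pos by (simp add: power2_eq_square)
    moreover have "(1 / 4 :: real)\<^sup>2 = 1 / 16" by (simp add: power2_eq_square)
    ultimately show ?thesis by (simp only: qpow power_divide[symmetric])
  qed
  also have "\<dots> \<le> (1 / 16) ^ (d + 1) + (1 / 16) ^ (d + 1)"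
    by (intro add_right_mono power_mono) auto
  finally show ?thesis by (simp add: q_def power_divide)
qed

private lemma inner_moment_sum_le:
  assumes M: "M \<subseteq> {m. m < u \<and> \<bar>mean m - real t\<bar> \<le> 20 * sigma}"
  shows "(\<Sum>m\<in>M. W m * (4 * (\<Sum>j\<le>N. Bernstein N j (pr m) *
      (300 * ((real j - real t) / (48000 * sigma))) ^ (2 * d + 2))))
    \<le> 200 * (sigma / real t) * (real t / real N) ^ d"
proof -
  define C where "C = real d / real u * (2 * real t / real N) ^ (d - 1) * (8 / 16 ^ (d + 1)) * (2 * (20 * sigma)\<^sup>2)"
  have C: "C \<ge> 0" by (simp add: C_def)
  have "(\<Sum>m\<in>M. W m * (4 * (\<Sum>j\<le>N. Bernstein N j (pr m) *
      (300 * ((real j - real t) / (48000 * sigma))) ^ (2 * d + 2))))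
      \<le> (\<Sum>m\<in>M. C * (1 / ((20 * sigma)\<^sup>2 + (mean m - real t)\<^sup>2)))"
  proof (rule sum_mono)
    fix m assume "m \<in> M"
    then have m: "m < u" "\<bar>mean m - real t\<bar> \<le> 20 * sigma" using M by auto
    define Q where "Q = (\<Sum>j\<le>N. Bernstein N j (pr m) *
        (300 * ((real j - real t) / (48000 * sigma))) ^ (2 * d + 2))"
    have Q: "0 \<le> Q" "Q \<le> 2 / 16 ^ (d + 1)"
    proof -
      show "0 \<le> Q" unfolding Q_def using pr_bounds[OF m(1)]
        by (intro sum_nonneg mult_nonneg_nonneg Bernstein_nonneg zero_le_even_power) auto
      show "Q \<le> 2 / 16 ^ (d + 1)" unfolding Q_def by (rule inner_moment_le[OF m])
    qed
    have "mean m \<le> 2 * real t" using m(2) sigma_le pos by simp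
    then have "W m * (4 * Q) \<le> (real d / real u * (2 * real t / real N) ^ (d - 1)) * (4 * (2 / 16 ^ (d + 1)))"
      using Q by (intro mult_mono W_le) auto
    \<comment> \<open>Inside the window the inserted factor is at least 1, so the Lorentzian sum
      also serves to count the m in the window.\<close>
    also have "\<dots> \<le> (real d / real u * (2 * real t / real N) ^ (d - 1)) * (4 * (2 / 16 ^ (d + 1)))
        * (2 * (20 * sigma)\<^sup>2 / ((20 * sigma)\<^sup>2 + (mean m - real t)\<^sup>2))"
    proof -
      have "\<bar>mean m - real t\<bar>\<^sup>2 \<le> (20 * sigma)\<^sup>2" by (intro power_mono m) simp
      moreover have "(20 * sigma)\<^sup>2 > 0" using sigma_pos by simp
      ultimately have "1 \<le> 2 * (20 * sigma)\<^sup>2 / ((20 * sigma)\<^sup>2 + (mean m - real t)\<^sup>2)"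
        by (simp add: pos_le_divide_eq add_pos_nonneg)
      from mult_left_mono[OF this, of "(real d / real u * (2 * real t / real N) ^ (d - 1)) * (4 * (2 / 16 ^ (d + 1)))"]
      show ?thesis by simp
    qed
    also have "\<dots> = C * (1 / ((20 * sigma)\<^sup>2 + (mean m - real t)\<^sup>2))" by (simp add: C_def)
    finally show "W m * (4 * (\<Sum>j\<le>N. Bernstein N j (pr m) *
        (300 * ((real j - real t) / (48000 * sigma))) ^ (2 * d + 2)))
      \<le> C * (1 / ((20 * sigma)\<^sup>2 + (mean m - real t)\<^sup>2))" unfolding Q_def .
  qed
  also have "\<dots> \<le> C * (real u / (2 * real N * sigma))"
    unfolding sum_distrib_left[symmetric] using M C by (intro mult_left_mono sum_mean_Lorentzian_le) auto
  also have "\<dots> = 200 * (real d * 2 ^ (d - 1) / 16 ^ d) * (sigma / real t) * (real t / real N) ^ d"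
  proof -
    obtain e where e: "d = Suc e" using d by (cases d) auto
    show ?thesis unfolding C_def e using pos sigma_pos
      by (simp add: power_divide power_mult_distrib power2_eq_square field_simps del: of_nat_Suc)
  qed
  also have "\<dots> \<le> 200 * 1 * (sigma / real t) * (real t / real N) ^ d"
  proof (intro mult_right_mono mult_left_mono)
    have "real d \<le> 2 ^ d" using of_nat_less_two_power[of d, where 'a=real] by simp
    moreover have "(2::real) ^ (d - 1) \<le> 2 ^ d" by (intro power_increasing) auto
    ultimately have "real d * 2 ^ (d - 1) \<le> 2 ^ d * 2 ^ d" by (intro mult_mono) auto
    also have "\<dots> = 4 ^ d" by (simp add: power_mult_distrib[symmetric])
    also have "\<dots> \<le> 16 ^ d" by (intro power_mono) auto
    finally show "real d * 2 ^ (d - 1) / 16 ^ d \<le> 1" by simp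
  qed (use sigma_pos in auto)
  finally show ?thesis by simp
qed

text \<open>The logarithmic derivative at \<open>j = t\<close> of the weight \<open>(j + d - 1 choose d - 1)\<close>.\<close>

private definition rate :: real where "rate = (\<Sum>i<d - 1. 1 / real (t + Suc i))"

private lemma rate_bounds: "0 \<le> rate" "rate * (48000 * sigma) \<le> real d / 8"
proof -
  show "0 \<le> rate" unfolding rate_def by (intro sum_nonneg) auto
  have "rate \<le> (\<Sum>i<d - 1. 1 / real t)"
    unfolding rate_def using pos by (intro sum_mono divide_left_mono) auto
  also have "\<dots> \<le> real d / real t" using pos by (simp add: divide_right_mono)
  \<comment> \<open>This bound, where t >= 10^12 d enters through sigma <= t / 10^6, is the
    condition b <= d / 8 of \<open>step_sandwich\<close>.\<close>
  finally have "rate * (48000 * sigma) \<le> real d / real t * (48000 * (real t / 10 ^ 6))"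
    using sigma_le sigma_pos pos by (intro mult_mono) auto
  also have "\<dots> \<le> real d / 8" using pos by simp
  finally show "rate * (48000 * sigma) \<le> real d / 8" .
qed

text \<open>The main term of the gap in \<open>step_sandwich\<close> at x = (j - t) / (48000 sigma)
  with b = 48000 sigma * rate, so that b x = rate (j - t). It is cut off at |x| = 1, beyond which
  the power term alone bounds the gap.\<close>

private definition peak :: "nat \<Rightarrow> real" where
  "peak j = (if \<bar>(real j - real t) / (48000 * sigma)\<bar> \<le> 1
    then 20736 * (1 - rate * (real j - real t) / real d) ^ d
      / (1 + (real d * ((real j - real t) / (48000 * sigma)) / 4)\<^sup>2) else 0)"

private lemma tilt_nonneg:
  assumes "\<bar>(real j - real t) / (48000 * sigma)\<bar> \<le> 1"
  shows "0 \<le> 1 - rate * (real j - real t) / real d"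
proof -
  have "\<bar>real j - real t\<bar> \<le> 48000 * sigma" using assms sigma_pos by (simp add: field_simps)
  then have "rate * (real j - real t) \<le> rate * (48000 * sigma)"
    using rate_bounds(1) by (intro mult_left_mono) auto
  then show ?thesis using rate_bounds(2) pos by (simp add: field_simps)
qed

private lemma peak_nonneg: "0 \<le> peak j"
  unfolding peak_def using tilt_nonneg[of j] by (auto intro!: divide_nonneg_nonneg add_nonneg_nonneg)

text \<open>The tilt is at most exp (- rate (j - t)), which cancels the tangent bound on the growth
  of the binomial coefficient. A pure Lorentzian in j remains.\<close>

private lemma binomial_mult_peak_le:
  "real ((j + d - 1) choose (d - 1)) * peak j
    \<le> 20736 * real ((t + d - 1) choose (d - 1)) *
      ((192000 * sigma / real d)\<^sup>2 * (1 / ((192000 * sigma / real d)\<^sup>2 + (real j - real t)\<^sup>2)))"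
proof (cases "\<bar>(real j - real t) / (48000 * sigma)\<bar> \<le> 1")
  case True
  define V where "V = 192000 * sigma / real d"
  have V: "V > 0" using sigma_pos pos by (simp add: V_def)
  have "(1 - rate * (real j - real t) / real d) ^ d \<le> exp (- (rate * (real j - real t) / real d)) ^ d"
    using tilt_nonneg[OF True] exp_ge_add_one_self[of "- (rate * (real j - real t) / real d)"]
    by (intro power_mono) auto
  also have "\<dots> = exp (- ((real j - real t) * rate))"
    using pos by (simp add: exp_of_nat_mult[symmetric] mult.commute)
  finally have tl: "(1 - rate * (real j - real t) / real d) ^ d \<le> exp (- ((real j - real t) * rate))" .
  have bn: "real ((j + d - 1) choose (d - 1)) \<le> real ((t + d - 1) choose (d - 1)) * exp ((real j - real t) * rate)"
    using binomial_le_exp_binomial[of j "d - 1" t] d by (simp add: rate_def)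
  have "real ((j + d - 1) choose (d - 1)) * (1 - rate * (real j - real t) / real d) ^ d
      \<le> real ((t + d - 1) choose (d - 1)) * exp ((real j - real t) * rate) * exp (- ((real j - real t) * rate))"
    using tilt_nonneg[OF True] by (intro mult_mono bn tl) auto
  also have "\<dots> = real ((t + d - 1) choose (d - 1))" by (simp add: exp_minus)
  finally have le: "real ((j + d - 1) choose (d - 1)) * (1 - rate * (real j - real t) / real d) ^ d
      \<le> real ((t + d - 1) choose (d - 1))" .
  have lor: "1 / (1 + (real d * ((real j - real t) / (48000 * sigma)) / 4)\<^sup>2) = V\<^sup>2 * (1 / (V\<^sup>2 + (real j - real t)\<^sup>2))"
  proof -
    have "real d * ((real j - real t) / (48000 * sigma)) / 4 = (real j - real t) / V"
      using sigma_pos pos by (simp add: V_def)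
    moreover have "1 / (1 + (c / V)\<^sup>2) = V\<^sup>2 * (1 / (V\<^sup>2 + c\<^sup>2))" for c
      using V by (simp add: power_divide field_simps add_pos_nonneg)
    ultimately show ?thesis by metis
  qed
  have "real ((j + d - 1) choose (d - 1)) * peak j
      = 20736 * (real ((j + d - 1) choose (d - 1)) * (1 - rate * (real j - real t) / real d) ^ d)
        * (1 / (1 + (real d * ((real j - real t) / (48000 * sigma)) / 4)\<^sup>2))"
    using True by (simp add: peak_def)
  also have "\<dots> \<le> 20736 * real ((t + d - 1) choose (d - 1))
        * (1 / (1 + (real d * ((real j - real t) / (48000 * sigma)) / 4)\<^sup>2))"
    by (intro mult_right_mono mult_left_mono le) (auto intro!: divide_nonneg_nonneg add_nonneg_nonneg)
  finally show ?thesis unfolding lor V_def .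
next
  case False
  then show ?thesis by (simp add: peak_def divide_nonneg_nonneg add_nonneg_nonneg)
qed

text \<open>The sum over m is done first. As \<open>peak\<close> is nonnegative it may run over all
  m < u, where the averaged weights are known; only then is the gap summed over j.\<close>

private lemma peak_error_sum_le:
  assumes M: "M \<subseteq> {..<u}"
  shows "(\<Sum>m\<in>M. W m * (\<Sum>j\<le>N. Bernstein N j (pr m) * peak j))
    \<le> 79626240000 * (sigma / real t) * (real ((t + d) choose d) / real ((N + d) choose d))"
proof -
  define V where "V = 192000 * sigma / real d"
  have V: "V \<ge> 1" using sigma_ge pos by (simp add: V_def field_simps)
  have "(\<Sum>m\<in>M. W m * (\<Sum>j\<le>N. Bernstein N j (pr m) * peak j))
      \<le> (\<Sum>m<u. W m * (\<Sum>j\<le>N. Bernstein N j (pr m) * peak j))"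
    using M pr_bounds peak_nonneg W_nonneg
    by (intro sum_mono2) (auto intro!: mult_nonneg_nonneg sum_nonneg Bernstein_nonneg)
  also have "\<dots> = (\<Sum>j\<le>N. peak j * (\<Sum>m<u. W m * Bernstein N j (pr m)))"
    unfolding sum_distrib_left by (subst sum.swap) (simp add: mult_ac)
  also have "\<dots> \<le> (\<Sum>j\<le>N. peak j * (2 * real ((j + d - 1) choose (d - 1)) / real ((N + d) choose d)))"
    unfolding W_def pr_def using d Nu
    by (intro sum_mono mult_left_mono weighted_Bernstein_sum_le peak_nonneg) auto
  also have "\<dots> = 2 / real ((N + d) choose d) * (\<Sum>j\<le>N. real ((j + d - 1) choose (d - 1)) * peak j)"
    unfolding sum_distrib_left by (intro sum.cong refl) simp
  also have "\<dots> \<le> 2 / real ((N + d) choose d) * (\<Sum>j\<le>N. 20736 * real ((t + d - 1) choose (d - 1)) *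
      (V\<^sup>2 * (1 / (V\<^sup>2 + (real j - real t)\<^sup>2))))"
    unfolding V_def by (intro mult_left_mono sum_mono binomial_mult_peak_le) auto
  also have "\<dots> = 41472 * real ((t + d - 1) choose (d - 1)) / real ((N + d) choose d) *
      (V\<^sup>2 * (\<Sum>j\<le>N. 1 / (V\<^sup>2 + (real j - real t)\<^sup>2)))"
    unfolding sum_distrib_left by (intro sum.cong refl) simp
  also have "\<dots> \<le> 41472 * real ((t + d - 1) choose (d - 1)) / real ((N + d) choose d) * (V\<^sup>2 * (10 / V))"
    by (intro mult_left_mono sum_Lorentzian_le V) auto
  also have "V\<^sup>2 * (10 / V) = 10 * V" using V by (simp add: power2_eq_square)
  also have "41472 * real ((t + d - 1) choose (d - 1)) / real ((N + d) choose d) * (10 * V)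
      = 79626240000 * (sigma / real (t + d)) * (real ((t + d) choose d) / real ((N + d) choose d))"
  proof -
    \<comment> \<open>Passing from d - 1 to d in the binomial coefficient costs d / (t + d). The d
      cancels against the width 192000 sigma / d, and sigma / t is left.\<close>
    have "d * ((t + d) choose d) = (t + d) * ((t + d - 1) choose (d - 1))"
      using d times_binomial_minus1_eq[of d "t + d"] by simp
    then have "real d * real ((t + d) choose d) = real (t + d) * real ((t + d - 1) choose (d - 1))"
      by (metis of_nat_mult)
    then have "real ((t + d - 1) choose (d - 1)) = real d * real ((t + d) choose d) / real (t + d)"
      using pos by (simp add: field_simps)
    then show ?thesis using pos by (simp add: V_def)
  qed
  also have "\<dots> \<le> 79626240000 * (sigma / real t) * (real ((t + d) choose d) / real ((N + d) choose d))"
    using sigma_pos pos by (intro mult_right_mono mult_left_mono divide_left_mono) auto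
  finally show ?thesis .
qed

lemma sandwich_error_sum:
  obtains qp qm :: "nat \<Rightarrow> real poly" where
    "\<And>m. degree (qp m) \<le> 2 * d + 2" "\<And>m. degree (qm m) \<le> 2 * d + 2"
    "\<And>m j. poly (qm m) (real j) \<le> of_bool (j \<le> t)"
    "\<And>m j. of_bool (j \<le> t) \<le> poly (qp m) (real j)"
    "(\<Sum>m<u. (real (Suc m) ^ d - real m ^ d) / real u ^ d *
        (\<Sum>j\<le>N. Bernstein N j (real (Suc m) / real u) * (poly (qp m) (real j) - poly (qm m) (real j))))
      \<le> 8 * 10 ^ 10 * sqrt (real d / real t) * (real ((t + d) choose d) / real ((N + d) choose d))"
proof -
  define R where "R = 48000 * sigma"
  have R: "R > 0" using sigma_pos by (simp add: R_def)
  obtain sp sm :: "real poly" where s: "degree sp \<le> 2 * d + 2" "degree sm \<le> 2 * d + 2"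
    "\<And>x. poly sm x \<le> (if x \<le> 0 then 1 else 0)"
    "\<And>x. (if x \<le> 0 then 1 else 0) \<le> poly sp x"
    "\<And>x. \<bar>x\<bar> \<le> 1 \<Longrightarrow> poly sp x - poly sm x
        \<le> 20736 * (1 - rate * R * x / real d) ^ d / (1 + (real d * x / 4)\<^sup>2) + 2 * (300 * x) ^ (2 * d + 2)"
    "\<And>x. 1 \<le> \<bar>x\<bar> \<Longrightarrow> poly sp x - poly sm x \<le> 4 * (300 * x) ^ (2 * d + 2)"
    using step_sandwich[of d "rate * R"] d rate_bounds R unfolding R_def by auto
  define lin where "lin = [:- real t / R, 1 / R:]"
  have lin: "poly lin (real j) = (real j - real t) / R" for j by (simp add: lin_def diff_divide_distrib)
  \<comment> \<open>This even power vanishes at the mean and equals 1 at t, so it is at least 1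
    beyond t as seen from the mean. It can correct the constant 1 or 0 on the wrong side.\<close>
  define Z where "Z = (\<lambda>m. [:- mean m / (mean m - real t), 1 / (mean m - real t):] ^ (2 * d + 2))"
  have Z: "poly (Z m) (real j) = ((real j - mean m) / (mean m - real t)) ^ (2 * d + 2)" for m j
    by (simp only: Z_def poly_power) (simp add: diff_divide_distrib)
  have Z0: "0 \<le> poly (Z m) (real j)" for m j unfolding Z by (rule zero_le_even_power) simp
  define qp where "qp = (\<lambda>m. if \<bar>mean m - real t\<bar> \<le> 20 * sigma then sp \<circ>\<^sub>p lin
      else if mean m < real t then 1 else Z m)"
  define qm where "qm = (\<lambda>m. if \<bar>mean m - real t\<bar> \<le> 20 * sigma then sm \<circ>\<^sub>p lin
      else if mean m < real t then 1 - Z m else 0)"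
  have dlin: "degree (p \<circ>\<^sub>p lin) \<le> 2 * d + 2" if "degree p \<le> 2 * d + 2" for p
  proof -
    have "degree (p \<circ>\<^sub>p lin) \<le> degree p * 1"
      unfolding lin_def by (intro order_trans[OF degree_pcompose_le] mult_left_mono) auto
    then show ?thesis using that by simp
  qed
  have dZ: "degree (Z m) \<le> 2 * d + 2" for m
  proof -
    have "degree (Z m) \<le> 1 * (2 * d + 2)"
      unfolding Z_def by (intro order_trans[OF degree_power_le] mult_right_mono) auto
    then show ?thesis by simp
  qed
  have deg: "degree (qp m) \<le> 2 * d + 2" "degree (qm m) \<le> 2 * d + 2" for m
    unfolding qp_def qm_def using s(1,2) dlin dZ by (auto intro!: degree_diff_le)
  have step: "(if (real j - real t) / R \<le> 0 then 1 else 0) = (of_bool (j \<le> t) :: real)" for j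
    using R by (simp add: divide_le_0_iff)
  have Z1: "1 \<le> poly (Z m) (real j)" if "(j \<le> t \<and> real t < mean m) \<or> (t < j \<and> mean m < real t)" for m j
  proof -
    have "1 \<le> \<bar>(real j - mean m) / (mean m - real t)\<bar>"
      using that by (auto simp: abs_divide pos_le_divide_eq)
    then have "1 \<le> \<bar>(real j - mean m) / (mean m - real t)\<bar> ^ (2 * d + 2)" by (rule one_le_power)
    also have "\<dots> = poly (Z m) (real j)" unfolding Z by (rule power_even_abs) simp
    finally show ?thesis .
  qed
  have low: "poly (qm m) (real j) \<le> of_bool (j \<le> t)" for m j
  proof -
    consider "\<bar>mean m - real t\<bar> \<le> 20 * sigma" | "\<not> \<bar>mean m - real t\<bar> \<le> 20 * sigma" "mean m < real t"
      | "\<not> \<bar>mean m - real t\<bar> \<le> 20 * sigma" "\<not> mean m < real t" by blast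
    then show ?thesis
    proof cases
      case 1
      then show ?thesis using s(3)[of "(real j - real t) / R"] by (simp add: qm_def poly_pcompose lin step)
    next
      case 2
      then show ?thesis using Z0[of m j] Z1[of j m] by (cases "j \<le> t") (auto simp: qm_def)
    qed (simp add: qm_def)
  qed
  have high: "of_bool (j \<le> t) \<le> poly (qp m) (real j)" for m j
  proof -
    consider "\<bar>mean m - real t\<bar> \<le> 20 * sigma" | "\<not> \<bar>mean m - real t\<bar> \<le> 20 * sigma" "mean m < real t"
      | "\<not> \<bar>mean m - real t\<bar> \<le> 20 * sigma" "\<not> mean m < real t" by blast
    then show ?thesis
    proof cases
      case 1
      then show ?thesis using s(4)[of "(real j - real t) / R"] by (simp add: qp_def poly_pcompose lin step)
    next
      case 3
      then have "real t < mean m" using sigma_pos by auto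
      then show ?thesis using 3 Z0[of m j] Z1[of j m] by (cases "j \<le> t") (auto simp: qp_def)
    qed (simp add: qp_def)
  qed
  define inner where "inner = {m. m < u \<and> \<bar>mean m - real t\<bar> \<le> 20 * sigma}"
  define outer where "outer = {m. m < u \<and> 20 * sigma < \<bar>mean m - real t\<bar>}"
  have split: "{..<u} = inner \<union> outer" "inner \<inter> outer = {}" "finite inner" "finite outer"
    by (auto simp: inner_def outer_def)
  define E where "E = (\<lambda>m. W m * (\<Sum>j\<le>N. Bernstein N j (pr m) * (poly (qp m) (real j) - poly (qm m) (real j))))"
  have E_outer: "E m = W m * (\<Sum>j\<le>N. Bernstein N j (pr m) * ((real j - mean m) / (mean m - real t)) ^ (2 * d + 2))"
    if "m \<in> outer" for m
    using that unfolding E_def Z[symmetric] by (auto simp: outer_def qp_def qm_def)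
  have E_inner: "E m \<le> W m * (\<Sum>j\<le>N. Bernstein N j (pr m) * peak j) +
      W m * (4 * (\<Sum>j\<le>N. Bernstein N j (pr m) * (300 * ((real j - real t) / (48000 * sigma))) ^ (2 * d + 2)))"
    if m: "m \<in> inner" for m
  proof -
    have mu: "m < u" using m by (simp add: inner_def)
    have ptw: "poly (qp m) (real j) - poly (qm m) (real j)
        \<le> peak j + 4 * (300 * ((real j - real t) / (48000 * sigma))) ^ (2 * d + 2)" for j
    proof -
      define x where "x = (real j - real t) / (48000 * sigma)"
      have e: "poly (qp m) (real j) - poly (qm m) (real j) = poly sp x - poly sm x"
        using m by (simp add: inner_def qp_def qm_def poly_pcompose lin x_def R_def)
      have p0: "0 \<le> (300 * x) ^ (2 * d + 2)" by (rule zero_le_even_power) simp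
      show ?thesis
      proof (cases "\<bar>x\<bar> \<le> 1")
        case True
        have eq: "rate * R * x = rate * (real j - real t)" using R by (simp add: x_def R_def)
        have "poly sp x - poly sm x \<le> peak j + 2 * (300 * x) ^ (2 * d + 2)"
          using s(5)[OF True] True unfolding peak_def x_def[symmetric] eq by (simp only: if_True)
        then show ?thesis using p0 unfolding e x_def[symmetric] by linarith
      next
        case False
        then show ?thesis using s(6)[of x] unfolding e peak_def x_def[symmetric] by simp
      qed
    qed
    have "E m \<le> W m * (\<Sum>j\<le>N. Bernstein N j (pr m) *
        (peak j + 4 * (300 * ((real j - real t) / (48000 * sigma))) ^ (2 * d + 2)))"
      unfolding E_def using pr_bounds[OF mu]
      by (intro mult_left_mono sum_mono ptw Bernstein_nonneg W_nonneg) auto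
    also have "\<dots> = W m * ((\<Sum>j\<le>N. Bernstein N j (pr m) * peak j) +
        4 * (\<Sum>j\<le>N. Bernstein N j (pr m) * (300 * ((real j - real t) / (48000 * sigma))) ^ (2 * d + 2)))"
      unfolding sum_distrib_left[of 4] sum.distrib[symmetric]
      by (intro arg_cong[of _ _ "(*) (W m)"] sum.cong refl) (simp only: distrib_left mult.left_commute)
    finally show ?thesis by (simp only: distrib_left)
  qed
  define I where "I = real ((t + d) choose d) / real ((N + d) choose d)"
  have I: "(real t / real N) ^ d \<le> I" "0 \<le> I"
    unfolding I_def using power_ratio_le_binomial_ratio[of t N d] tN by auto
  have rho: "sigma / real t = sqrt (real d / real t)" "0 \<le> sigma / real t"
  proof -
    have "real d / real t = (real t * real d) / (real t)\<^sup>2" using pos by (simp add: power2_eq_square)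
    then show "sigma / real t = sqrt (real d / real t)"
      unfolding sigma_def using pos by (simp add: real_sqrt_divide)
    show "0 \<le> sigma / real t" using sigma_pos by simp
  qed
  have "(\<Sum>m<u. E m) = (\<Sum>m\<in>inner. E m) + (\<Sum>m\<in>outer. E m)"
    unfolding split(1) by (rule sum.union_disjoint[OF split(3,4,2)])
  also have "\<dots> \<le> (\<Sum>m\<in>inner. W m * (\<Sum>j\<le>N. Bernstein N j (pr m) * peak j) +
      W m * (4 * (\<Sum>j\<le>N. Bernstein N j (pr m) * (300 * ((real j - real t) / (48000 * sigma))) ^ (2 * d + 2))))
      + (\<Sum>m\<in>outer. W m * (\<Sum>j\<le>N. Bernstein N j (pr m) * ((real j - mean m) / (mean m - real t)) ^ (2 * d + 2)))"
    by (intro add_mono sum_mono E_inner) (auto simp: E_outer)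
  also have "\<dots> \<le> 79626240000 * (sigma / real t) * I + 200 * (sigma / real t) * (real t / real N) ^ d
      + 24 * (sigma / real t) * (real t / real N) ^ d"
    unfolding sum.distrib I_def
    by (intro add_mono peak_error_sum_le inner_moment_sum_le outer_error_sum_le) (auto simp: inner_def outer_def)
  also have "\<dots> \<le> 79626240000 * (sigma / real t) * I + 200 * (sigma / real t) * I + 24 * (sigma / real t) * I"
    using rho I by (intro add_mono mult_left_mono order_refl) auto
  also have "\<dots> = 79626240224 * ((sigma / real t) * I)" by (simp add: algebra_simps)
  also have "\<dots> \<le> 8 * 10 ^ 10 * ((sigma / real t) * I)"
    using rho(2) I(2) by (intro mult_right_mono mult_nonneg_nonneg) auto
  finally have "(\<Sum>m<u. E m) \<le> 8 * 10 ^ 10 * sqrt (real d / real t) * I" by (simp only: rho(1) mult.assoc)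
  then show thesis
    unfolding E_def W_def pr_def I_def by (rule that[OF deg low high])
qed

end

theorem theorem2:
  shows "\<exists>c c' :: real. c > 0 \<and> c' > 0 \<and>
    (\<forall>(\<epsilon>::real) (\<epsilon>'::real) (d::nat) (k::nat) (l::nat) (u::nat) (H :: (nat \<Rightarrow> nat) set).
       0 < \<epsilon> \<and> \<epsilon> < 1 \<and> \<epsilon>' = \<epsilon> / c \<and>
       0 < d \<and> 0 < k \<and> 0 < l \<and>
       real d \<le> real k / c' \<and>
       real k > real d - 1
         + 2 * 8 powr (2 / real l) * ((6 * real l) powr (1 + 1 / real l) / \<epsilon>'\<^sup>2) \<and>
       l \<ge> 3 * d + 2 \<and>
       wise_independent l u H
       \<longrightarrow> approx_min_wise_independent d k \<epsilon> u H)"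
proof (rule exI[of _ "10 ^ 12"], rule exI[of _ 1], intro conjI allI impI)
  fix \<epsilon> \<epsilon>' :: real and d k l u :: nat and H :: "(nat \<Rightarrow> nat) set"
  assume "0 < \<epsilon> \<and> \<epsilon> < 1 \<and> \<epsilon>' = \<epsilon> / 10 ^ 12 \<and> 0 < d \<and> 0 < k \<and> 0 < l \<and> real d \<le> real k / 1 \<and>
       real k > real d - 1
         + 2 * 8 powr (2 / real l) * ((6 * real l) powr (1 + 1 / real l) / \<epsilon>'\<^sup>2) \<and>
       l \<ge> 3 * d + 2 \<and> wise_independent l u H"
  then have e: "0 < \<epsilon>" "\<epsilon> < 1" and e': "\<epsilon>' = \<epsilon> / 10 ^ 12" and d: "1 \<le> d" and dk: "d \<le> k"
    and k: "real k > real d - 1 + 2 * 8 powr (2 / real l) * ((6 * real l) powr (1 + 1 / real l) / \<epsilon>'\<^sup>2)"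
    and l: "3 * d + 2 \<le> l" and H: "wise_independent l u H" by auto
  \<comment> \<open>The witnesses are c = 10^12 and c' = 1. Both powr factors contribute at least 1
    beyond 6 l, so the bound on k yields Q l with Q = 2 * 6 / \<epsilon>'^2.\<close>
  define Q where "Q = 12 * 10 ^ 24 / \<epsilon>\<^sup>2"
  have e2: "0 < \<epsilon>\<^sup>2" "\<epsilon>\<^sup>2 \<le> \<epsilon>" "\<epsilon>\<^sup>2 \<le> 1"
    using e mult_left_mono[of \<epsilon> 1 \<epsilon>] by (auto simp: power2_eq_square mult_le_one)
  have Q: "12 * 10 ^ 24 \<le> Q" "Q * \<epsilon>\<^sup>2 = 12 * 10 ^ 24"
    using e2 by (auto simp: Q_def field_simps)
  have kQ: "real k > real d - 1 + Q * real l"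
  proof -
    have l1: "1 \<le> 6 * real l" using l by simp
    have "2 * 1 * (6 * real l / \<epsilon>'\<^sup>2) \<le> 2 * 8 powr (2 / real l) * ((6 * real l) powr (1 + 1 / real l) / \<epsilon>'\<^sup>2)"
    proof (intro mult_mono divide_right_mono mult_left_mono)
      show "(1::real) \<le> 8 powr (2 / real l)" by (rule ge_one_powr_ge_zero) auto
      have "(6 * real l) powr 1 \<le> (6 * real l) powr (1 + 1 / real l)" using l1 by (intro powr_mono) auto
      then show "6 * real l \<le> (6 * real l) powr (1 + 1 / real l)" using l1 by simp
    qed auto
    moreover have "2 * 1 * (6 * real l / \<epsilon>'\<^sup>2) = Q * real l"
      unfolding e' Q_def by (simp add: power_divide)
    ultimately show ?thesis using k by linarith
  qed
  define t where "t = k - d"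
  have tk: "real t = real k - real d" "t + d = k" using dk by (auto simp: t_def)
  have Q1: "1 \<le> Q" using Q(1) by simp
  have "Q * (3 * real d + 2) \<le> Q * real l" using l Q1 by (intro mult_left_mono) auto
  then have Ql: "3 * (Q * real d) + 2 * Q \<le> Q * real l" by (simp add: algebra_simps)
  have tQ: "3 * (Q * real d) \<le> real t" and lk: "l < k"
  proof -
    show "3 * (Q * real d) \<le> real t" using kQ tk(1) Q1 Ql by linarith
    have "1 * real l \<le> Q * real l" using Q1 by (intro mult_right_mono) auto
    then have "real l < real k" using kQ d by linarith
    then show "l < k" by simp
  qed
  have t: "10 ^ 12 * real d \<le> real t"
  proof -
    have "10 ^ 12 * real d \<le> 3 * Q * real d" using Q(1) by (intro mult_right_mono) auto
    then show ?thesis using tQ by simp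
  qed
  have t0: "real t > 0" using t d by (auto intro: less_le_trans[of 0 "10 ^ 12 * real d"])
  \<comment> \<open>From t >= 3 Q d and Q \<epsilon>^2 = 12 * 10^24; the root of 36 * 10^24 is 6 *
    10^12.\<close>
  have dt: "real d / real t \<le> (\<epsilon> / (6 * 10 ^ 12))\<^sup>2"
  proof -
    have "36 * 10 ^ 24 * real d = 3 * (Q * real d) * \<epsilon>\<^sup>2" using Q(2) by simp
    also have "\<dots> \<le> real t * \<epsilon>\<^sup>2" using tQ e2 by (intro mult_right_mono) auto
    finally show ?thesis using t0 by (simp add: power_divide field_simps)
  qed
  have root: "sqrt (real d / real t) \<le> \<epsilon> / (6 * 10 ^ 12)"
    using real_sqrt_le_mono[OF dt] e by simp
  have hf: "hash_family u H" using H by (simp add: wise_independent_def)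
  show "approx_min_wise_independent d k \<epsilon> u H"
    unfolding approx_min_wise_independent_def
  proof (intro conjI allI impI hf e dk)
    fix n X Y
    assume a: "k < n \<and> X \<subseteq> {..<u} \<and> card X = n - d \<and> Y \<subseteq> {..<u} \<and> card Y = d \<and> X \<inter> Y = {}"
    define N where "N = n - d"
    have N: "card X = N" "t < N" "N + d = n" using a dk by (auto simp: N_def t_def)
    have fin: "finite X" "finite Y" using a by (auto intro: finite_subset)
    \<comment> \<open>Disjointness gives n <= u, and with l < k < n also l <= u, without which the
      independence condition would be vacuous.\<close>
    have "card (X \<union> Y) = n" using card_Un_disjoint[OF fin] a N by simp
    moreover have "card (X \<union> Y) \<le> card {..<u}" using a by (intro card_mono) auto
    ultimately have nu: "n \<le> u" by simp
    have lu: "l \<le> u" using lk a nu by simp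
    define I where "I = real (k choose d) / real (n choose d)"
    have I: "0 \<le> I" by (simp add: I_def)
    define S where "S = (\<Sum>m<u. (real (Suc m) ^ d - real m ^ d) / real u ^ d * Bernstein_cdf N t (real (Suc m) / real u))"
    define P where "P = measure_pmf.prob (pmf_of_set H) {h. RANK d (hash_values h Y) < RANK (k - d + 1) (hash_values h X)}"
    have S: "S \<le> I" "I * (1 - real d / real k) \<le> S"
      using uniform_order_statistic_moment[OF d dk _ nu] a unfolding S_def I_def N_def t_def by auto
    obtain qp qm :: "nat \<Rightarrow> real poly" where q:
      "\<And>m. degree (qp m) \<le> 2 * d + 2" "\<And>m. degree (qm m) \<le> 2 * d + 2"
      "\<And>m j. poly (qm m) (real j) \<le> of_bool (j \<le> t)"
      "\<And>m j. of_bool (j \<le> t) \<le> poly (qp m) (real j)"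
      "(\<Sum>m<u. (real (Suc m) ^ d - real m ^ d) / real u ^ d *
          (\<Sum>j\<le>N. Bernstein N j (real (Suc m) / real u) * (poly (qp m) (real j) - poly (qm m) (real j))))
        \<le> 8 * 10 ^ 10 * sqrt (real d / real t) * (real ((t + d) choose d) / real ((N + d) choose d))"
      using sandwich_error_sum[OF d t N(2), of u] nu N(3) by blast
    have dq: "d + degree (qp m) \<le> l" "d + degree (qm m) \<le> l" for m
      using q(1,2)[of m] l by linarith+
    have "\<bar>P - S\<bar> \<le> (\<Sum>m<u. (real (Suc m) ^ d - real m ^ d) / real u ^ d *
          (\<Sum>j\<le>N. Bernstein N j (real (Suc m) / real u) * (poly (qp m) (real j) - poly (qm m) (real j))))"
      using wise_independent_rank_prob_error[OF H lu _ _ _ _ d, of X Y t qp qm] a N dq q(3,4)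
      unfolding P_def S_def t_def by auto
    also have "\<dots> \<le> 8 * 10 ^ 10 * sqrt (real d / real t) * I"
      using q(5) unfolding N(3) tk(2) I_def .
    also have "\<dots> \<le> 8 * 10 ^ 10 * (\<epsilon> / (6 * 10 ^ 12)) * I"
      using root I by (intro mult_right_mono mult_left_mono) auto
    also have "\<dots> \<le> \<epsilon> / 2 * I" using e I by (intro mult_right_mono) auto
    finally have PS: "\<bar>P - S\<bar> \<le> \<epsilon> / 2 * I" .
    have "real d / real k \<le> real d / real t"
      using tk t0 by (intro divide_left_mono) auto
    also have "\<dots> \<le> \<epsilon> / 2"
    proof -
      have "(\<epsilon> / (6 * 10 ^ 12))\<^sup>2 = \<epsilon>\<^sup>2 / (6 * 10 ^ 12)\<^sup>2" by (rule power_divide)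
      also have "\<dots> \<le> \<epsilon> / 2" using e2 e by (intro frac_le) auto
      finally show ?thesis using dt by linarith
    qed
    finally have "I * (1 - \<epsilon> / 2) \<le> I * (1 - real d / real k)" using I by (intro mult_left_mono) auto
    then have "I * (1 - \<epsilon> / 2) \<le> S" using S(2) by linarith
    \<comment> \<open>One half of \<epsilon> pays for limited independence, the other for the
      rounding of the hash values, which acts only downwards.\<close>
    moreover define J where "J = \<epsilon> / 2 * I"
    ultimately have "I - J \<le> S" "\<bar>P - S\<bar> \<le> J"
      using PS by (auto simp: algebra_simps)
    then have "I - 2 * J \<le> P" "P \<le> I + 2 * J" using S(1) by linarith+
    then have "I * (1 - \<epsilon>) \<le> P" "P \<le> I * (1 + \<epsilon>)" by (simp_all add: J_def algebra_simps)
    then show "measure_pmf.prob (pmf_of_set H) {h. RANK d (hash_values h Y) < RANK (k - d + 1) (hash_values h X)}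
        \<in> {real (k choose d) / real (n choose d) * (1 - \<epsilon>)..real (k choose d) / real (n choose d) * (1 + \<epsilon>)}"
      unfolding P_def I_def by simp
  qed
qed auto

end
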